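(* Let $q$ be a complex number with $0<|q|<1$, and for $r\in\{1,7\}$ put $$u_r:=\frac{f_r f_{3r}}{q^r f_{7r}f_{21r}}.$$ Then $$\begin{aligned}\frac{u_7^3}{u_1^3}={}&\frac{161u_7^2}{u_1}+\frac{112u_7^2}{u_1^2}+196\left(u_1u_7+\frac{49}{u_1u_7}\right)+28\left(u_1^2u_7^2+\frac{7^4}{u_1^2u_7^2}\right)+1372\\&+\frac{980u_7}{u_1}+\frac{1127u_7}{u_1^2}+\left(u_1^4u_7^2+\frac{7^6}{u_1^2u_7^4}\right)+539\left(u_7+\frac{7}{u_1}\right)+343\left(u_1+\frac{7}{u_7}\right)\\&+77\left(u_7^2u_1+\frac{7^3}{u_1^2u_7}\right)+49\left(u_7u_1^2+\frac{7^3}{u_1u_7^2}\right)+7\left(u_7^2u_1^3+\frac{7^5}{u_1^2u_7^3}\right)\\&+49\left(u_1^2+\frac{7^2}{u_7^2}\right)+140\left(u_7^2+\frac{7^2}{u_1^2}\right)+7\left(u_1^3u_7+\frac{7^4}{u_1u_7^3}\right)+\frac{343u_1}{u_7}.\end{aligned}$$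
   Context: For $|q|<1$, $f(-q):=\sum_{n=-\infty}^{\infty}(-1)^n q^{n(3n-1)/2}$, and $f_n:=f(-q^n)$ for positive integers $n$ (so $f_n$ is $f(-x)$ evaluated at $x=q^n$). *)

theory Defs
  imports "HOL-Analysis.Analysis"
begin

text \<open>
  \<open>f_neg q\<close> is the value usually written \<open>f(-q)\<close>, as a bilateral series over the integers.
  The series converges absolutely for \<open>norm q < 1\<close>, so the unordered sum is the usual one; the
  exponent \<open>n (3 n - 1) / 2\<close> is always a nonnegative integer and the division is exact.
\<close>

definition f_neg :: "complex \<Rightarrow> complex" where
  "f_neg q = (\<Sum>\<^sub>\<infinity>n\<in>(UNIV :: int set). (- 1) powi n * q powi (n * (3 * n - 1) div 2))"

definition f_sub :: "nat \<Rightarrow> complex \<Rightarrow> complex" where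
  "f_sub n q = f_neg (q ^ n)"

definition u_quot :: "nat \<Rightarrow> complex \<Rightarrow> complex" where
  "u_quot r q = f_sub r q * f_sub (3 * r) q / (q ^ r * f_sub (7 * r) q * f_sub (21 * r) q)"

end

theory Submission
  imports Defs "HOL-Complex_Analysis.Complex_Analysis" "HOL-Probability.Characteristic_Functions"
begin

text \<open>
  With \<open>q = exp (2 \<pi> i \<tau>)\<close>, \<open>u\<^sub>1\<close> is the eta quotient \<open>h(\<tau>) = \<eta>(\<tau>) \<eta>(3\<tau>) / (\<eta>(7\<tau>) \<eta>(21\<tau>))\<close> and \<open>u\<^sub>7 = h(7\<tau>)\<close>.
  The inversion formula for \<open>\<eta>\<close> follows from Poisson summation on the imaginary axis. It gives
  \<open>h(-1/(21\<tau>)) = 7 / h(\<tau>)\<close>, and it shows that under the elements of \<open>\<Gamma>\<^sub>0(21)+3\<close> the function \<open>h\<close> is multiplied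
  by constants, which are \<open>1\<close> for elliptic elements. The difference \<open>E\<close> of the two sides of the claimed equation has
  fourteen translates under \<open>\<Gamma>\<^sub>0(21)+\<close>, whose product is invariant under this group. The group has a single
  cusp, where the translates \<open>E((\<tau> + j) / 7)\<close> and \<open>E(\<tau>)\<close> vanish (by expansion in \<open>q\<close>) and the other six remain bounded
  (because \<open>1 + \<zeta> + \<dots> + \<zeta>\<^sup>6 = 0\<close>). By the maximum modulus principle the product is \<open>0\<close>, hence so is \<open>E\<close>.
\<close>

section \<open>The pentagonal number theorem\<close>

text \<open>The obstacle is that \<open>hm \<tau>\<close> and \<open>hm (7 * \<tau>)\<close>
  together live at level 147, where there are several inequivalent cusps while expansions are cheap
  only at infinity. The orbit product trades those cusps for a single one, at the price of having to
  recover one factor from a vanishing product. Its factors belong to the seven points (\<tau> + j) /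
  7 and, exchanged with these by the Fricke involution, to 7 \<tau> and the six points \<tau> + k /
  7. A second obstacle is the multiplier system of eta, which would involve Dedekind sums. It is
  bypassed: only the transformation of the 24th power of eta is proved, and the remaining root of
  unity is read off at a fixed point. So, besides translations and the Fricke involution, the
  symmetries are built from elliptic elements. The product formula for \<open>f_neg\<close> enters
  only to show that \<open>f_neg\<close> has no zeros; all other facts come from the series. At
  infinity the equation has a pole of order 18, so 19 coefficients must cancel; at the six other
  translates the order is 2 and two coefficients suffice.\<close>

lemma has_sum_int_iff_nat:
  fixes f :: "int \<Rightarrow> 'a :: {comm_monoid_add, t2_space, topological_comm_monoid_add}"
  assumes "((\<lambda>n. f (int n)) has_sum a) UNIV" "((\<lambda>n. f (- int (Suc n))) has_sum b) UNIV"
  shows "(f has_sum (a + b)) UNIV"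
proof -
  have 1: "(f has_sum a) (range int)"
    using assms(1) by (subst has_sum_reindex) (auto simp: o_def)
  have 2: "(f has_sum b) (range (\<lambda>n. - int (Suc n)))"
    using assms(2) by (subst has_sum_reindex) (auto simp: o_def inj_def)
  have "range int \<union> range (\<lambda>n. - int (Suc n)) = UNIV"
    unfolding set_eq_iff by (metis Un_iff UNIV_I int_cases rangeI)
  moreover have "range int \<inter> range (\<lambda>n. - int (Suc n)) = {}"
    by auto
  ultimately show ?thesis
    using has_sum_Un_disjoint[OF 1 2] by simp
qed

text \<open>The exponents at the indices n and -n. At n = 0 the truncated \<open>3 * n - 1\<close>
  is harmless because the factor n vanishes.\<close>

definition pent1 :: "nat \<Rightarrow> nat" where "pent1 n = n * (3 * n - 1) div 2"
definition pent2 :: "nat \<Rightarrow> nat" where "pent2 n = n * (3 * n + 1) div 2"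

lemma two_pent1: "2 * pent1 n = n * (3 * n - 1)"
  unfolding pent1_def by (intro dvd_mult_div_cancel) (cases n; simp)

lemma two_pent2: "2 * pent2 n = n * (3 * n + 1)"
  unfolding pent2_def by (intro dvd_mult_div_cancel) simp

lemma pent_exponent_nonneg: "int n * (3 * int n - 1) div 2 = int (pent1 n)"
proof -
  have "int n * (3 * int n - 1) = int (2 * pent1 n)"
    unfolding two_pent1 by (cases n) (auto simp: algebra_simps)
  thus ?thesis by simp
qed

lemma pent_exponent_neg: "(- int n) * (3 * (- int n) - 1) div 2 = int (pent2 n)"
proof -
  have "(- int n) * (3 * (- int n) - 1) = int (2 * pent2 n)"
    unfolding two_pent2 by (auto simp: algebra_simps)
  thus ?thesis by simp
qed

lemma pent1_ge: "n \<le> pent1 n"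
proof -
  have "2 * n \<le> 2 * pent1 n"
    unfolding two_pent1 by (cases n) auto
  thus ?thesis by simp
qed

lemma pent2_ge: "n \<le> pent2 n"
proof -
  have "2 * n \<le> 2 * pent2 n"
    unfolding two_pent2 by (cases n) auto
  thus ?thesis by simp
qed

lemma f_neg_has_sum_int:
  assumes "norm q < 1"
  shows "((\<lambda>n::int. (- 1) powi n * q powi (n * (3 * n - 1) div 2)) has_sum f_neg q) UNIV"
    and "f_neg q = (\<Sum>n. (-1) ^ n * q ^ pent1 n) + (\<Sum>n. (-1) ^ Suc n * q ^ pent2 (Suc n))"
    and "summable (\<lambda>n. norm ((-1) ^ n * q ^ pent1 n))"
    and "summable (\<lambda>n. norm ((-1) ^ Suc n * q ^ pent2 (Suc n)))"
proof -
  have geo: "summable (\<lambda>n. norm q ^ n)"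
    using assms by (simp add: summable_geometric)
  show s1: "summable (\<lambda>n. norm ((-1) ^ n * q ^ pent1 n))"
    by (rule summable_comparison_test'[OF geo, of 0])
       (use assms pent1_ge in \<open>auto simp: norm_mult norm_power intro!: power_decreasing\<close>)
  show s2: "summable (\<lambda>n. norm ((-1) ^ Suc n * q ^ pent2 (Suc n)))"
    by (rule summable_comparison_test'[OF geo, of 0])
       (use assms Suc_leD[OF pent2_ge] in \<open>auto simp: norm_mult norm_power intro!: power_decreasing\<close>)
  let ?f = "\<lambda>n::int. (- 1) powi n * q powi (n * (3 * n - 1) div 2)"
  have e1: "?f (int n) = (-1) ^ n * q ^ pent1 n" for n
    by (simp only: pent_exponent_nonneg power_int_of_nat)
  have e2: "?f (- int (Suc n)) = (-1) ^ Suc n * q ^ pent2 (Suc n)" for n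
    unfolding pent_exponent_neg power_int_of_nat
    by (simp add: power_int_minus power_int_of_nat power_inverse[symmetric] del: of_nat_Suc)
  have h1: "((\<lambda>n. ?f (int n)) has_sum (\<Sum>n. (-1) ^ n * q ^ pent1 n)) UNIV"
    unfolding e1 using s1 by (intro norm_summable_imp_has_sum summable_sums summable_norm_cancel[OF s1])
  have h2: "((\<lambda>n. ?f (- int (Suc n))) has_sum (\<Sum>n. (-1) ^ Suc n * q ^ pent2 (Suc n))) UNIV"
    unfolding e2 using s2 by (intro norm_summable_imp_has_sum summable_sums summable_norm_cancel[OF s2])
  have h: "(?f has_sum ((\<Sum>n. (-1) ^ n * q ^ pent1 n) + (\<Sum>n. (-1) ^ Suc n * q ^ pent2 (Suc n)))) UNIV"
    by (rule has_sum_int_iff_nat[OF h1 h2])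
  show eq: "f_neg q = (\<Sum>n. (-1) ^ n * q ^ pent1 n) + (\<Sum>n. (-1) ^ Suc n * q ^ pent2 (Suc n))"
    unfolding f_neg_def using infsumI[OF h] .
  show "(?f has_sum f_neg q) UNIV"
    using h unfolding eq .
qed

lemma f_neg_sums:
  assumes "norm q < 1"
  shows "(\<lambda>n. (-1) ^ Suc n * (q ^ pent1 (Suc n) + q ^ pent2 (Suc n))) sums (f_neg q - 1)"
proof -
  note f = f_neg_has_sum_int[OF assms]
  have "(\<lambda>n. (-1) ^ n * q ^ pent1 n) sums (\<Sum>n. (-1) ^ n * q ^ pent1 n)"
    by (rule summable_sums[OF summable_norm_cancel[OF f(3)]])
  hence "(\<lambda>n. (-1) ^ Suc n * q ^ pent1 (Suc n)) sums ((\<Sum>n. (-1) ^ n * q ^ pent1 n) - 1)"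
    using sums_Suc_iff[of "\<lambda>n. (-1) ^ n * q ^ pent1 n" "(\<Sum>n. (-1) ^ n * q ^ pent1 n) - 1"]
    by (simp only: diff_add_cancel pent1_def mult_zero_left div_0 power_0 mult_1_left)
  moreover have "(\<lambda>n. (-1) ^ Suc n * q ^ pent2 (Suc n)) sums (\<Sum>n. (-1) ^ Suc n * q ^ pent2 (Suc n))"
    by (rule summable_sums[OF summable_norm_cancel[OF f(4)]])
  ultimately have "(\<lambda>n. (-1) ^ Suc n * q ^ pent1 (Suc n) + (-1) ^ Suc n * q ^ pent2 (Suc n)) sums
      ((\<Sum>n. (-1) ^ n * q ^ pent1 n) - 1 + (\<Sum>n. (-1) ^ Suc n * q ^ pent2 (Suc n)))"
    by (rule sums_add)
  thus ?thesis
    unfolding f(2) by (simp add: algebra_simps)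
qed

text \<open>Shanks' finite form of Euler's pentagonal number theorem: as \<open>n\<close> grows, only the term \<open>s = 0\<close> survives.\<close>

lemma shanks_identity:
  fixes q :: "'a :: comm_ring_1"
  shows "(\<Sum>s\<le>n. (-1) ^ s * (\<Prod>j\<in>{s<..n}. 1 - q ^ j) * q ^ (s * n + s * (s + 1) div 2)) =
    1 + (\<Sum>k<n. (-1) ^ Suc k * (q ^ pent1 (Suc k) + q ^ pent2 (Suc k)))"
proof (induction n)
  case (Suc n)
  define tri where "tri s = s * (s + 1) div 2" for s :: nat
  have tri_Suc: "tri (Suc s) = tri s + Suc s" for s
    unfolding tri_def by simp
  define a where "a m s = (-1) ^ s * (\<Prod>j\<in>{s<..m}. 1 - q ^ j) * q ^ (s * m + tri s)" for m s :: nat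
  \<comment> \<open>A telescoping certificate: passing from n to n + 1 changes the s-th summand by
    \<open>c (Suc s) - c s\<close>. The value 0 at s = 0 stands for the factor
    \<open>1 - q ^ 0\<close> of \<open>cs\<close>, which the product would miss because
    \<open>s - 1\<close> is truncated there.\<close>
  define c where "c s = (if s = 0 then 0 else (-1) ^ s * (\<Prod>j\<in>{s-1<..n}. 1 - q ^ j) * q ^ (s * n + tri s))" for s
  have step: "a (Suc n) s - a n s = c (Suc s) - c s" if "s \<le> n" for s
  proof -
    have ins: "{s<..Suc n} = insert (Suc n) {s<..n}"
      using that by auto
    have p1: "(\<Prod>j\<in>{s<..Suc n}. 1 - q ^ j) = (1 - q ^ Suc n) * (\<Prod>j\<in>{s<..n}. 1 - q ^ j)"
      unfolding ins by (subst prod.insert) auto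
    have cs: "c s = (-1) ^ s * ((1 - q ^ s) * (\<Prod>j\<in>{s<..n}. 1 - q ^ j)) * q ^ (s * n + tri s)"
    proof (cases "s = 0")
      case False
      have "{s-1<..n} = insert s {s<..n}"
        using that False by auto
      hence "(\<Prod>j\<in>{s-1<..n}. 1 - q ^ j) = (1 - q ^ s) * (\<Prod>j\<in>{s<..n}. 1 - q ^ j)"
        by (simp add: prod.insert)
      thus ?thesis using False by (simp add: c_def)
    qed (simp add: c_def)
    have cS: "c (Suc s) = - ((-1) ^ s * (\<Prod>j\<in>{s<..n}. 1 - q ^ j) * q ^ (s * n + tri s) * q ^ (n + Suc s))"
      by (simp add: c_def tri_Suc power_add algebra_simps)
    have aS: "a (Suc n) s = (-1) ^ s * ((1 - q ^ Suc n) * (\<Prod>j\<in>{s<..n}. 1 - q ^ j)) * (q ^ (s * n + tri s) * q ^ s)"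
      unfolding a_def p1 by (simp add: power_add algebra_simps)
    show ?thesis
      unfolding cs cS aS unfolding a_def by (simp add: power_add algebra_simps)
  qed
  have tr: "2 * tri s = s * (s + 1)" for s
    unfolding tri_def by simp
  \<comment> \<open>The two new terms on the right arise separately: the telescoped boundary value
    \<open>c (Suc n)\<close> has exponent \<open>pent1 (Suc n)\<close>, the new summand s = n + 1
    has exponent \<open>pent2 (Suc n)\<close>.\<close>
  have "(\<Sum>s\<le>Suc n. a (Suc n) s) = (\<Sum>s\<le>n. a n s) + (\<Sum>s\<le>n. a (Suc n) s - a n s) + a (Suc n) (Suc n)"
    by (simp add: sum_subtractf)
  also have "(\<Sum>s\<le>n. a (Suc n) s - a n s) = (\<Sum>s\<le>n. c (Suc s) - c s)"
    by (rule sum.cong) (auto simp: step)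
  also have "\<dots> = c (Suc n)"
    using sum_Suc_diff[of 0 n c] by (simp add: atLeast0AtMost[symmetric] c_def del: power_Suc)
  also have "Suc n * n + tri (Suc n) = pent1 (Suc n)"
  proof -
    have "2 * (Suc n * n + tri (Suc n)) = 2 * pent1 (Suc n)"
      unfolding distrib_left tr two_pent1 by (simp add: algebra_simps)
    thus ?thesis by simp
  qed
  hence "c (Suc n) = (-1) ^ Suc n * q ^ pent1 (Suc n)"
    by (simp add: c_def)
  also have "Suc n * Suc n + tri (Suc n) = pent2 (Suc n)"
  proof -
    have "2 * (Suc n * Suc n + tri (Suc n)) = 2 * pent2 (Suc n)"
      unfolding distrib_left tr two_pent2 by (simp add: algebra_simps)
    thus ?thesis by simp
  qed
  hence "a (Suc n) (Suc n) = (-1) ^ Suc n * q ^ pent2 (Suc n)"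
    by (simp add: a_def)
  finally show ?case
    using Suc.IH unfolding a_def tri_def by (simp add: algebra_simps)
qed auto

text \<open>Each of the n summands with s \<ge> 1 in Shanks' sum carries at least the power
  \<open>q ^ n\<close>, times a partial product bounded by C because 1 + x \<le> exp x. Together
  they are at most C n |q|^n, which tends to 0.\<close>

theorem pentagonal_number:
  fixes q :: complex
  assumes "norm q < 1"
  shows "(\<lambda>n. \<Prod>j\<in>{0<..n}. 1 - q ^ j) \<longlonglongrightarrow> f_neg q"
proof -
  define P where "P s n = (\<Prod>j\<in>{s<..n}. 1 - q ^ j)" for s n :: nat
  define a where "a n s = (-1) ^ s * P s n * q ^ (s * n + s * (s + 1) div 2)" for n s :: nat
  define C where "C = exp (1 / (1 - norm q))"
  have P_bound: "norm (P s n) \<le> C" for s n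
  proof -
    have "norm (P s n) \<le> (\<Prod>j\<in>{s<..n}. 1 + norm q ^ j)"
      unfolding P_def prod_norm[symmetric]
      by (intro prod_mono) (auto intro: order.trans[OF norm_triangle_ineq4] simp: norm_power)
    also have "\<dots> \<le> (\<Prod>j\<in>{s<..n}. exp (norm q ^ j))"
      by (intro prod_mono) auto
    also have "\<dots> = exp (\<Sum>j\<in>{s<..n}. norm q ^ j)"
      by (simp add: exp_sum)
    also have "(\<Sum>j\<in>{s<..n}. norm q ^ j) \<le> (\<Sum>j. norm q ^ j)"
      using assms by (intro sum_le_suminf) (auto simp: summable_geometric)
    also have "(\<Sum>j. norm q ^ j) = 1 / (1 - norm q)"
      using assms by (simp add: suminf_geometric)
    finally show ?thesis by (simp add: C_def)
  qed
  have "(\<lambda>n. 1 + (\<Sum>k<n. (-1) ^ Suc k * (q ^ pent1 (Suc k) + q ^ pent2 (Suc k)))) \<longlonglongrightarrow> 1 + (f_neg q - 1)"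
    using f_neg_sums[OF assms] unfolding sums_def by (intro tendsto_intros)
  hence lim: "(\<lambda>n. \<Sum>s\<le>n. a n s) \<longlonglongrightarrow> f_neg q"
    unfolding shanks_identity[symmetric] a_def P_def by simp
  have bound: "norm ((\<Sum>s\<le>n. a n s) - P 0 n) \<le> C * (real n * norm q ^ n)" for n
  proof -
    have "(\<Sum>s\<le>n. a n s) = a n 0 + (\<Sum>s\<in>{1..n}. a n s)"
      by (simp add: atMost_atLeast0 sum.atLeast_Suc_atMost)
    moreover have "a n 0 = P 0 n"
      by (simp add: a_def)
    ultimately have "norm ((\<Sum>s\<le>n. a n s) - P 0 n) = norm (\<Sum>s\<in>{1..n}. a n s)"
      by simp
    also have "\<dots> \<le> (\<Sum>s\<in>{1..n}. C * norm q ^ n)"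
    proof (rule sum_norm_le)
      fix s assume s: "s \<in> {1..n}"
      have "norm (a n s) = norm (P s n) * norm q ^ (s * n + s * (s + 1) div 2)"
        by (simp add: a_def norm_mult norm_power)
      also have "\<dots> \<le> C * norm q ^ n"
      proof (intro mult_mono P_bound power_decreasing)
        have "1 * n \<le> s * n" using s by (intro mult_right_mono) auto
        thus "n \<le> s * n + s * (s + 1) div 2" by linarith
      qed (use assms in \<open>auto simp: C_def\<close>)
      finally show "norm (a n s) \<le> C * norm q ^ n" .
    qed
    finally show ?thesis by (simp add: mult_ac)
  qed
  have "(\<lambda>n. C * (real n * norm q ^ n)) \<longlonglongrightarrow> C * 0"
    by (rule tendsto_mult_left, rule powser_times_n_limit_0) (use assms in simp)
  hence "(\<lambda>n. (\<Sum>s\<le>n. a n s) - P 0 n) \<longlonglongrightarrow> 0"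
    using Lim_null_comparison[OF always_eventually[OF allI[OF bound]]] by simp
  from tendsto_diff[OF lim this] show ?thesis
    by (simp add: P_def)
qed

text \<open>A convergent product vanishes only if one of its factors does. This makes
  \<open>hm\<close> and its reciprocal holomorphic, so that the modular equation may divide by both
  unknowns.\<close>

lemma f_neg_nonzero:
  assumes "norm q < 1"
  shows "f_neg q \<noteq> 0"
proof -
  have "summable (\<lambda>j. norm (q ^ Suc j))"
    using assms by (simp add: norm_mult norm_power summable_mult summable_geometric)
  hence "abs_convergent_prod (\<lambda>j. 1 - q ^ Suc j)"
    by (intro summable_imp_abs_convergent_prod) simp
  hence conv: "convergent_prod (\<lambda>j. 1 - q ^ Suc j)"
    by (rule abs_convergent_prod_imp_convergent_prod)
  have "(\<lambda>n. \<Prod>j\<le>n. 1 - q ^ Suc j) \<longlonglongrightarrow> (\<Prod>j. 1 - q ^ Suc j)"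
    using conv by (rule convergent_prod_LIMSEQ)
  moreover have "(\<Prod>j\<le>n. 1 - q ^ Suc j) = (\<Prod>j\<in>{0<..Suc n}. 1 - q ^ j)" for n
    by (rule prod.reindex_bij_witness[of _ "\<lambda>j. j - 1" Suc]) auto
  ultimately have "(\<lambda>n. \<Prod>j\<in>{0<..Suc n}. 1 - q ^ j) \<longlonglongrightarrow> (\<Prod>j. 1 - q ^ Suc j)"
    by simp
  moreover have "(\<lambda>n. \<Prod>j\<in>{0<..Suc n}. 1 - q ^ j) \<longlonglongrightarrow> f_neg q"
    using pentagonal_number[OF assms] by (rule LIMSEQ_Suc)
  ultimately have "f_neg q = (\<Prod>j. 1 - q ^ Suc j)"
    by (rule LIMSEQ_unique[symmetric])
  moreover have "1 - q ^ Suc j \<noteq> 0" for j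
  proof
    assume "1 - q ^ Suc j = 0"
    hence "norm (q ^ Suc j) = 1" by simp
    moreover have "norm (q ^ Suc j) < 1"
      using assms unfolding norm_power by (subst power_less_one_iff) auto
    ultimately show False by simp
  qed
  ultimately show ?thesis
    using prodinf_nonzero[OF conv] by simp
qed

section \<open>Holomorphy and initial coefficients of \<open>f_neg\<close>\<close>

lemma f_neg_holomorphic: "f_neg holomorphic_on ball 0 1"
proof -
  define g where "g n q = 1 + (\<Sum>k<n. (-1) ^ Suc k * (q ^ pent1 (Suc k) + q ^ pent2 (Suc k)))"
    for n and q :: complex
  show ?thesis
  proof (rule holomorphic_uniform_sequence[where f = g])
    show "g n holomorphic_on ball 0 1" for n
      unfolding g_def by (intro holomorphic_intros)
    fix x :: complex assume x: "x \<in> ball 0 1"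
    define r where "r = (1 + norm x) / 2"
    have r: "norm x < r" "r < 1" "0 < r"
      using x norm_ge_zero[of x] unfolding r_def by (auto simp del: norm_ge_zero)
    have lim: "uniform_limit (cball 0 r) g f_neg sequentially"
    proof -
      have s: "summable (\<lambda>k. 2 * r ^ Suc k)"
        using r by (intro summable_mult) (simp add: summable_mult summable_geometric)
      have "uniform_limit (cball 0 r) (\<lambda>n q. \<Sum>k<n. (-1) ^ Suc k * (q ^ pent1 (Suc k) + q ^ pent2 (Suc k)))
         (\<lambda>q. f_neg q - 1) sequentially"
      proof -
        have b: "norm ((-1) ^ Suc k * (q ^ pent1 (Suc k) + q ^ pent2 (Suc k))) \<le> 2 * r ^ Suc k"
          if q: "q \<in> cball 0 r" for k and q :: complex
        proof -
          have b: "norm (q ^ m) \<le> r ^ Suc k" if "m \<ge> Suc k" for m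
          proof -
            have "norm (q ^ m) \<le> r ^ m" using q by (simp add: norm_power power_mono)
            also have "\<dots> \<le> r ^ Suc k" using r that by (intro power_decreasing) auto
            finally show ?thesis .
          qed
          have "norm (q ^ pent1 (Suc k) + q ^ pent2 (Suc k)) \<le> r ^ Suc k + r ^ Suc k"
            by (intro norm_triangle_mono b pent1_ge pent2_ge)
          thus ?thesis
            by (simp add: norm_mult norm_power)
        qed
        have eq: "(\<Sum>k. (-1) ^ Suc k * (q ^ pent1 (Suc k) + q ^ pent2 (Suc k))) = f_neg q - 1"
          if "q \<in> cball 0 r" for q :: complex
          using that r by (intro sums_unique[symmetric] f_neg_sums) auto
        have W: "uniform_limit (cball 0 r)
            (\<lambda>n (q::complex). \<Sum>k<n. (-1) ^ Suc k * (q ^ pent1 (Suc k) + q ^ pent2 (Suc k)))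
            (\<lambda>q. \<Sum>k. (-1) ^ Suc k * (q ^ pent1 (Suc k) + q ^ pent2 (Suc k))) sequentially"
          by (rule Weierstrass_m_test[where f = "\<lambda>k q. (-1) ^ Suc k * (q ^ pent1 (Suc k) + q ^ pent2 (Suc k))", OF _ s])
             (rule b)
        show ?thesis
          by (rule uniform_limit_cong'[THEN iffD1, OF _ _ W]) (rule refl, rule eq)
      qed
      hence "uniform_limit (cball 0 r) g (\<lambda>q. 1 + (f_neg q - 1)) sequentially"
        unfolding g_def by (intro uniform_limit_intros)
      thus ?thesis by simp
    qed
    have "cball x (r - norm x) \<subseteq> cball 0 r"
      by (simp add: subset_cball norm_minus_commute cball_subset_cball_iff)
    moreover have "cball 0 r \<subseteq> ball (0::complex) 1" using r by auto
    ultimately show "\<exists>d>0. cball x d \<subseteq> ball 0 1 \<and> uniform_limit (cball x d) g f_neg sequentially"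
      using r uniform_limit_on_subset[OF lim] by (intro exI[of _ "r - norm x"]) auto
  qed auto
qed

text \<open>The first omitted exponent is \<open>pent1 4 = 22\<close>, beyond the 19 coefficients
  needed at the cusp. For |q| < 1/2 the n-th omitted pair is at most 2 |q|^22 / 2^n, which sums to
  the constant 4.\<close>

lemma f_neg_bigo:
  "(\<lambda>q. f_neg q - (1 - q - q^2 + q^5 + q^7 - q^12 - q^15)) \<in> O[at 0](\<lambda>q. q ^ 22)"
proof (rule bigoI[of _ 4], unfold eventually_at, intro exI[of _ "1/2"] conjI ballI impI)
  fix q :: complex assume "q \<in> UNIV" "q \<noteq> 0 \<and> dist q 0 < 1/2"
  hence q: "norm q < 1 / 2" "q \<noteq> 0" by auto
  define f where "f n = (-1) ^ Suc n * (q ^ pent1 (Suc n) + q ^ pent2 (Suc n))" for n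
  have "f sums (f_neg q - 1)"
    unfolding f_def using q by (intro f_neg_sums) auto
  hence 1: "(\<lambda>n. f (n + 3)) sums (f_neg q - 1 - (\<Sum>i<3. f i))"
    by (subst sums_iff_shift) simp
  have 2: "f_neg q - 1 - (\<Sum>i<3. f i) = f_neg q - (1 - q - q^2 + q^5 + q^7 - q^12 - q^15)"
  proof -
    have "pent1 (Suc 0) = 1" "pent1 (Suc 1) = 5" "pent1 (Suc 2) = 12"
         "pent2 (Suc 0) = 2" "pent2 (Suc 1) = 7" "pent2 (Suc 2) = 15"
      by (simp_all add: pent1_def pent2_def)
    moreover have "{..<3::nat} = {0, 1, 2}" by auto
    ultimately show ?thesis by (simp add: f_def)
  qed
  have p: "22 + n \<le> pent1 (Suc (n+3))" "22 + n \<le> pent2 (Suc (n+3))" for n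
  proof -
    have "2 * (22 + n) \<le> 2 * pent1 (Suc (n+3))" unfolding two_pent1 by (simp add: algebra_simps)
    thus "22 + n \<le> pent1 (Suc (n+3))" by simp
    have "2 * (22 + n) \<le> 2 * pent2 (Suc (n+3))" unfolding two_pent2 by (simp add: algebra_simps)
    thus "22 + n \<le> pent2 (Suc (n+3))" by simp
  qed
  have b: "norm (f (n+3)) \<le> 2 * norm q ^ 22 * (1/2) ^ n" for n
  proof -
    have "norm (q ^ m) \<le> norm q ^ 22 * (1/2) ^ n" if "22 + n \<le> m" for m
    proof -
      have "norm (q ^ m) \<le> norm q ^ (22 + n)"
        using q that unfolding norm_power by (intro power_decreasing) auto
      also have "\<dots> = norm q ^ 22 * norm q ^ n" by (rule power_add)
      also have "\<dots> \<le> norm q ^ 22 * (1/2) ^ n" using q by (intro mult_left_mono power_mono) auto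
      finally show ?thesis .
    qed
    from this[OF p(1)[of n]] this[OF p(2)[of n]] show ?thesis
      unfolding f_def by (auto simp: norm_mult norm_power intro!: order.trans[OF norm_triangle_ineq])
  qed
  have s: "(\<lambda>n. 2 * norm q ^ 22 * (1/2) ^ n) sums (2 * norm q ^ 22 * 2)"
    using geometric_sums[of "1/2 :: real"] by (intro sums_mult) simp
  have "norm (\<Sum>n. f (n+3)) \<le> (\<Sum>n. 2 * norm q ^ 22 * (1/2) ^ n)"
    using b s by (intro norm_suminf_le) (auto simp: sums_iff)
  thus "norm (f_neg q - (1 - q - q^2 + q^5 + q^7 - q^12 - q^15)) \<le> 4 * norm (q ^ 22)"
    using 1 2 s by (simp add: sums_iff norm_power)
qed auto

section \<open>Poisson summation for Gaussians\<close>

lemma integral_shift_cos: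
  fixes g :: "real \<Rightarrow> real"
  assumes "continuous_on UNIV g"
  shows "integral {0..1} (\<lambda>x. g (x + of_int k) * cos (2 * pi * real m * x)) =
    integral {of_int k..of_int k + 1} (\<lambda>x. g x * cos (2 * pi * real m * x))"
proof -
  have c: "cos (2 * pi * real m * (x + of_int k)) = cos (2 * pi * real m * x)" for x
  proof -
    have "2 * pi * real m * (x + of_int k) = 2 * pi * real m * x + of_int (int m * k) * (2 * pi)"
      by (simp add: algebra_simps)
    thus ?thesis
      by (simp only: cos_add sin_int_2pin cos_int_2pin mult.commute[of _ "2 * pi"] mult_1_right mult_zero_right diff_zero)
  qed
  have "integral {0..1} ((\<lambda>x. g x * cos (2 * pi * real m * x)) \<circ> (\<lambda>x. x + of_int k)) =
     integral {0 + of_int k..1 + of_int k} (\<lambda>x. g x * cos (2 * pi * real m * x))"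
    by (rule integral_shift) (intro continuous_intros continuous_on_subset[OF assms] subset_UNIV)
  thus ?thesis by (simp add: o_def c add.commute)
qed

text \<open>Unfolding: the integer translates of [0, 1] tile [-N, N], and the cosine has period 1.
  Pairing the shifts n and -(n + 1) makes each step extend the interval by one unit at both
  ends.\<close>

lemma integral_unfold:
  fixes g :: "real \<Rightarrow> real"
  assumes "continuous_on UNIV g"
  shows "integral {0..1} (\<lambda>x. (\<Sum>n<N. g (x + real n) + g (x - real (Suc n))) * cos (2 * pi * real m * x)) =
    integral {- real N..real N} (\<lambda>x. g x * cos (2 * pi * real m * x))"
proof (induction N)
  case (Suc N)
  let ?c = "\<lambda>x. cos (2 * pi * real m * x)"
  have cont: "continuous_on A (\<lambda>x. g (x + c))" "continuous_on A (\<lambda>x. g (x - c))" for A c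
    by (rule continuous_on_compose2[OF assms]; auto intro!: continuous_intros)+
  have int: "f integrable_on {a..b}" if "continuous_on {a..b} f" for f :: "real \<Rightarrow> real" and a b
    using that by (rule integrable_continuous_interval)
  have contg: "continuous_on A g" for A by (rule continuous_on_subset[OF assms]) auto
  have i: "(\<lambda>x. g x * ?c x) integrable_on {a..b}" for a b
    by (intro int continuous_intros contg)
  have "integral {0..1} (\<lambda>x. (\<Sum>n<Suc N. g (x + real n) + g (x - real (Suc n))) * ?c x) =
    integral {0..1} (\<lambda>x. (\<Sum>n<N. g (x + real n) + g (x - real (Suc n))) * ?c x + (g (x + real N) * ?c x + g (x - real (Suc N)) * ?c x))"
    by (simp add: algebra_simps)
  also have "\<dots> = integral {0..1} (\<lambda>x. (\<Sum>n<N. g (x + real n) + g (x - real (Suc n))) * ?c x) +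
     (integral {0..1} (\<lambda>x. g (x + real N) * ?c x) + integral {0..1} (\<lambda>x. g (x - real (Suc N)) * ?c x))"
    by (subst integral_add integral_add[of "\<lambda>x. g (x + real N) * ?c x"];
        (intro int continuous_intros cont)?)+ simp
  also have "integral {0..1} (\<lambda>x. g (x + real N) * ?c x) = integral {real N..real N + 1} (\<lambda>x. g x * ?c x)"
    using integral_shift_cos[OF assms, of "int N" m] by simp
  also have "integral {0..1} (\<lambda>x. g (x - real (Suc N)) * ?c x) = integral {- real (Suc N)..- real N} (\<lambda>x. g x * ?c x)"
    using integral_shift_cos[OF assms, of "- int (Suc N)" m] by (simp add: algebra_simps)
  also note Suc.IH
  also have "integral {- real N..real N} (\<lambda>x. g x * ?c x) + (integral {real N..real N + 1} (\<lambda>x. g x * ?c x) +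
     integral {- real (Suc N)..- real N} (\<lambda>x. g x * ?c x)) = integral {- real (Suc N)..real (Suc N)} (\<lambda>x. g x * ?c x)"
    using Henstock_Kurzweil_Integration.integral_combine[OF _ _ i, of "- real (Suc N)" "- real N" "real (Suc N)"]
      Henstock_Kurzweil_Integration.integral_combine[OF _ _ i, of "- real N" "real N" "real (Suc N)"]
    by (simp add: add.commute)
  finally show ?case .
qed auto

text \<open>An even 1-periodic function is a function of \<open>cos (2 \<pi> x)\<close>, so Weierstrass approximation in this variable suffices.\<close>

lemma fourier_unique_even:
  fixes D :: "real \<Rightarrow> real"
  assumes cont: "continuous_on {0..1} D"
    and sym: "\<And>x. D (1 - x) = D x"
    and coeff: "\<And>m. integral {0..1} (\<lambda>x. D x * cos (2 * pi * real m * x)) = 0"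
    and x: "x \<in> {0..1}"
  shows "D x = 0"
proof -
  have int: "f integrable_on {0..1}" if "continuous_on {0..1} f" for f :: "real \<Rightarrow> real"
    using that by (rule integrable_continuous_interval)
  \<comment> \<open>\<open>arccos\<close> reaches only the half period [0, 1/2]; the reflection x ->
    1 - x supplies the other half.\<close>
  define p where "p s = D (arccos s / (2 * pi))" for s
  have p_cont: "continuous_on {-1..1} p"
    unfolding p_def
    by (rule continuous_on_compose2[OF cont])
       (auto intro!: continuous_intros simp: arccos_lbound divide_simps,
        smt (verit) arccos_ubound pi_gt_zero)
  have Dp0: "D x = p (cos (2 * pi * x))" if "x \<in> {0..1/2}" for x
    using that unfolding p_def by (subst arccos_cos) auto
  have Dp: "D x = p (cos (2 * pi * x))" if "x \<in> {0..1}" for x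
  proof (cases "x \<le> 1/2")
    case False
    have "D x = D (1 - x)" by (simp add: sym)
    also have "\<dots> = p (cos (2 * pi * (1 - x)))" using that False by (intro Dp0) auto
    also have "cos (2 * pi * (1 - x)) = cos (2 * pi * x)" by (simp add: algebra_simps cos_diff)
    finally show ?thesis .
  qed (use that in \<open>auto intro: Dp0\<close>)
  \<comment> \<open>By the product-to-sum formula, a factor cos (2 pi x) replaces the index m by the
    mean of m - 1 and m + 1, so orthogonality to all cosines passes to all polynomials in cos (2 pi
    x). At m = 0 there is no lower index, and the factor itself is the cosine of index 1.\<close>
  have pow: "integral {0..1} (\<lambda>x. D x * cos (2 * pi * x) ^ k * cos (2 * pi * real m * x)) = 0" for k m
  proof (induction k arbitrary: m)
    case 0
    thus ?case using coeff by simp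
  next
    case (Suc k)
    show ?case
    proof (cases m)
      case 0
      thus ?thesis using Suc.IH[of 1] by (simp add: mult_ac)
    next
      case (Suc m')
      have "D x * cos (2 * pi * x) ^ Suc k * cos (2 * pi * real m * x) =
          (1/2) * (D x * cos (2 * pi * x) ^ k * cos (2 * pi * real m' * x)) +
          (1/2) * (D x * cos (2 * pi * x) ^ k * cos (2 * pi * real (Suc m) * x))" for x
      proof -
        have "cos (2 * pi * x) * cos (2 * pi * real m * x) =
          (cos (2 * pi * real m * x - 2 * pi * x) + cos (2 * pi * real m * x + 2 * pi * x)) / 2"
          by (simp add: cos_add cos_diff)
        also have "2 * pi * real m * x - 2 * pi * x = 2 * pi * real m' * x"
          by (simp add: Suc algebra_simps)
        also have "2 * pi * real m * x + 2 * pi * x = 2 * pi * real (Suc m) * x"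
          by (simp add: algebra_simps)
        finally have c: "cos (2 * pi * x) * cos (2 * pi * real m * x) =
          (cos (2 * pi * real m' * x) + cos (2 * pi * real (Suc m) * x)) / 2" .
        have "D x * cos (2 * pi * x) ^ Suc k * cos (2 * pi * real m * x) =
          D x * cos (2 * pi * x) ^ k * (cos (2 * pi * x) * cos (2 * pi * real m * x))"
          by (simp only: power_Suc mult_ac)
        moreover have "A * ((P + Q) / 2) = (1/2) * (A * P) + (1/2) * (A * Q)" for A P Q :: real
          by (simp add: field_simps)
        ultimately show ?thesis unfolding c by (simp only:)
      qed
      moreover have "integral {0..1} (\<lambda>x. (1/2) * (D x * cos (2 * pi * x) ^ k * cos (2 * pi * real m' * x)) +
          (1/2) * (D x * cos (2 * pi * x) ^ k * cos (2 * pi * real (Suc m) * x))) = 0"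
      proof -
        have hi: "((\<lambda>x. D x * cos (2 * pi * x) ^ k * cos (2 * pi * real j * x)) has_integral 0) {0..1}" for j
        proof -
          have "(\<lambda>x. D x * cos (2 * pi * x) ^ k * cos (2 * pi * real j * x)) integrable_on {0..1}"
            by (intro int continuous_intros cont)
          from integrable_integral[OF this] show ?thesis by (simp only: Suc.IH)
        qed
        from has_integral_add[OF has_integral_mult_right[OF hi, of "1/2" m'] has_integral_mult_right[OF hi, of "1/2" "Suc m"]]
        show ?thesis by (simp add: integral_unique)
      qed
      ultimately show ?thesis by simp
    qed
  qed
  have poly: "integral {0..1} (\<lambda>x. D x * (\<Sum>i\<le>n. a i * cos (2 * pi * x) ^ i)) = 0" for a and n :: nat
  proof -
    have "integral {0..1} (\<lambda>x. D x * (\<Sum>i\<le>n. a i * cos (2 * pi * x) ^ i)) =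
      integral {0..1} (\<lambda>x. \<Sum>i\<le>n. a i * (D x * cos (2 * pi * x) ^ i))"
      by (simp add: sum_distrib_left mult_ac)
    also have "\<dots> = (\<Sum>i\<le>n. integral {0..1} (\<lambda>x. a i * (D x * cos (2 * pi * x) ^ i)))"
      by (rule integral_sum) (auto intro!: int continuous_intros cont)
    also have "\<dots> = 0"
      using pow[of _ 0] by simp
    finally show ?thesis .
  qed
  define K where "K = integral {0..1} (\<lambda>x. \<bar>D x\<bar>)"
  have K: "K \<ge> 0" unfolding K_def by (rule Henstock_Kurzweil_Integration.integral_nonneg) (auto intro!: int continuous_intros cont)
  \<comment> \<open>D is orthogonal to the polynomial approximation, so the integral of its square
    equals that of D times the approximation error.\<close>
  have le: "integral {0..1} (\<lambda>x. D x * D x) \<le> e * K" if e: "e > 0" for e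
  proof -
    obtain g where g: "real_polynomial_function g" "\<And>x. x \<in> {-1..1} \<Longrightarrow> \<bar>p x - g x\<bar> < e"
      using Stone_Weierstrass_real_polynomial_function[OF compact_Icc p_cont e] by blast
    obtain a n where g_eq: "g = (\<lambda>x. \<Sum>i\<le>n. a i * x ^ i)"
      using g(1) unfolding real_polynomial_function_iff_sum by blast
    have "integral {0..1} (\<lambda>x. D x * D x) = integral {0..1} (\<lambda>x. D x * D x) - integral {0..1} (\<lambda>x. D x * g (cos (2 * pi * x)))"
      unfolding g_eq poly by simp
    also have "\<dots> = integral {0..1} (\<lambda>x. D x * D x - D x * g (cos (2 * pi * x)))"
      by (rule Henstock_Kurzweil_Integration.integral_diff[symmetric])
         (auto intro!: int continuous_intros cont simp: g_eq)
    also have "\<dots> \<le> integral {0..1} (\<lambda>x. e * \<bar>D x\<bar>)"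
    proof (rule integral_le)
      fix x :: real assume x: "x \<in> {0..1}"
      have "D x * D x - D x * g (cos (2 * pi * x)) = D x * (p (cos (2 * pi * x)) - g (cos (2 * pi * x)))"
        using Dp[OF x] by (simp add: algebra_simps)
      also have "\<dots> \<le> \<bar>D x\<bar> * \<bar>p (cos (2 * pi * x)) - g (cos (2 * pi * x))\<bar>"
        by (simp add: abs_mult[symmetric])
      also have "\<dots> \<le> \<bar>D x\<bar> * e"
        by (intro mult_left_mono order.strict_implies_order[OF g(2)]) auto
      finally show "D x * D x - D x * g (cos (2 * pi * x)) \<le> e * \<bar>D x\<bar>" by (simp add: mult_ac)
    qed (auto intro!: int continuous_intros cont simp: g_eq)
    also have "\<dots> = e * K" by (simp add: K_def)
    finally show ?thesis .
  qed
  have "integral {0..1} (\<lambda>x. D x * D x) \<le> 0"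
  proof (rule field_le_epsilon)
    fix e :: real assume e: "e > 0"
    have "integral {0..1} (\<lambda>x. D x * D x) \<le> e / (K + 1) * K" using e K by (intro le) auto
    also have "\<dots> \<le> e" using e K by (simp add: field_simps)
    finally show "integral {0..1} (\<lambda>x. D x * D x) \<le> 0 + e" by simp
  qed
  moreover have "integral {0..1} (\<lambda>x. D x * D x) \<ge> 0"
    by (rule Henstock_Kurzweil_Integration.integral_nonneg) (auto intro!: int continuous_intros cont)
  ultimately have "integral {0..1} (\<lambda>x. D x * D x) = 0" by linarith
  hence "\<forall>x\<in>{0..1}. D x * D x = 0"
    by (subst (asm) integral_eq_0_iff) (auto intro!: continuous_intros cont)
  with x show ?thesis by auto
qed

text \<open>After scaling by c = sqrt (2 pi s) this is the characteristic function of the standard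
  normal law. The limit over [-N, N] is the form that \<open>integral_unfold\<close>
  delivers.\<close>

lemma gauss_cos_integral:
  fixes s :: real
  assumes s: "s > 0"
  shows "(\<lambda>N. integral {- real N..real N} (\<lambda>x. exp (- pi * s * x\<^sup>2) * cos (2 * pi * real m * x)))
     \<longlonglongrightarrow> exp (- pi * (real m)\<^sup>2 / s) / sqrt s"
proof -
  define c where "c = sqrt (2 * pi * s)"
  have c: "c > 0" "c^2 = 2 * pi * s" using s by (auto simp: c_def)
  let ?h = "\<lambda>x. exp (- pi * s * x\<^sup>2) * cos (2 * pi * real m * x)"
  have nd: "integrable lborel (\<lambda>x. std_normal_density x)"
    by (rule integrable_normal_density) simp
  have int0: "integrable lborel (\<lambda>x. std_normal_density x * cos (t * x))" for t
    by (rule Bochner_Integration.integrable_bound[OF nd]) (auto simp: abs_mult mult_left_le)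
  have re: "(LINT x|lborel. std_normal_density x * cos (t * x)) = exp (- t\<^sup>2 / 2)" for t
  proof -
    interpret prob_space std_normal_distribution
      by (rule prob_space_normal_density) simp
    have "complex_of_real (exp (- t\<^sup>2 / 2)) = char std_normal_distribution t"
      by (simp add: char_std_normal_distribution)
    also have "\<dots> = (CLINT x|std_normal_distribution. iexp (t * x))"
      by (simp add: char_def)
    finally have "exp (- t\<^sup>2 / 2) = Re (CLINT x|std_normal_distribution. iexp (t * x))"
      by (metis Re_complex_of_real)
    also have "\<dots> = (LINT x|std_normal_distribution. Re (iexp (t * x)))"
      by (rule integral_Re[symmetric]) (auto intro!: integrable_const_bound[where B=1])
    also have "\<dots> = (LINT x|lborel. std_normal_density x * cos (t * x))"
      by (subst integral_density) (auto simp: normal_density_nonneg Re_exp)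
    finally show ?thesis ..
  qed
  have h: "?h x = sqrt (2 * pi) * (std_normal_density (c * x) * cos ((2 * pi * real m / c) * (c * x)))" for x
    using c s by (simp add: std_normal_density_def power_mult_distrib field_simps)
  have int: "integrable lborel ?h"
    unfolding h using c by (intro integrable_mult_right lborel_integrable_real_affine[OF int0, of c 0, simplified]) auto
  have val: "(LINT x|lborel. ?h x) = exp (- pi * (real m)\<^sup>2 / s) / sqrt s"
  proof -
    have "exp (- (2 * pi * real m / c)\<^sup>2 / 2) = c * (LINT x|lborel. std_normal_density (c * x) * cos ((2 * pi * real m / c) * (c * x)))"
      using lborel_integral_real_affine[of c "\<lambda>x. std_normal_density x * cos ((2 * pi * real m / c) * x)" 0] c
      unfolding re by simp
    moreover have "(2 * pi * real m / c)\<^sup>2 / 2 = pi * (real m)\<^sup>2 / s"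
      using c s by (simp add: power_divide power_mult_distrib power2_eq_square field_simps)
    ultimately have "(LINT x|lborel. std_normal_density (c * x) * cos ((2 * pi * real m / c) * (c * x))) = exp (- pi * (real m)\<^sup>2 / s) / c"
      using c by (simp add: field_simps)
    hence "(LINT x|lborel. ?h x) = sqrt (2 * pi) * (exp (- pi * (real m)\<^sup>2 / s) / c)"
      unfolding h by simp
    thus ?thesis by (simp add: c_def real_sqrt_mult)
  qed
  have "(\<lambda>N. LINT x|lborel. indicator {- real N..real N} x *\<^sub>R ?h x) \<longlonglongrightarrow> (LINT x|lborel. ?h x)"
  proof (rule integral_dominated_convergence[where w = "\<lambda>x. norm (?h x)"])
    show "AE x in lborel. (\<lambda>N. indicator {- real N..real N} x *\<^sub>R ?h x) \<longlonglongrightarrow> ?h x"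
    proof (rule AE_I2)
      fix x :: real
      obtain N0 where N0: "\<bar>x\<bar> \<le> real N0" using real_arch_simple by blast
      have "eventually (\<lambda>N. indicator {- real N..real N} x *\<^sub>R ?h x = ?h x) sequentially"
        using eventually_ge_at_top[of N0] by eventually_elim (use N0 in \<open>auto simp: indicator_def\<close>)
      thus "(\<lambda>N. indicator {- real N..real N} x *\<^sub>R ?h x) \<longlonglongrightarrow> ?h x" by (rule tendsto_eventually)
    qed
  qed (use int in \<open>auto simp: indicator_def\<close>)
  moreover have "(LINT x|lborel. indicator {- real N..real N} x *\<^sub>R ?h x) = integral {- real N..real N} ?h" for N
  proof -
    have "continuous_on {- real N..real N} ?h" by (intro continuous_intros)
    hence "set_integrable lborel {- real N..real N} ?h" by (rule borel_integrable_atLeastAtMost')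
    from set_borel_integral_eq_integral(2)[OF this] show ?thesis
      by (simp only: set_lebesgue_integral_def)
  qed
  ultimately show ?thesis unfolding val by simp
qed

lemma summable_exp_square:
  fixes a :: real
  assumes a: "a > 0" and f: "\<And>n. f n \<ge> real n"
  shows "summable (\<lambda>n. exp (- a * (f n)\<^sup>2))"
proof -
  have e: "exp (- a * (f n)\<^sup>2) \<le> exp (- a) ^ n" for n
  proof (cases "n = 0")
    case False
    have "real n * 1 \<le> f n * f n" using f[of n] False by (intro mult_mono) auto
    hence "a * real n \<le> a * (f n)\<^sup>2" using a by (intro mult_left_mono) (auto simp: power2_eq_square)
    thus ?thesis by (simp add: exp_of_nat_mult[symmetric] mult_ac)
  qed (use a in auto)
  have "summable (\<lambda>n. exp (- a) ^ n)"
    using a by (intro summable_geometric) auto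
  thus ?thesis
    by (rule summable_comparison_test'[of _ 0]) (use e in auto)
qed

lemma integral_cos_cos:
  "integral {0..1} (\<lambda>x. cos (2 * pi * real j * x) * cos (2 * pi * real m * x)) =
     (if j = m then if m = 0 then 1 else 1 / 2 else 0)"
proof -
  have I: "integral {0..1} (\<lambda>x. cos (2 * pi * of_int k * x)) = (if k = 0 then 1 else 0)" for k
  proof (cases "k = 0")
    case False
    have "((\<lambda>x. cos (2 * pi * of_int k * x)) has_integral
       (sin (2 * pi * of_int k * 1) / (2 * pi * of_int k) - sin (2 * pi * of_int k * 0) / (2 * pi * of_int k))) {0..1}"
      using False by (intro fundamental_theorem_of_calculus)
        (auto intro!: derivative_eq_intros simp: has_real_derivative_iff_has_vector_derivative[symmetric])
    moreover have "sin (2 * pi * of_int k) = 0" by (simp only: sin_int_2pin)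
    ultimately show ?thesis using False by (simp add: integral_unique)
  qed auto
  have "integral {0..1} (\<lambda>x. cos (2 * pi * real j * x) * cos (2 * pi * real m * x)) =
    integral {0..1} (\<lambda>x. (1/2) * cos (2 * pi * of_int (int j - int m) * x) + (1/2) * cos (2 * pi * of_int (int j + int m) * x))"
    by (simp add: cos_times_cos algebra_simps add_divide_distrib)
  also have "\<dots> = (1/2) * (if int j - int m = 0 then 1 else 0) + (1/2) * (if int j + int m = 0 then 1 else 0)"
  proof -
    have hi: "((\<lambda>x. cos (2 * pi * of_int k * x)) has_integral (if k = 0 then 1 else 0)) {0..1}" for k
      unfolding I[symmetric] by (intro integrable_integral integrable_continuous_interval continuous_intros)
    from has_integral_add[OF has_integral_mult_right[OF hi, of "1/2" "int j - int m"] has_integral_mult_right[OF hi, of "1/2" "int j + int m"]]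
    show ?thesis by (rule integral_unique)
  qed
  also have "\<dots> = (if j = m then if m = 0 then 1 else 1 / 2 else 0)"
    by auto
  finally show ?thesis .
qed

text \<open>Both sides are continuous, symmetric under x -> 1 - x and have the cosine coefficients
  \<open>b m / sqrt s\<close>: for the translated Gaussians by unfolding, for the cosine series by
  orthogonality. Uniform convergence lets integrals pass to the limit. The reflection swaps the two
  Gaussians in each pair, so the pairing keeps even the partial sums symmetric.\<close>

lemma gauss_poisson_nat:
  fixes s x :: real
  assumes s: "s > 0" and x: "x \<in> {0..1}"
  shows "(\<Sum>n. exp (- pi * s * (x + real n)\<^sup>2) + exp (- pi * s * (x - real (Suc n))\<^sup>2)) =
    (1 + 2 * (\<Sum>n. exp (- pi * (real (Suc n))\<^sup>2 / s) * cos (2 * pi * real (Suc n) * x))) / sqrt s"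
proof -
  define g where "g x = exp (- pi * s * x\<^sup>2)" for x
  define h where "h n x = g (x + real n) + g (x - real (Suc n))" for n x
  define b where "b n = exp (- (pi / s) * (real n)\<^sup>2)" for n
  define c where "c n x = b (Suc n) * cos (2 * pi * real (Suc n) * x)" for n x
  define F where "F x = (\<Sum>n. h n x)" for x
  define G where "G x = (1 + 2 * (\<Sum>n. c n x)) / sqrt s" for x
  have contg: "continuous_on A g" for A unfolding g_def by (intro continuous_intros)
  have conth: "continuous_on A (h n)" for A n unfolding h_def g_def by (intro continuous_intros)
  have uF: "uniform_limit {0..1} (\<lambda>N x. \<Sum>n<N. h n x) F sequentially"
    unfolding F_def
  proof (rule Weierstrass_m_test)
    fix n :: nat and x :: real assume x: "x \<in> {0..1}"
    have "(real n)\<^sup>2 \<le> (x + real n)\<^sup>2" "(real n)\<^sup>2 \<le> (real (Suc n) - x)\<^sup>2"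
      using x by (intro power_mono; simp)+
    hence "g (x + real n) \<le> exp (- (pi * s) * (real n)\<^sup>2)" "g (x - real (Suc n)) \<le> exp (- (pi * s) * (real n)\<^sup>2)"
      unfolding g_def power2_commute[of x] using s by auto
    moreover have "g (x + real n) \<ge> 0" "g (x - real (Suc n)) \<ge> 0" by (auto simp: g_def)
    ultimately show "norm (h n x) \<le> 2 * exp (- (pi * s) * (real n)\<^sup>2)"
      unfolding h_def by (simp add: abs_of_nonneg)
  next
    show "summable (\<lambda>n. 2 * exp (- (pi * s) * (real n)\<^sup>2))"
      using s by (intro summable_mult summable_exp_square) auto
  qed
  have uc: "uniform_limit {0..1} (\<lambda>N x. \<Sum>n<N. c n x) (\<lambda>x. \<Sum>n. c n x) sequentially"
  proof (rule Weierstrass_m_test)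
    fix n :: nat and x :: real
    show "norm (c n x) \<le> b (Suc n)"
      unfolding c_def b_def by (auto simp: abs_mult mult_left_le)
    show "summable (\<lambda>n. b (Suc n))"
      unfolding b_def using s by (intro summable_exp_square) auto
  qed
  hence uG: "uniform_limit {0..1} (\<lambda>N x. (1 + 2 * (\<Sum>n<N. c n x)) / sqrt s) G sequentially"
    unfolding G_def using s by (intro uniform_limit_intros) (auto intro!: uniform_limit_intros)
  have contF: "continuous_on {0..1} F"
    by (rule uniform_limit_theorem[OF eventuallyI uF]) (auto intro!: continuous_intros conth)
  have contG: "continuous_on {0..1} G"
    by (rule uniform_limit_theorem[OF eventuallyI uG]) (use s in \<open>auto intro!: continuous_intros simp: c_def\<close>)
  have ulim: "(\<lambda>N. integral {0..1} (\<lambda>x. f N x * cos (2 * pi * real m * x))) \<longlonglongrightarrow> integral {0..1} (\<lambda>x. l x * cos (2 * pi * real m * x))"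
    if u: "uniform_limit {0..1} f l sequentially" and f: "\<And>N. continuous_on {0..1} (f N)" and l: "continuous_on {0..1} l"
    for f :: "nat \<Rightarrow> real \<Rightarrow> real" and l m
  proof -
    have b: "bounded (l ` {0..1})"
      by (intro compact_imp_bounded compact_continuous_image l compact_Icc)
    have "uniform_limit {0..1} (\<lambda>N x. f N x * cos (2 * pi * real m * x)) (\<lambda>x. l x * cos (2 * pi * real m * x)) sequentially"
      by (intro uniform_lim_mult u uniform_limit_const b boundedI[of _ 1]) auto
    then obtain I J where IJ: "\<And>n. ((\<lambda>x. f n x * cos (2 * pi * real m * x)) has_integral I n) {0..1}"
       "((\<lambda>x. l x * cos (2 * pi * real m * x)) has_integral J) {0..1}" "I \<longlonglongrightarrow> J"
      by (rule uniform_limit_integral) (auto intro!: continuous_intros f)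
    thus ?thesis using integral_unique[OF IJ(1)] integral_unique[OF IJ(2)] by simp
  qed
  have int: "f integrable_on {0..1}" if "continuous_on {0..1} f" for f :: "real \<Rightarrow> real"
    using that by (rule integrable_continuous_interval)
  have cF: "integral {0..1} (\<lambda>x. F x * cos (2 * pi * real m * x)) = b m / sqrt s" for m
  proof (rule LIMSEQ_unique)
    show "(\<lambda>N. integral {0..1} (\<lambda>x. (\<Sum>n<N. h n x) * cos (2 * pi * real m * x))) \<longlonglongrightarrow> integral {0..1} (\<lambda>x. F x * cos (2 * pi * real m * x))"
      by (rule ulim[OF uF _ contF]) (auto intro!: continuous_intros conth)
    show "(\<lambda>N. integral {0..1} (\<lambda>x. (\<Sum>n<N. h n x) * cos (2 * pi * real m * x))) \<longlonglongrightarrow> b m / sqrt s"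
      unfolding h_def integral_unfold[OF contg] using gauss_cos_integral[OF s, of m]
      by (simp add: g_def b_def)
  qed
  have cG: "integral {0..1} (\<lambda>x. G x * cos (2 * pi * real m * x)) = b m / sqrt s" for m
  proof (rule LIMSEQ_unique)
    let ?f = "\<lambda>N x. (1 + 2 * (\<Sum>n<N. c n x)) / sqrt s"
    show "(\<lambda>N. integral {0..1} (\<lambda>x. ?f N x * cos (2 * pi * real m * x))) \<longlonglongrightarrow> integral {0..1} (\<lambda>x. G x * cos (2 * pi * real m * x))"
      by (rule ulim[OF uG _ contG]) (use s in \<open>auto intro!: continuous_intros simp: c_def\<close>)
    have "integral {0..1} (\<lambda>x. ?f N x * cos (2 * pi * real m * x)) = b m / sqrt s" if N: "N \<ge> m" for N
    proof -
      have "integral {0..1} (\<lambda>x. ?f N x * cos (2 * pi * real m * x)) =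
        integral {0..1} (\<lambda>x. (1 / sqrt s) * (cos (2 * pi * real 0 * x) * cos (2 * pi * real m * x)) +
          (\<Sum>n<N. (2 * b (Suc n) / sqrt s) * (cos (2 * pi * real (Suc n) * x) * cos (2 * pi * real m * x))))"
        by (rule integral_cong)
           (simp add: c_def sum_distrib_left sum_distrib_right sum_divide_distrib add_divide_distrib distrib_right distrib_left mult_ac)
      also have "\<dots> = (1 / sqrt s) * integral {0..1} (\<lambda>x. cos (2 * pi * real 0 * x) * cos (2 * pi * real m * x)) +
          (\<Sum>n<N. (2 * b (Suc n) / sqrt s) * integral {0..1} (\<lambda>x. cos (2 * pi * real (Suc n) * x) * cos (2 * pi * real m * x)))"
      proof -
        have hc: "((\<lambda>x. cos (2 * pi * real j * x) * cos (2 * pi * real m * x)) has_integral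
          integral {0..1} (\<lambda>x. cos (2 * pi * real j * x) * cos (2 * pi * real m * x))) {0..1}" for j
          by (intro integrable_integral int continuous_intros)
        show ?thesis
          by (intro integral_unique has_integral_add has_integral_sum has_integral_mult_right hc finite_lessThan)
      qed
      also have "\<dots> = b m / sqrt s"
      proof (cases m)
        case 0
        thus ?thesis unfolding integral_cos_cos by (simp add: b_def)
      next
        case (Suc m')
        have "(\<Sum>n<N. (2 * b (Suc n) / sqrt s) * (if Suc n = m then if m = 0 then 1 else 1 / 2 else 0)) =
          (\<Sum>n<N. if n = m' then b m / sqrt s else 0)"
          by (rule sum.cong) (auto simp: Suc)
        also have "\<dots> = b m / sqrt s" using N Suc by simp
        finally show ?thesis unfolding integral_cos_cos by (simp add: Suc)
      qed
      finally show ?thesis .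
    qed
    thus "(\<lambda>N. integral {0..1} (\<lambda>x. ?f N x * cos (2 * pi * real m * x))) \<longlonglongrightarrow> b m / sqrt s"
      by (intro tendsto_eventually) (auto simp: eventually_sequentially)
  qed
  have symF: "F (1 - x) = F x" for x
  proof -
    have "h n (1 - x) = h n x" for n
    proof -
      have "g (1 - x + real n) = g (x - real (Suc n))" "g (1 - x - real (Suc n)) = g (x + real n)"
        unfolding g_def by (simp_all add: power2_eq_square algebra_simps)
      thus ?thesis by (simp add: h_def)
    qed
    thus ?thesis by (simp add: F_def)
  qed
  have symG: "G (1 - x) = G x" for x
  proof -
    have "c n (1 - x) = c n x" for n
    proof -
      have "cos (2 * pi * real (Suc n) * (1 - x)) = cos (2 * pi * real_of_int (int (Suc n)) - 2 * pi * real (Suc n) * x)"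
        by (simp add: algebra_simps)
      also have "\<dots> = cos (2 * pi * real (Suc n) * x)"
        by (simp only: cos_diff sin_int_2pin cos_int_2pin mult_zero_left mult_1_left add_0_right)
      finally show ?thesis by (simp only: c_def)
    qed
    thus ?thesis by (simp add: G_def)
  qed
  have "F x - G x = 0"
  proof (rule fourier_unique_even[OF _ _ _ x])
    show "continuous_on {0..1} (\<lambda>x. F x - G x)" by (intro continuous_intros contF contG)
    show "integral {0..1} (\<lambda>x. (F x - G x) * cos (2 * pi * real m * x)) = 0" for m
    proof -
      have hF: "((\<lambda>x. F x * cos (2 * pi * real m * x)) has_integral (b m / sqrt s)) {0..1}"
        unfolding cF[symmetric] by (intro integrable_integral int continuous_intros contF)
      have hG: "((\<lambda>x. G x * cos (2 * pi * real m * x)) has_integral (b m / sqrt s)) {0..1}"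
        unfolding cG[symmetric] by (intro integrable_integral int continuous_intros contG)
      show ?thesis
        using integral_unique[OF has_integral_diff[OF hF hG]] by (simp only: left_diff_distrib diff_self)
    qed
  qed (simp add: symF symG)
  moreover have "b n = exp (- pi * (real n)\<^sup>2 / s)" for n
    by (simp add: b_def)
  ultimately show ?thesis
    unfolding F_def G_def h_def g_def c_def by simp
qed


lemma sums_nonneg_has_sum:
  fixes f :: "nat \<Rightarrow> real"
  assumes "summable (\<lambda>n. norm (f n))"
  shows "(f has_sum suminf f) UNIV"
  by (rule norm_summable_imp_has_sum[OF assms summable_sums[OF summable_norm_cancel[OF assms]]])

text \<open>The two-sided form. As unordered sums both sides can be split and reindexed along
  residue classes, which the passage to eta requires; the shared S carries convergence and equality
  at once.\<close>

lemma gauss_poisson: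
  fixes s x :: real
  assumes s: "s > 0" and x: "x \<in> {0..1}"
  shows "\<exists>S. ((\<lambda>n::int. exp (- pi * s * (x + of_int n)\<^sup>2)) has_sum S) UNIV \<and>
     ((\<lambda>m::int. exp (- pi * (of_int m)\<^sup>2 / s) * cos (2 * pi * of_int m * x)) has_sum (sqrt s * S)) UNIV"
proof -
  define f1 where "f1 n = exp (- pi * s * (x + real n)\<^sup>2)" for n
  define f2 where "f2 n = exp (- pi * s * (x - real (Suc n))\<^sup>2)" for n
  define b where "b n = exp (- pi * (real (Suc n))\<^sup>2 / s) * cos (2 * pi * real (Suc n) * x)" for n
  have s1: "summable (\<lambda>n. norm (f1 n))"
    using summable_exp_square[of "pi * s" "\<lambda>n. x + real n"] s x by (simp add: f1_def)
  have s2: "summable (\<lambda>n. norm (f2 n))"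
  proof -
    have "summable (\<lambda>n. exp (- (pi * s) * (real (Suc n) - x)\<^sup>2))"
      using s x by (intro summable_exp_square) auto
    thus ?thesis by (simp add: f2_def power2_commute[of x])
  qed
  have s3: "summable (\<lambda>n. norm (b n))"
  proof (rule summable_comparison_test'[of _ 0])
    show "summable (\<lambda>n. exp (- (pi / s) * (real (Suc n))\<^sup>2))"
      using s by (intro summable_exp_square) auto
  qed (auto simp: b_def abs_mult mult_left_le)
  note h1 = sums_nonneg_has_sum[OF s1] and h2 = sums_nonneg_has_sum[OF s2] and h3 = sums_nonneg_has_sum[OF s3]
  have A: "((\<lambda>n::int. exp (- pi * s * (x + of_int n)\<^sup>2)) has_sum (suminf f1 + suminf f2)) UNIV"
  proof (rule has_sum_int_iff_nat)
    have "exp (- pi * s * (x + of_int (int n))\<^sup>2) = f1 n" for n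
      by (simp add: f1_def)
    thus "((\<lambda>n. exp (- pi * s * (x + of_int (int n))\<^sup>2)) has_sum suminf f1) UNIV" using h1 by simp
    have "exp (- pi * s * (x + of_int (- int (Suc n)))\<^sup>2) = f2 n" for n
      by (simp add: f2_def algebra_simps)
    thus "((\<lambda>n. exp (- pi * s * (x + of_int (- int (Suc n)))\<^sup>2)) has_sum suminf f2) UNIV" using h2 by (simp only:)
  qed
  have h3': "((\<lambda>n. exp (- pi * (of_int (- int (Suc n)))\<^sup>2 / s) * cos (2 * pi * of_int (- int (Suc n)) * x)) has_sum suminf b) UNIV"
  proof -
    have "exp (- pi * (of_int (- int (Suc n)))\<^sup>2 / s) * cos (2 * pi * of_int (- int (Suc n)) * x) = b n" for n
    proof -
      have "cos (2 * pi * of_int (- int (Suc n)) * x) = cos (2 * pi * real (Suc n) * x)"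
        using cos_minus[of "2 * pi * real (Suc n) * x"] by (simp del: cos_minus of_nat_Suc)
      thus ?thesis by (simp add: b_def del: of_nat_Suc)
    qed
    thus ?thesis using h3 by simp
  qed
  define b0 where "b0 n = (if n = 0 then 1 else b (n - 1))" for n
  have h4: "(b0 has_sum (1 + suminf b)) UNIV"
  proof -
    have "(b0 has_sum suminf b) (range Suc)"
      using h3 by (subst has_sum_reindex) (auto simp: o_def b0_def)
    hence "(b0 has_sum (b0 0 + suminf b)) (insert 0 (range Suc))"
      by (intro has_sum_insert) auto
    thus ?thesis by (simp add: b0_def UNIV_nat_eq[symmetric])
  qed
  have "((\<lambda>m::int. exp (- pi * (of_int m)\<^sup>2 / s) * cos (2 * pi * of_int m * x)) has_sum (1 + suminf b + suminf b)) UNIV"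
  proof (rule has_sum_int_iff_nat[OF _ h3'])
    have "exp (- pi * (of_int (int n))\<^sup>2 / s) * cos (2 * pi * of_int (int n) * x) = b0 n" for n
      by (cases n) (simp_all add: b0_def b_def)
    thus "((\<lambda>n. exp (- pi * (of_int (int n))\<^sup>2 / s) * cos (2 * pi * of_int (int n) * x)) has_sum (1 + suminf b)) UNIV"
      using h4 by simp
  qed
  moreover have "1 + suminf b + suminf b = sqrt s * (suminf f1 + suminf f2)"
  proof -
    have "suminf f1 + suminf f2 = (\<Sum>n. f1 n + f2 n)"
      by (rule suminf_add) (use summable_norm_cancel[OF s1] summable_norm_cancel[OF s2] in auto)
    also have "\<dots> = (1 + 2 * suminf b) / sqrt s"
      unfolding f1_def f2_def b_def by (rule gauss_poisson_nat[OF s x])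
    finally show ?thesis using s by (simp add: field_simps)
  qed
  ultimately show ?thesis using A by auto
qed

text \<open>The value of the Dedekind eta function at \<open>i t\<close>; the sign \<open>(-1)\<^sup>n\<close> is produced by combining the
  Gaussian sums at \<open>x = 1/12\<close> and \<open>x = 1/6\<close>.\<close>

definition eta_it :: "real \<Rightarrow> real" where
  "eta_it t = (\<Sum>\<^sub>\<infinity>n::int. (-1) powi n * exp (- pi * t * (6 * of_int n + 1)\<^sup>2 / 12))"

text \<open>On odd m, cos (pi m / 6) is sqrt 3 / 2 times the even quadratic character mod 12, whose
  values are the signs in the eta series.\<close>

lemma cos_residue_6:
  "cos (pi * of_int (6 * k + 1) / 6) = (-1) powi k * (sqrt 3 / 2)"
  "cos (pi * of_int (6 * k + 3) / 6) = 0"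
proof -
  have 1: "cos (of_int k * pi) = (-1) powi k" "sin (of_int k * pi) = 0" for k
  proof -
    show "sin (of_int k * pi) = 0"
      using sin_npi_int[of k] by (simp only: mult.commute)
    show "cos (of_int k * pi) = (-1) powi k"
      using cos_npi_int[of k] by (simp add: mult.commute power_int_minus_left)
  qed
  have a: "pi * of_int (6 * k + 1) / 6 = of_int k * pi + pi / 6"
       "pi * of_int (6 * k + 3) / 6 = of_int k * pi + pi / 2"
    by (simp_all add: field_simps)
  show "cos (pi * of_int (6 * k + 1) / 6) = (-1) powi k * (sqrt 3 / 2)"
       "cos (pi * of_int (6 * k + 3) / 6) = 0"
    unfolding a by (simp_all add: cos_add 1 cos_30)
qed

lemma minus_one_powi: "(-1 :: real) powi n = 2 * of_bool (even n) - 1"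
  by (simp add: power_int_minus_left)

text \<open>Since (-1)^n is twice the indicator of even n minus 1, the eta sum is 2
  \<open>S1\<close> - \<open>S2\<close>, where \<open>S1\<close> runs over even n (parameter 12 t, x
  = 1/12) and \<open>S2\<close> over all n (parameter 3 t, x = 1/6). On the dual side the series of
  \<open>S2\<close> is the part of the series of \<open>S1\<close> with even m, and sqrt (12 t) = 2
  sqrt (3 t), so exactly the odd m remain.\<close>

lemma eta_it_inversion_aux:
  assumes t: "t > 0"
  shows "((\<lambda>n::int. (-1) powi n * exp (- pi * t * (6 * of_int n + 1)\<^sup>2 / 12)) has_sum eta_it t) UNIV"
    and "((\<lambda>m. exp (- pi * (of_int m)\<^sup>2 / (12 * t)) * cos (pi * of_int m / 6)) has_sum (sqrt (3 * t) * eta_it t)) {m::int. odd m}"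
proof -
  define f where "f n = exp (- pi * t * (6 * of_int n + 1)\<^sup>2 / 12)" for n :: int
  define d where "d m = exp (- pi * (of_int m)\<^sup>2 / (12 * t)) * cos (pi * of_int m / 6)" for m :: int
  have bij: "bij_betw (\<lambda>n. 2 * n) UNIV {n::int. even n}"
    by (rule bij_betwI[of _ _ _ "\<lambda>n. n div 2"]) auto
  obtain S1 where S1: "((\<lambda>n::int. exp (- pi * (12 * t) * (1/12 + of_int n)\<^sup>2)) has_sum S1) UNIV"
     "((\<lambda>m::int. exp (- pi * (of_int m)\<^sup>2 / (12 * t)) * cos (2 * pi * of_int m * (1/12))) has_sum (sqrt (12 * t) * S1)) UNIV"
    using gauss_poisson[of "12 * t" "1/12"] t by auto
  obtain S2 where S2: "((\<lambda>n::int. exp (- pi * (3 * t) * (1/6 + of_int n)\<^sup>2)) has_sum S2) UNIV"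
     "((\<lambda>m::int. exp (- pi * (of_int m)\<^sup>2 / (3 * t)) * cos (2 * pi * of_int m * (1/6))) has_sum (sqrt (3 * t) * S2)) UNIV"
    using gauss_poisson[of "3 * t" "1/6"] t by auto
  have e1: "exp (- pi * (12 * t) * (1/12 + of_int n)\<^sup>2) = f (2 * n)" for n
    by (simp add: f_def power2_eq_square field_simps)
  have e2: "exp (- pi * (3 * t) * (1/6 + of_int n)\<^sup>2) = f n" for n
    by (simp add: f_def power2_eq_square field_simps)
  have e3: "exp (- pi * (of_int m)\<^sup>2 / (12 * t)) * cos (2 * pi * of_int m * (1/12)) = d m" for m
    by (simp add: d_def)
  have e4: "exp (- pi * (of_int m)\<^sup>2 / (3 * t)) * cos (2 * pi * of_int m * (1/6)) = d (2 * m)" for m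
    by (simp add: d_def power2_eq_square field_simps)
  have fe: "(f has_sum S1) {n. even n}"
    using S1(1) unfolding e1 by (subst (asm) has_sum_reindex_bij_betw[OF bij])
  have fa: "(f has_sum S2) UNIV" using S2(1) unfolding e2 .
  have "((\<lambda>n. 2 * (of_bool (even n) * f n) + - f n) has_sum (2 * S1 + - S2)) UNIV"
  proof (intro has_sum_add has_sum_uminusI has_sum_cmult_right fa)
    show "((\<lambda>n. of_bool (even n) * f n) has_sum S1) UNIV"
      using fe by (rule has_sum_cong_neutral[THEN iffD1, rotated -1]) auto
  qed
  hence E: "((\<lambda>n. (-1) powi n * f n) has_sum (2 * S1 - S2)) UNIV"
    by (simp add: minus_one_powi algebra_simps)
  hence eta: "eta_it t = 2 * S1 - S2"
    unfolding eta_it_def f_def by (rule infsumI)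
  show "((\<lambda>n::int. (-1) powi n * exp (- pi * t * (6 * of_int n + 1)\<^sup>2 / 12)) has_sum eta_it t) UNIV"
    using E unfolding f_def eta .
  have da: "(d has_sum (sqrt (12 * t) * S1)) UNIV" using S1(2) unfolding e3 .
  have de: "(d has_sum (sqrt (3 * t) * S2)) {n. even n}"
    using S2(2) unfolding e4 by (subst (asm) has_sum_reindex_bij_betw[OF bij])
  have "(d has_sum (sqrt (12 * t) * S1 - sqrt (3 * t) * S2)) (UNIV - {n. even n})"
    by (rule has_sum_Diff[OF da de]) auto
  moreover have "UNIV - {n::int. even n} = {n. odd n}" by auto
  moreover have "sqrt (12 * t) * S1 - sqrt (3 * t) * S2 = sqrt (3 * t) * eta_it t"
  proof -
    have "sqrt (12 * t) = sqrt (4 * (3 * t))" by simp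
    also have "\<dots> = 2 * sqrt (3 * t)" by (simp only: real_sqrt_mult) simp
    finally show ?thesis by (simp add: eta algebra_simps)
  qed
  ultimately show "((\<lambda>m. exp (- pi * (of_int m)\<^sup>2 / (12 * t)) * cos (pi * of_int m / 6)) has_sum (sqrt (3 * t) * eta_it t)) {m::int. odd m}"
    unfolding d_def by simp
qed

text \<open>The odd m fall into the classes 1, -1 and 3 mod 6. The first two contribute the eta
  series at 1 / t with weight sqrt 3 / 2 each, the last contributes 0, and the resulting sqrt 3
  cancels against sqrt (3 t).\<close>

theorem eta_it_inversion:
  assumes t: "t > 0"
  shows "eta_it (1 / t) = sqrt t * eta_it t"
proof -
  define d where "d m = exp (- pi * (of_int m)\<^sup>2 / (12 * t)) * cos (pi * of_int m / 6)" for m :: int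
  define A where "A = range (\<lambda>n::int. 6 * n + 1)"
  define B where "B = range (\<lambda>n::int. - (6 * n + 1))"
  define C where "C = range (\<lambda>n::int. 6 * n + 3)"
  have inj: "inj (\<lambda>n::int. 6 * n + 1)" "inj (\<lambda>n::int. - (6 * n + 1))" by (auto simp: inj_def)
  have E: "((\<lambda>n::int. (-1) powi n * exp (- pi * (1 / t) * (6 * of_int n + 1)\<^sup>2 / 12)) has_sum eta_it (1 / t)) UNIV"
    using t by (intro eta_it_inversion_aux(1)) auto
  have d1: "d (6 * n + 1) = (-1) powi n * exp (- pi * (1 / t) * (6 * of_int n + 1)\<^sup>2 / 12) * (sqrt 3 / 2)" for n
    unfolding d_def cos_residue_6 by (simp add: mult_ac)
  have d2: "d (- m) = d m" for m
    by (simp add: d_def)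
  have "((\<lambda>n. d (6 * n + 1)) has_sum (eta_it (1 / t) * (sqrt 3 / 2))) UNIV"
    unfolding d1 by (intro has_sum_cmult_left E)
  hence hA: "(d has_sum (eta_it (1 / t) * (sqrt 3 / 2))) A" and hB: "(d has_sum (eta_it (1 / t) * (sqrt 3 / 2))) B"
    unfolding A_def B_def has_sum_reindex[OF inj(1)] has_sum_reindex[OF inj(2)] o_def d2 by assumption+
  have hC: "(d has_sum 0) C"
  proof (rule has_sum_0)
    fix m assume "m \<in> C"
    then obtain n where n: "m = 6 * n + 3" unfolding C_def by blast
    show "d m = 0" unfolding d_def n cos_residue_6(2) by simp
  qed
  have disj: "A \<inter> B = {}" "(A \<union> B) \<inter> C = {}"
    unfolding A_def B_def C_def by (auto; presburger)+
  have un: "A \<union> B \<union> C = {m. odd m}"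
  proof (intro equalityI subsetI)
    fix m :: int assume "m \<in> {m. odd m}"
    hence "m = 6 * (m div 6) + 1 \<or> m = - (6 * (- (m div 6) - 1) + 1) \<or> m = 6 * (m div 6) + 3"
      by simp presburger
    thus "m \<in> A \<union> B \<union> C" unfolding A_def B_def C_def by blast
  qed (auto simp: A_def B_def C_def)
  have "(d has_sum (eta_it (1 / t) * (sqrt 3 / 2) + eta_it (1 / t) * (sqrt 3 / 2) + 0)) (A \<union> B \<union> C)"
    by (intro has_sum_Un_disjoint hA hB hC disj)
  hence "(d has_sum (eta_it (1 / t) * sqrt 3)) {m. odd m}"
    unfolding un by (simp add: mult.commute)
  moreover have "(d has_sum (sqrt (3 * t) * eta_it t)) {m. odd m}"
    unfolding d_def by (rule eta_it_inversion_aux(2)[OF t])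
  ultimately have "eta_it (1 / t) * sqrt 3 = sqrt (3 * t) * eta_it t"
    by (rule has_sum_unique)
  thus ?thesis by (simp add: real_sqrt_mult)
qed

section \<open>The Dedekind eta function and the eta quotient\<close>

definition eta :: "complex \<Rightarrow> complex" where
  "eta \<tau> = exp (pi * \<i> * \<tau> / 12) * f_neg (exp (2 * pi * \<i> * \<tau>))"

abbreviation upper_half :: "complex set" where "upper_half \<equiv> {\<tau>. 0 < Im \<tau>}"

lemma upper_half_simps: "open upper_half" "connected upper_half"
  by (simp_all add: open_halfspace_Im_gt convex_halfspace_Im_gt convex_connected)

lemma norm_nome: "norm (exp (2 * pi * \<i> * \<tau>)) = exp (- (2 * pi * Im \<tau>))"
  by simp

lemma norm_nome_less: "Im \<tau> > 0 \<Longrightarrow> norm (exp (2 * pi * \<i> * \<tau>)) < 1"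
  unfolding norm_nome by simp

lemma eta_nonzero: "Im \<tau> > 0 \<Longrightarrow> eta \<tau> \<noteq> 0"
  unfolding eta_def using f_neg_nonzero[OF norm_nome_less] by simp

lemma eta_holomorphic: "eta holomorphic_on upper_half"
proof -
  have "(f_neg \<circ> (\<lambda>\<tau>. exp (2 * pi * \<i> * \<tau>))) holomorphic_on upper_half"
    by (rule holomorphic_on_compose_gen[OF _ f_neg_holomorphic])
       (use norm_nome_less in \<open>auto intro!: holomorphic_intros\<close>)
  thus ?thesis
    unfolding eta_def o_def by (intro holomorphic_intros) auto
qed

lemma eta_holomorphic' [holomorphic_intros]:
  assumes "f holomorphic_on A" "\<And>z. z \<in> A \<Longrightarrow> Im (f z) > 0"
  shows "(\<lambda>z. eta (f z)) holomorphic_on A"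
  using holomorphic_on_compose_gen[OF assms(1) eta_holomorphic] assms(2) by (auto simp: o_def)

lemma eta_translate: "eta (\<tau> + 1) = exp (pi * \<i> / 12) * eta \<tau>"
proof -
  have "exp (2 * pi * \<i> * (\<tau> + 1)) = exp (2 * pi * \<i> * \<tau>)"
    by (simp add: distrib_left exp_add)
  moreover have "exp (pi * \<i> * (\<tau> + 1) / 12) = exp (pi * \<i> / 12) * exp (pi * \<i> * \<tau> / 12)"
    by (simp add: exp_add[symmetric] field_simps)
  ultimately show ?thesis by (simp add: eta_def)
qed

text \<open>Completing the square: n (3 n + 1) / 2 + 1 / 24 = (6 n + 1)^2 / 24. The index is negated
  first because \<open>f_neg\<close> has the exponents n (3 n - 1) / 2.\<close>

lemma eta_imaginary:
  assumes t: "t > 0"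
  shows "eta (\<i> * of_real t) = of_real (eta_it t)"
proof -
  define q where "q = exp (- (2 * pi * t))"
  have q: "exp (2 * pi * \<i> * (\<i> * of_real t)) = of_real q"
    by (simp add: q_def exp_of_real[symmetric]) (simp add: algebra_simps)
  have q1: "norm (complex_of_real q) < 1" "q > 0" using t by (auto simp: q_def)
  define T where "T n = ((- 1) powi n * of_real q powi (n * (3 * n - 1) div 2) * of_real (exp (- (pi * t / 12))) :: complex)" for n :: int
  have "(T has_sum f_neg (of_real q) * of_real (exp (- (pi * t / 12)))) UNIV"
    unfolding T_def by (intro has_sum_cmult_left f_neg_has_sum_int(1) q1)
  moreover have "f_neg (of_real q) * of_real (exp (- (pi * t / 12))) = eta (\<i> * of_real t)"
  proof -
    have "complex_of_real pi * \<i> * (\<i> * of_real t) / 12 = of_real (- (pi * t / 12))"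
      by (simp add: complex_eq_iff)
    thus ?thesis unfolding eta_def q by (simp only: exp_of_real mult.commute)
  qed
  ultimately have "(T has_sum eta (\<i> * of_real t)) UNIV" by simp
  moreover have bij: "bij (uminus :: int \<Rightarrow> int)"
    by (rule o_bij[of uminus]) (auto simp: fun_eq_iff)
  ultimately have 1: "((\<lambda>n. T (- n)) has_sum eta (\<i> * of_real t)) UNIV"
    by (subst has_sum_reindex_bij_betw[OF bij])
  have "T (- n) = of_real ((-1) powi n * exp (- pi * t * (6 * of_int n + 1)\<^sup>2 / 12))" for n
  proof -
    define e where "e = (- n) * (3 * (- n) - 1) div 2"
    have "2 dvd (- n) * (3 * (- n) - 1)" by simp
    hence "2 * e = n * (3 * n + 1)" unfolding e_def by (simp add: algebra_simps)
    hence e: "2 * real_of_int e = of_int n * (3 * of_int n + 1)"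
      by (metis of_int_add of_int_mult of_int_numeral of_int_1)
    have "q powi e = exp (of_int e * (- (2 * pi * t)))"
      unfolding q_def by (rule exp_power_int)
    hence "q powi e * exp (- (pi * t / 12)) = exp (of_int e * (- (2 * pi * t)) + - (pi * t / 12))"
      by (simp only: exp_add)
    also have "of_int e * (- (2 * pi * t)) + - (pi * t / 12) = - (pi * t) * (2 * of_int e + 1 / 12)"
      by (simp add: algebra_simps)
    also have "\<dots> = - pi * t * (6 * of_int n + 1)\<^sup>2 / 12"
      unfolding e by (simp add: power2_eq_square algebra_simps)
    finally have "q powi e * exp (- (pi * t / 12)) = exp (- pi * t * (6 * of_int n + 1)\<^sup>2 / 12)" .
    moreover have "T (- n) = of_real ((-1) powi n * (q powi e * exp (- (pi * t / 12))))"
      unfolding T_def e_def[symmetric] by (simp add: power_int_minus_left)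
    ultimately show ?thesis by simp
  qed
  hence "((\<lambda>n. complex_of_real ((-1) powi n * exp (- pi * t * (6 * of_int n + 1)\<^sup>2 / 12))) has_sum eta (\<i> * of_real t)) UNIV"
    using 1 by simp
  moreover have "((\<lambda>n. complex_of_real ((-1) powi n * exp (- pi * t * (6 * of_int n + 1)\<^sup>2 / 12))) has_sum of_real (eta_it t)) UNIV"
    by (intro has_sum_of_real eta_it_inversion_aux(1) t)
  ultimately show ?thesis by (rule has_sum_unique)
qed

lemma Im_minus_inverse: "Im (- (1 / \<tau>)) = Im \<tau> / (norm \<tau>)\<^sup>2"
  by (simp add: Im_divide cmod_power2)

lemma Im_minus_inverse_pos: "Im \<tau> > 0 \<Longrightarrow> Im (- (1 / \<tau>)) > 0"
  unfolding Im_minus_inverse by (rule divide_pos_pos) auto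

text \<open>Identity theorem, starting from the imaginary axis. As -i \<tau> has positive real part,
  the principal square root is holomorphic on the whole upper half-plane.\<close>

theorem eta_inversion:
  assumes "Im \<tau> > 0"
  shows "eta (- (1 / \<tau>)) = csqrt (- \<i> * \<tau>) * eta \<tau>"
proof -
  have "eta (- (1 / \<tau>)) - csqrt (- \<i> * \<tau>) * eta \<tau> = 0"
  proof (rule analytic_continuation[where f = "\<lambda>\<tau>. eta (- (1 / \<tau>)) - csqrt (- \<i> * \<tau>) * eta \<tau>" and S = upper_half and U = "{\<tau>. 0 < Im \<tau> \<and> Re \<tau> = 0}" and \<xi> = \<i>])
    show "(\<lambda>\<tau>. eta (- (1 / \<tau>)) - csqrt (- \<i> * \<tau>) * eta \<tau>) holomorphic_on upper_half"
      by (intro holomorphic_intros) (use Im_minus_inverse_pos in \<open>auto simp: complex_nonpos_Reals_iff\<close>)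
    show "\<i> islimpt {\<tau>. 0 < Im \<tau> \<and> Re \<tau> = 0}"
      unfolding islimpt_approachable
    proof (intro allI impI)
      fix e :: real assume "e > 0"
      thus "\<exists>x'\<in>{\<tau>. 0 < Im \<tau> \<and> Re \<tau> = 0}. x' \<noteq> \<i> \<and> dist x' \<i> < e"
        by (intro bexI[of _ "Complex 0 (1 + e / 2)"]) (auto simp: dist_norm cmod_def complex_eq_iff)
    qed
    fix z :: complex assume "z \<in> {\<tau>. 0 < Im \<tau> \<and> Re \<tau> = 0}"
    hence z: "z = \<i> * of_real (Im z)" "Im z > 0" by (auto simp: complex_eq_iff)
    define t where "t = Im z"
    have t: "t > 0" and z: "z = \<i> * of_real t" using z by (auto simp: t_def)
    have "- (1 / z) = \<i> * of_real (1 / t)"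
      using t by (simp add: z field_simps)
    hence "eta (- (1 / z)) = of_real (sqrt t * eta_it t)"
      using t eta_imaginary[of "1 / t"] eta_it_inversion[of t] by simp
    moreover have "- \<i> * z = of_real t" by (simp add: z)
    hence "csqrt (- \<i> * z) * eta z = of_real (sqrt t) * of_real (eta_it t)"
      unfolding z using t eta_imaginary[of t] by (simp add: csqrt_of_real)
    ultimately show "eta (- (1 / z)) - csqrt (- \<i> * z) * eta z = 0" by simp
  qed (use assms upper_half_simps in auto)
  thus ?thesis by simp
qed

section \<open>The 24th power of eta under the modular group\<close>

lemma eta24_inversion:
  assumes "Im \<tau> > 0"
  shows "eta (- (1 / \<tau>)) ^ 24 = \<tau> ^ 12 * eta \<tau> ^ 24"
proof -
  have "csqrt (- \<i> * \<tau>) ^ 24 = ((csqrt (- \<i> * \<tau>))\<^sup>2) ^ 12"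
    by (simp only: power_mult[symmetric]) simp
  also have "\<dots> = ((- \<i>)\<^sup>2) ^ 6 * \<tau> ^ 12"
    by (simp only: power2_csqrt power_mult_distrib power_mult[symmetric]) simp
  also have "\<dots> = \<tau> ^ 12"
    by simp
  finally show ?thesis
    unfolding eta_inversion[OF assms] power_mult_distrib by simp
qed

lemma eta24_translate: "eta (\<tau> + of_int k) ^ 24 = eta \<tau> ^ 24"
proof -
  have 1: "eta (\<tau> + 1) ^ 24 = eta \<tau> ^ 24" for \<tau>
  proof -
    have "exp (pi * \<i> / 12) ^ 24 = exp (24 * (pi * \<i> / 12))"
      using exp_of_nat_mult[of 24 "pi * \<i> / 12"] by simp
    also have "24 * (pi * \<i> / 12) = 2 * pi * \<i>" by simp
    finally show ?thesis unfolding eta_translate power_mult_distrib by simp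
  qed
  have nat: "eta (\<tau> + of_nat k) ^ 24 = eta \<tau> ^ 24" for \<tau> k
  proof (induction k)
    case (Suc k)
    have "eta (\<tau> + of_nat (Suc k)) ^ 24 = eta (\<tau> + of_nat k + 1) ^ 24" by (simp add: algebra_simps)
    thus ?case using Suc 1 by simp
  qed auto
  show ?thesis
  proof (cases "k \<ge> 0")
    case True
    thus ?thesis using nat[of \<tau> "nat k"] by simp
  next
    case False
    thus ?thesis using nat[of "\<tau> + of_int k" "nat (- k)"] by simp
  qed
qed

text \<open>Euclid's algorithm on the bottom row: translating by k = d div c and then inverting
  replaces (c, d) by (-r, c) with r = d mod c, until c = 0. The 24th power removes the square root
  of the inversion and the root of unity of the translation.\<close>

lemma eta24_modular:
  fixes a b c d :: int and \<tau> :: complex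
  assumes "a * d - b * c = 1" "Im \<tau> > 0"
  shows "Im ((of_int a * \<tau> + of_int b) / (of_int c * \<tau> + of_int d)) > 0 \<and>
     eta ((of_int a * \<tau> + of_int b) / (of_int c * \<tau> + of_int d)) ^ 24 =
       (of_int c * \<tau> + of_int d) ^ 12 * eta \<tau> ^ 24"
  using assms
proof (induction "nat \<bar>c\<bar>" arbitrary: a b c d \<tau> rule: less_induct)
  case less
  show ?case
  proof (cases "c = 0")
    case True
    hence ad: "a * d = 1" using less.prems by simp
    hence "a = 1 \<and> d = 1 \<or> a = -1 \<and> d = -1" by (simp add: zmult_eq_1_iff)
    thus ?thesis
    proof
      assume "a = 1 \<and> d = 1"
      thus ?thesis using True less.prems eta24_translate[of \<tau> b] by simp
    next
      assume "a = -1 \<and> d = -1"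
      thus ?thesis using True less.prems eta24_translate[of \<tau> "-b"] by simp
    qed
  next
    case False
    define k where "k = d div c"
    define r where "r = d mod c"
    have d: "d = k * c + r" by (simp add: k_def r_def)
    define \<tau>' where "\<tau>' = \<tau> + of_int k"
    define \<sigma> where "\<sigma> = - (1 / \<tau>')"
    have \<tau>': "Im \<tau>' > 0" using less.prems by (simp add: \<tau>'_def)
    have \<sigma>: "Im \<sigma> > 0" unfolding \<sigma>_def by (rule Im_minus_inverse_pos[OF \<tau>'])
    have nz: "\<tau>' \<noteq> 0" using \<tau>' by auto
    have r: "nat \<bar>- r\<bar> < nat \<bar>c\<bar>"
      using False abs_mod_less[of c d] unfolding r_def by simp
    have det: "(- (b - a * k)) * c - a * (- r) = 1"
      using less.prems(1) unfolding d by (simp add: algebra_simps)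
    have IH: "Im ((of_int (- (b - a * k)) * \<sigma> + of_int a) / (of_int (- r) * \<sigma> + of_int c)) > 0 \<and>
      eta ((of_int (- (b - a * k)) * \<sigma> + of_int a) / (of_int (- r) * \<sigma> + of_int c)) ^ 24 =
        (of_int (- r) * \<sigma> + of_int c) ^ 12 * eta \<sigma> ^ 24"
      by (rule less.hyps[OF r det \<sigma>])
    have num: "of_int (- (b - a * k)) * \<sigma> + of_int a = (of_int a * \<tau> + of_int b) / \<tau>'"
      using nz unfolding \<sigma>_def by (simp add: field_simps \<tau>'_def)
    have den: "of_int (- r) * \<sigma> + of_int c = (of_int c * \<tau> + of_int d) / \<tau>'"
      using nz unfolding \<sigma>_def d by (simp add: field_simps \<tau>'_def)
    have "eta \<sigma> ^ 24 = \<tau>' ^ 12 * eta \<tau> ^ 24"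
      unfolding \<sigma>_def eta24_inversion[OF \<tau>'] unfolding \<tau>'_def eta24_translate ..
    thus ?thesis using IH nz unfolding num den by (simp add: power_divide)
  qed
qed


text \<open>The paper's \<open>u\<^sub>1\<close> and \<open>u\<^sub>7\<close> are \<open>hm \<tau>\<close> and \<open>hm (7 \<tau>)\<close> for \<open>q = exp (2 \<pi> i \<tau>)\<close>;
  \<open>hm\<close> is a Hauptmodul of the group usually written \<open>\<Gamma>\<^sub>0(21)+3\<close>.\<close>

definition hm :: "complex \<Rightarrow> complex" where
  "hm \<tau> = eta \<tau> * eta (3 * \<tau>) / (eta (7 * \<tau>) * eta (21 * \<tau>))"

lemma hm_nonzero: "Im \<tau> > 0 \<Longrightarrow> hm \<tau> \<noteq> 0"
  by (simp add: hm_def eta_nonzero)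

lemma hm_holomorphic: "hm holomorphic_on upper_half"
  unfolding hm_def by (intro holomorphic_intros) (auto simp: eta_nonzero)

lemma hm_holomorphic' [holomorphic_intros]:
  assumes "f holomorphic_on A" "\<And>z. z \<in> A \<Longrightarrow> Im (f z) > 0"
  shows "(\<lambda>z. hm (f z)) holomorphic_on A"
  using holomorphic_on_compose_gen[OF assms(1) hm_holomorphic] assms(2) by (auto simp: o_def)

lemma eta_of_nat_mult:
  "eta (of_nat n * \<tau>) = exp (of_nat n * (pi * \<i> * \<tau> / 12)) * f_sub n (exp (2 * pi * \<i> * \<tau>))"
  unfolding eta_def f_sub_def exp_of_nat_mult[symmetric] by (simp add: mult_ac)

text \<open>Because 7 + 21 - 1 - 3 = 24, the fractional powers of q in the four etas combine to one
  power of q, and the roots of unity picked up under translation combine to a 24th power.\<close>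

lemma eta_weight_cancel:
  fixes z :: "'a :: field"
  assumes "z \<noteq> 0"
  shows "(z ^ 1 * A) * (z ^ 3 * B) / ((z ^ 7 * C) * (z ^ 21 * D)) = A * B / (z ^ 24 * (C * D))"
proof -
  have "(z ^ 1 * A) * (z ^ 3 * B) = z ^ 4 * (A * B)" "(z ^ 7 * C) * (z ^ 21 * D) = z ^ 4 * (z ^ 24 * (C * D))"
    by algebra+
  thus ?thesis using assms by (simp only: mult_divide_mult_cancel_left power_not_zero not_False_eq_True)
qed

lemma u_quot_eq_hm:
  assumes "Im \<tau> > 0" "r > 0"
  shows "u_quot r (exp (2 * pi * \<i> * \<tau>)) = hm (of_nat r * \<tau>)"
proof -
  define q where "q = exp (2 * pi * \<i> * \<tau>)"
  define e where "e = exp (of_nat r * (pi * \<i> * \<tau> / 12))"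
  have e: "exp (of_nat (n * r) * (pi * \<i> * \<tau> / 12)) = e ^ n" for n
    unfolding e_def exp_of_nat_mult[symmetric] by (simp add: mult_ac)
  have q: "q ^ r = e ^ 24"
    unfolding q_def e_def exp_of_nat_mult[symmetric] by (simp add: mult_ac)
  have e0: "e \<noteq> 0" by (simp add: e_def)
  have "f_sub n q \<noteq> 0" if "n > 0" for n
    unfolding f_sub_def
  proof (rule f_neg_nonzero)
    show "norm (q ^ n) < 1"
      using norm_nome_less[OF assms(1)] that unfolding q_def norm_power by (subst power_less_one_iff) auto
  qed
  hence nz: "f_sub (7 * r) q \<noteq> 0" "f_sub (21 * r) q \<noteq> 0" using assms by auto
  have a: "of_nat r * \<tau> = of_nat (1 * r) * \<tau>" "3 * (of_nat r * \<tau>) = of_nat (3 * r) * \<tau>"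
    "7 * (of_nat r * \<tau>) = of_nat (7 * r) * \<tau>" "21 * (of_nat r * \<tau>) = of_nat (21 * r) * \<tau>" by auto
  have "hm (of_nat r * \<tau>) = (e ^ 1 * f_sub (1 * r) q) * (e ^ 3 * f_sub (3 * r) q) / ((e ^ 7 * f_sub (7 * r) q) * (e ^ 21 * f_sub (21 * r) q))"
    unfolding hm_def a(2-4) unfolding a(1) eta_of_nat_mult e q_def ..
  also have "\<dots> = u_quot r q"
    unfolding u_quot_def q eta_weight_cancel[OF e0] by simp
  finally show ?thesis by (simp add: q_def)
qed

section \<open>\<open>hm\<close> under the Fricke involution and under elliptic elements\<close>

lemma csqrt_scale:
  assumes "r \<ge> 0"
  shows "csqrt (of_real r * z) = of_real (sqrt r) * csqrt z"
proof (cases "r = 0")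
  case False
  show ?thesis
  proof (rule csqrt_unique)
    show "(of_real (sqrt r) * csqrt z)\<^sup>2 = of_real r * z"
      using assms by (simp add: power_mult_distrib flip: of_real_power)
    show "0 < Re (of_real (sqrt r) * csqrt z) \<or> Re (of_real (sqrt r) * csqrt z) = 0 \<and> 0 \<le> Im (of_real (sqrt r) * csqrt z)"
      using csqrt_principal[of z] assms False by (auto simp: zero_less_mult_iff)
  qed
qed auto

text \<open>The involution exchanges the levels 1 and 21 as well as 3 and 7, so numerator and
  denominator trade places. The automorphy factors cancel and leave sqrt 21 sqrt 7 / sqrt 3 =
  7.\<close>

lemma hm_fricke:
  assumes "Im \<tau> > 0"
  shows "hm (- (1 / (21 * \<tau>))) = 7 / hm \<tau>"
proof -
  define s where "s = csqrt (- \<i> * \<tau>)"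
  have "\<tau> \<noteq> 0" using assms by auto
  hence s: "s \<noteq> 0" by (simp add: s_def)
  have inv: "eta (- (1 / (of_real r * \<tau>))) = of_real (sqrt r) * s * eta (of_real r * \<tau>)" if "r > 0" for r
  proof -
    have "eta (- (1 / (of_real r * \<tau>))) = csqrt (- \<i> * (of_real r * \<tau>)) * eta (of_real r * \<tau>)"
      using assms that by (intro eta_inversion) simp
    also have "- \<i> * (of_real r * \<tau>) = of_real r * (- \<i> * \<tau>)" by simp
    also have "csqrt (of_real r * (- \<i> * \<tau>)) = of_real (sqrt r) * s"
      unfolding s_def using that by (intro csqrt_scale) auto
    finally show ?thesis .
  qed
  have a: "3 * - (1 / (21 * \<tau>)) = - (1 / (7 * \<tau>))" "7 * - (1 / (21 * \<tau>)) = - (1 / (3 * \<tau>))"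
     "21 * - (1 / (21 * \<tau>)) = - (1 / (1 * \<tau>))"
    using \<open>\<tau> \<noteq> 0\<close> by (simp_all add: field_simps)
  have nz: "eta \<tau> \<noteq> 0" "eta (3 * \<tau>) \<noteq> 0" "eta (7 * \<tau>) \<noteq> 0" "eta (21 * \<tau>) \<noteq> 0"
    using assms by (auto intro!: eta_nonzero)
  have sq: "complex_of_real (sqrt 21) * of_real (sqrt 7) = 7 * of_real (sqrt 3)"
  proof -
    have "sqrt 21 * sqrt 7 = sqrt (7\<^sup>2 * 3)" by (simp only: real_sqrt_mult[symmetric]) simp
    also have "\<dots> = 7 * sqrt 3" by (simp only: real_sqrt_mult real_sqrt_abs abs_numeral)
    finally have "complex_of_real (sqrt 21 * sqrt 7) = of_real (7 * sqrt 3)" by (simp only:)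
    thus ?thesis by (simp only: of_real_mult of_real_numeral)
  qed
  have "hm (- (1 / (21 * \<tau>))) =
     (of_real (sqrt 21) * s * eta (21 * \<tau>)) * (of_real (sqrt 7) * s * eta (7 * \<tau>)) /
     ((of_real (sqrt 3) * s * eta (3 * \<tau>)) * (of_real (sqrt 1) * s * eta (1 * \<tau>)))"
    unfolding hm_def a using inv[of 21] inv[of 7] inv[of 3] inv[of 1] by simp
  also have "\<dots> = (of_real (sqrt 21) * of_real (sqrt 7)) * (eta (21 * \<tau>) * eta (7 * \<tau>)) /
     (of_real (sqrt 3) * (eta (3 * \<tau>) * eta \<tau>))"
    using s nz by (simp add: divide_simps)
  also have "\<dots> = 7 / hm \<tau>"
    unfolding sq hm_def using nz by (simp add: field_simps)
  finally show ?thesis .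
qed

definition moeb :: "int \<Rightarrow> int \<Rightarrow> int \<Rightarrow> int \<Rightarrow> complex \<Rightarrow> complex" where
  "moeb a b c d \<tau> = (of_int a * \<tau> + of_int b) / (of_int c * \<tau> + of_int d)"

definition hm_symmetry :: "bool \<Rightarrow> int \<Rightarrow> int \<Rightarrow> int \<Rightarrow> int \<Rightarrow> bool" where
  "hm_symmetry e a b c d \<longleftrightarrow> (\<forall>\<tau>. Im \<tau> > 0 \<longrightarrow>
     Im (moeb a b c d \<tau>) > 0 \<and> hm (moeb a b c d \<tau>) = (if e then 7 / hm \<tau> else hm \<tau>))"

text \<open>These matrices of determinant 3 are the Atkin-Lehner elements for the prime 3 at level
  21. They exchange eta at \<tau> with eta at 3 \<tau>, and eta at 7 \<tau> with eta at 21 \<tau>,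
  so the factors \<open>E ^ 12\<close> and \<open>D ^ 12\<close> occur once above and once
  below.\<close>

lemma hm_pow24:
  fixes a b c d :: int
  assumes det: "3 * a * d - 7 * b * c = 1" and \<tau>: "Im \<tau> > 0"
  shows "Im (moeb (3 * a) b (21 * c) (3 * d) \<tau>) > 0"
    and "hm (moeb (3 * a) b (21 * c) (3 * d) \<tau>) ^ 24 = hm \<tau> ^ 24"
proof -
  let ?M = "moeb (3 * a) b (21 * c) (3 * d) \<tau>"
  have pos: "Im (3 * \<tau>) > 0" "Im (7 * \<tau>) > 0" "Im (21 * \<tau>) > 0" using \<tau> by auto
  have d1: "a * (3 * d) - b * (7 * c) = 1" "(3 * a) * d - b * (7 * c) = 1"
    "a * (3 * d) - (7 * b) * c = 1" "(3 * a) * d - (7 * b) * c = 1"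
    using det by (auto simp: algebra_simps)
  note m1 = eta24_modular[OF d1(1) pos(1)] and m3 = eta24_modular[OF d1(2) \<tau>]
    and m7 = eta24_modular[OF d1(3) pos(3)] and m21 = eta24_modular[OF d1(4) pos(2)]
  define D where "D = 7 * of_int c * \<tau> + of_int d"
  define E where "E = 21 * of_int c * \<tau> + 3 * of_int d"
  have ED: "E = 3 * D" by (simp add: D_def E_def)
  have D0: "D \<noteq> 0"
  proof
    assume "D = 0"
    hence "of_int (7 * c) * \<tau> + of_int d = 0" by (simp add: D_def)
    with m3 show False by simp
  qed
  have e1: "(of_int a * (3 * \<tau>) + of_int b) / (of_int (7 * c) * (3 * \<tau>) + of_int (3 * d)) = ?M"
    by (simp add: moeb_def algebra_simps)
  have M: "?M = (3 * of_int a * \<tau> + of_int b) / (3 * D)"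
    by (simp add: moeb_def D_def algebra_simps)
  have e3: "(of_int (3 * a) * \<tau> + of_int b) / (of_int (7 * c) * \<tau> + of_int d) = 3 * ?M"
  proof -
    have "(of_int (3 * a) * \<tau> + of_int b) / (of_int (7 * c) * \<tau> + of_int d) = (3 * of_int a * \<tau> + of_int b) / D"
      by (simp add: D_def)
    moreover have "X / D = 3 * (X / (3 * D))" for X
      using D0 by simp
    from this[of "3 * of_int a * \<tau> + of_int b"]
    have "(3 * of_int a * \<tau> + of_int b) / D = 3 * ?M" unfolding M .
    ultimately show ?thesis by (simp only:)
  qed
  have e7: "(of_int a * (21 * \<tau>) + of_int (7 * b)) / (of_int c * (21 * \<tau>) + of_int (3 * d)) = 7 * ?M"
    by (simp add: moeb_def algebra_simps)
  have e21: "(of_int (3 * a) * (7 * \<tau>) + of_int (7 * b)) / (of_int c * (7 * \<tau>) + of_int d) = 21 * ?M"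
  proof -
    have "(of_int (3 * a) * (7 * \<tau>) + of_int (7 * b)) / (of_int c * (7 * \<tau>) + of_int d) =
        7 * (3 * of_int a * \<tau> + of_int b) / D"
      by (simp add: D_def algebra_simps)
    moreover have "7 * X / D = 21 * (X / (3 * D))" for X
      using D0 by simp
    from this[of "3 * of_int a * \<tau> + of_int b"]
    have "7 * (3 * of_int a * \<tau> + of_int b) / D = 21 * ?M" unfolding M .
    ultimately show ?thesis by (simp only:)
  qed
  show "Im ?M > 0" using m1 unfolding e1 by blast
  have nz: "eta \<tau> \<noteq> 0" "eta (3 * \<tau>) \<noteq> 0" "eta (7 * \<tau>) \<noteq> 0" "eta (21 * \<tau>) \<noteq> 0"
    using \<tau> by (auto intro!: eta_nonzero)
  have f1: "eta ?M ^ 24 = E ^ 12 * eta (3 * \<tau>) ^ 24"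
    using m1 unfolding e1 by (simp add: E_def mult_ac)
  have f3: "eta (3 * ?M) ^ 24 = D ^ 12 * eta \<tau> ^ 24"
    using m3 unfolding e3 by (simp add: D_def mult_ac)
  have f7: "eta (7 * ?M) ^ 24 = E ^ 12 * eta (21 * \<tau>) ^ 24"
    using m7 unfolding e7 by (simp add: E_def mult_ac)
  have f21: "eta (21 * ?M) ^ 24 = D ^ 12 * eta (7 * \<tau>) ^ 24"
    using m21 unfolding e21 by (simp add: D_def mult_ac)
  show "hm ?M ^ 24 = hm \<tau> ^ 24"
    unfolding hm_def power_divide power_mult_distrib f1 f3 f7 f21
    using D0 nz by (simp add: ED field_simps)
qed

text \<open>The multiplier is a root of unity depending continuously on \<open>\<tau>\<close>, hence constant, and it is \<open>1\<close> at a fixed point.\<close>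

lemma hm_elliptic:
  assumes det: "3 * a * d - 7 * b * c = 1" and "Im z > 0" "moeb (3 * a) b (21 * c) (3 * d) z = z"
  shows "hm_symmetry False (3 * a) b (21 * c) (3 * d)"
proof -
  let ?M = "moeb (3 * a) b (21 * c) (3 * d)"
  define f where "f \<tau> = hm (?M \<tau>) / hm \<tau>" for \<tau>
  have M_pos: "Im (?M \<tau>) > 0" if "Im \<tau> > 0" for \<tau>
    using hm_pow24(1)[OF det that] .
  have den: "of_int (21 * c) * \<tau> + of_int (3 * d) \<noteq> 0" if "Im \<tau> > 0" for \<tau>
    using M_pos[OF that] by (auto simp: moeb_def)
  have Mh: "?M holomorphic_on upper_half"
    unfolding moeb_def by (intro holomorphic_intros) (use den in auto)
  have "f holomorphic_on upper_half"
    unfolding f_def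
    by (intro holomorphic_intros Mh) (auto simp: hm_nonzero M_pos)
  hence cont: "continuous_on upper_half f" by (rule holomorphic_on_imp_continuous_on)
  have "f \<tau> ^ 24 = 1" if "Im \<tau> > 0" for \<tau>
    using hm_pow24(2)[OF det that] hm_nonzero[OF that] by (simp add: f_def power_divide)
  hence "f ` upper_half \<subseteq> {w. w ^ 24 = 1}" by auto
  hence "finite (f ` upper_half)"
    using finite_nth_roots[of 24 1] by (auto intro: finite_subset)
  then have "f constant_on upper_half"
    using continuous_finite_range_constant[OF upper_half_simps(2) cont] by blast
  then obtain k where k: "\<And>\<tau>. Im \<tau> > 0 \<Longrightarrow> f \<tau> = k"
    unfolding constant_on_def by auto
  have "k = 1"
    using k[OF assms(2)] assms(3) hm_nonzero[OF assms(2)] by (simp add: f_def)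
  show ?thesis
    unfolding hm_symmetry_def
  proof (intro allI impI conjI)
    fix \<tau> :: complex assume t: "Im \<tau> > 0"
    show "Im (?M \<tau>) > 0" using M_pos[OF t] .
    show "hm (?M \<tau>) = (if False then 7 / hm \<tau> else hm \<tau>)"
      using k[OF t] hm_nonzero[OF t] \<open>k = 1\<close> by (simp add: f_def)
  qed
qed

text \<open>\<open>W\<close> is the Fricke involution of level 21, \<open>R\<close> and \<open>X\<close> are elliptic elements of order 6 and 2 of
  \<open>\<Gamma>\<^sub>0(21)+3\<close>, and \<open>R'\<close> is the inverse of \<open>R\<close> (up to a scalar).\<close>

datatype gen = T int | W | R | R' | X

fun gen_mat :: "gen \<Rightarrow> int \<times> int \<times> int \<times> int" where
  "gen_mat (T k) = (1, k, 0, 1)"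
| "gen_mat W = (0, -1, 21, 0)"
| "gen_mat R = (6, -1, 21, -3)"
| "gen_mat R' = (-3, 1, -21, 6)"
| "gen_mat X = (9, -4, 21, -9)"

section \<open>Words in the symmetries as integer matrices\<close>

fun mat_mul :: "int \<times> int \<times> int \<times> int \<Rightarrow> int \<times> int \<times> int \<times> int \<Rightarrow> int \<times> int \<times> int \<times> int" where
  "mat_mul (a, b, c, d) (a', b', c', d') = (a * a' + b * c', a * b' + b * d', c * a' + d * c', c * b' + d * d')"

fun word_mat :: "gen list \<Rightarrow> int \<times> int \<times> int \<times> int" where
  "word_mat [] = (1, 0, 0, 1)"
| "word_mat (g # gs) = mat_mul (gen_mat g) (word_mat gs)"

fun word_sign :: "gen list \<Rightarrow> bool" where
  "word_sign [] = False"
| "word_sign (g # gs) = ((g = W) \<noteq> word_sign gs)"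

lemma hm_translate: "hm (\<tau> + 1) = hm \<tau>"
proof -
  define z where "z = exp (pi * \<i> / 12)"
  have e: "eta (\<tau> + of_nat n) = z ^ n * eta \<tau>" for \<tau> n
  proof (induction n)
    case (Suc n)
    have "eta (\<tau> + of_nat (Suc n)) = eta (\<tau> + of_nat n + 1)" by (simp add: algebra_simps)
    thus ?case using Suc by (simp add: eta_translate z_def)
  qed auto
  have z0: "z \<noteq> 0" by (simp add: z_def)
  have "z ^ 24 = exp (24 * (pi * \<i> / 12))"
    unfolding z_def using exp_of_nat_mult[of 24 "pi * \<i> / 12"] by simp
  also have "24 * (pi * \<i> / 12) = 2 * pi * \<i>" by simp
  finally have z24: "z ^ 24 = 1" by simp
  have "hm (\<tau> + 1) = (z ^ 1 * eta \<tau>) * (z ^ 3 * eta (3 * \<tau>)) / ((z ^ 7 * eta (7 * \<tau>)) * (z ^ 21 * eta (21 * \<tau>)))"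
    unfolding hm_def distrib_left using e[of _ 1] e[of _ 3] e[of _ 7] e[of _ 21] by simp
  also have "\<dots> = hm \<tau>"
    unfolding eta_weight_cancel[OF z0] z24 by (simp add: hm_def)
  finally show ?thesis .
qed

lemma hm_translate_int: "hm (\<tau> + of_int k) = hm \<tau>"
proof -
  have nat: "hm (\<tau> + of_nat k) = hm \<tau>" for \<tau> k
  proof (induction k)
    case (Suc k)
    have "hm (\<tau> + of_nat (Suc k)) = hm (\<tau> + of_nat k + 1)" by (simp add: algebra_simps)
    thus ?case using Suc hm_translate by simp
  qed auto
  show ?thesis
  proof (cases "k \<ge> 0")
    case True
    thus ?thesis using nat[of \<tau> "nat k"] by simp
  next
    case False
    thus ?thesis using nat[of "\<tau> + of_int k" "nat (- k)"] by simp
  qed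
qed

lemma hm_symmetry_gen:
  assumes "gen_mat g = (a, b, c, d)"
  shows "hm_symmetry (g = W) a b c d"
proof (cases g)
  case (T k)
  thus ?thesis using assms by (simp add: hm_symmetry_def moeb_def hm_translate_int)
next
  case W
  have "hm_symmetry True 0 (-1) 21 0"
    unfolding hm_symmetry_def
  proof (intro allI impI conjI)
    fix \<tau> :: complex assume t: "Im \<tau> > 0"
    have e: "moeb 0 (-1) 21 0 \<tau> = - (1 / (21 * \<tau>))" by (simp add: moeb_def)
    show "Im (moeb 0 (-1) 21 0 \<tau>) > 0" unfolding e by (rule Im_minus_inverse_pos) (use t in simp)
    show "hm (moeb 0 (-1) 21 0 \<tau>) = (if True then 7 / hm \<tau> else hm \<tau>)"
      unfolding e using hm_fricke[OF t] by simp
  qed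
  thus ?thesis using assms W by simp
next
  case R
  \<comment> \<open>The root in the upper half-plane of 21 z^2 - 9 z + 1 = 0, the fixed point of
    \<open>R\<close> and of \<open>R'\<close>.\<close>
  define z where "z = Complex (9 / 42) (sqrt 3 / 42)"
  have "hm_symmetry False (3 * 2) (-1) (21 * 1) (3 * (-1))"
    by (rule hm_elliptic[of _ _ _ _ z])
       (auto simp: z_def moeb_def complex_eq_iff Re_divide Im_divide power2_eq_square divide_simps)
  thus ?thesis using assms R by simp
next
  case R'
  define z where "z = Complex (9 / 42) (sqrt 3 / 42)"
  have "hm_symmetry False (3 * (-1)) 1 (21 * (-1)) (3 * 2)"
    by (rule hm_elliptic[of _ _ _ _ z])
       (auto simp: z_def moeb_def complex_eq_iff Re_divide Im_divide power2_eq_square divide_simps)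
  thus ?thesis using assms R' by simp
next
  case X
  \<comment> \<open>The root in the upper half-plane of 21 z^2 - 18 z + 4 = 0, the fixed point
    equation of \<open>X\<close>.\<close>
  define z where "z = Complex (9 / 21) (sqrt 3 / 21)"
  have "hm_symmetry False (3 * 3) (-4) (21 * 1) (3 * (-3))"
    by (rule hm_elliptic[of _ _ _ _ z])
       (auto simp: z_def moeb_def complex_eq_iff Re_divide Im_divide power2_eq_square divide_simps)
  thus ?thesis using assms X by simp
qed

section \<open>Translates of the modular equation\<close>

fun mob :: "int \<times> int \<times> int \<times> int \<Rightarrow> complex \<Rightarrow> complex" where
  "mob (a, b, c, d) \<tau> = moeb a b c d \<tau>"

lemma mob_mat_mul:
  assumes "Im \<tau> > 0" "Im (mob N \<tau>) > 0"
  shows "mob (mat_mul M N) \<tau> = mob M (mob N \<tau>)"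
proof -
  obtain a b c d where M: "M = (a, b, c, d)" by (cases M)
  obtain a' b' c' d' where N: "N = (a', b', c', d')" by (cases N)
  define \<sigma> where "\<sigma> = mob N \<tau>"
  define D where "D = of_int c' * \<tau> + of_int d'"
  have D0: "D \<noteq> 0" using assms(2) by (auto simp: N moeb_def D_def)
  have sD: "\<sigma> * D = of_int a' * \<tau> + of_int b'" using D0 by (simp add: \<sigma>_def N moeb_def D_def)
  have mm: "(of_int x * \<sigma> + of_int y) * D = of_int (x * a' + y * c') * \<tau> + of_int (x * b' + y * d')" for x y
  proof -
    have "(of_int x * \<sigma> + of_int y) * D = of_int x * (of_int a' * \<tau> + of_int b') + of_int y * D"
      by (simp add: distrib_right mult.assoc sD)
    thus ?thesis by (simp add: D_def algebra_simps)
  qed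
  have "mob (mat_mul M N) \<tau> = ((of_int a * \<sigma> + of_int b) * D) / ((of_int c * \<sigma> + of_int d) * D)"
    unfolding M N mm by (simp only: mob.simps mat_mul.simps moeb_def)
  also have "\<dots> = mob M \<sigma>" using D0 by (simp add: M moeb_def)
  finally show ?thesis by (simp add: \<sigma>_def)
qed

text \<open>The generators have different determinants, so words represent a Moebius map only up to
  an integer factor; matrix identities are therefore stated with a scalar on each side.\<close>

fun mat_scale :: "int \<Rightarrow> int \<times> int \<times> int \<times> int \<Rightarrow> int \<times> int \<times> int \<times> int" where
  "mat_scale k (a, b, c, d) = (k * a, k * b, k * c, k * d)"

lemma mob_scale:
  assumes "k \<noteq> 0"
  shows "mob (mat_scale k M) \<tau> = mob M \<tau>"
proof -
  obtain a b c d where M: "M = (a, b, c, d)" by (cases M)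
  have "mob (mat_scale k M) \<tau> = (of_int k * (of_int a * \<tau> + of_int b)) / (of_int k * (of_int c * \<tau> + of_int d))"
    by (simp add: M moeb_def algebra_simps)
  thus ?thesis using assms by (simp add: M moeb_def)
qed

lemma hm_word:
  assumes "Im \<tau> > 0"
  shows "Im (mob (word_mat w) \<tau>) > 0"
    and "hm (mob (word_mat w) \<tau>) = (if word_sign w then 7 / hm \<tau> else hm \<tau>)"
proof -
  have "Im (mob (word_mat w) \<tau>) > 0 \<and>
      hm (mob (word_mat w) \<tau>) = (if word_sign w then 7 / hm \<tau> else hm \<tau>)"
  proof (induction w)
    case (Cons g w)
    obtain a b c d where g: "gen_mat g = (a, b, c, d)" by (cases "gen_mat g")
    have "mob (word_mat (g # w)) \<tau> = moeb a b c d (mob (word_mat w) \<tau>)"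
      using mob_mat_mul[OF assms, of "word_mat w" "gen_mat g"] Cons g by simp
    thus ?case
      using hm_symmetry_gen[OF g] Cons by (auto simp: hm_symmetry_def)
  qed (use assms in \<open>simp add: moeb_def\<close>)
  thus "Im (mob (word_mat w) \<tau>) > 0"
    and "hm (mob (word_mat w) \<tau>) = (if word_sign w then 7 / hm \<tau> else hm \<tau>)" by auto
qed

text \<open>In the tables below, L and N are the maps to (\<tau> + j) / 7, 7 \<tau> or \<tau> + k /
  7, and G is a generator. The hypothesis \<open>eq\<close> says that L after G and N differ by a
  word in the symmetries of \<open>hm\<close>, so each table entry becomes one integer matrix
  computation.\<close>

lemma hm_orbit_word:
  assumes "Im \<tau> > 0" "Im (mob G \<tau>) > 0"
    and "Im (mob N \<tau>) > 0" "k \<noteq> 0" "l \<noteq> 0"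
    and eq: "mat_scale k (mat_mul L G) = mat_scale l (mat_mul (word_mat w) N)"
  shows "hm (mob L (mob G \<tau>)) = (if word_sign w then 7 / hm (mob N \<tau>) else hm (mob N \<tau>))"
proof -
  have "mob L (mob G \<tau>) = mob (mat_scale k (mat_mul L G)) \<tau>"
    by (simp only: mob_scale[OF assms(4)] mob_mat_mul[OF assms(1,2)])
  also have "\<dots> = mob (word_mat w) (mob N \<tau>)"
    unfolding eq by (simp only: mob_scale[OF assms(5)] mob_mat_mul[OF assms(1,3)])
  finally show ?thesis using hm_word(2)[OF assms(3), of w] by simp
qed

lemma mob_gen_pos: "Im \<tau> > 0 \<Longrightarrow> Im (mob (gen_mat g) \<tau>) > 0"
  using hm_word(1)[of \<tau> "[g]"] by (cases g) simp_all

lemma mob_pos: "Im \<tau> > 0 \<Longrightarrow> a > 0 \<Longrightarrow> d > 0 \<Longrightarrow> Im (mob (a, b, 0, d) \<tau>) > 0"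
  by (simp add: moeb_def)

text \<open>The words \<open>w\<close> were found by reducing the matrices \<open>L G N\<^sup>-\<^sup>1\<close> by the isometric circles
  of \<open>raise_Im\<close> below.\<close>

lemma hm_orbit_T:
  assumes "Im \<tau> > 0"
  shows
    "hm (mob (1, 0, 0, 7) (mob (gen_mat (T 1)) \<tau>)) = hm (mob (1, 1, 0, 7) \<tau>)"
    "hm (mob (1, 1, 0, 7) (mob (gen_mat (T 1)) \<tau>)) = hm (mob (1, 2, 0, 7) \<tau>)"
    "hm (mob (1, 2, 0, 7) (mob (gen_mat (T 1)) \<tau>)) = hm (mob (1, 3, 0, 7) \<tau>)"
    "hm (mob (1, 3, 0, 7) (mob (gen_mat (T 1)) \<tau>)) = hm (mob (1, 4, 0, 7) \<tau>)"
    "hm (mob (1, 4, 0, 7) (mob (gen_mat (T 1)) \<tau>)) = hm (mob (1, 5, 0, 7) \<tau>)"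
    "hm (mob (1, 5, 0, 7) (mob (gen_mat (T 1)) \<tau>)) = hm (mob (1, 6, 0, 7) \<tau>)"
    "hm (mob (1, 6, 0, 7) (mob (gen_mat (T 1)) \<tau>)) = hm (mob (1, 0, 0, 7) \<tau>)"
    "hm (mob (7, 0, 0, 1) (mob (gen_mat (T 1)) \<tau>)) = hm (mob (7, 0, 0, 1) \<tau>)"
    "hm (mob (7, 1, 0, 7) (mob (gen_mat (T 1)) \<tau>)) = hm (mob (7, 1, 0, 7) \<tau>)"
    "hm (mob (7, 2, 0, 7) (mob (gen_mat (T 1)) \<tau>)) = hm (mob (7, 2, 0, 7) \<tau>)"
    "hm (mob (7, 3, 0, 7) (mob (gen_mat (T 1)) \<tau>)) = hm (mob (7, 3, 0, 7) \<tau>)"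
    "hm (mob (7, 4, 0, 7) (mob (gen_mat (T 1)) \<tau>)) = hm (mob (7, 4, 0, 7) \<tau>)"
    "hm (mob (7, 5, 0, 7) (mob (gen_mat (T 1)) \<tau>)) = hm (mob (7, 5, 0, 7) \<tau>)"
    "hm (mob (7, 6, 0, 7) (mob (gen_mat (T 1)) \<tau>)) = hm (mob (7, 6, 0, 7) \<tau>)"
proof -
  note pos = mob_gen_pos[OF assms, of "T 1"]
  show "hm (mob (1, 0, 0, 7) (mob (gen_mat (T 1)) \<tau>)) = hm (mob (1, 1, 0, 7) \<tau>)"
    using hm_orbit_word[where w = "[]" and k = "1" and l = "1" and L = "(1, 0, 0, 7)" and N = "(1, 1, 0, 7)", OF assms pos] pos
    by (simp add: mob_pos assms del: mob.simps)
  show "hm (mob (1, 1, 0, 7) (mob (gen_mat (T 1)) \<tau>)) = hm (mob (1, 2, 0, 7) \<tau>)"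
    using hm_orbit_word[where w = "[]" and k = "1" and l = "1" and L = "(1, 1, 0, 7)" and N = "(1, 2, 0, 7)", OF assms pos] pos
    by (simp add: mob_pos assms del: mob.simps)
  show "hm (mob (1, 2, 0, 7) (mob (gen_mat (T 1)) \<tau>)) = hm (mob (1, 3, 0, 7) \<tau>)"
    using hm_orbit_word[where w = "[]" and k = "1" and l = "1" and L = "(1, 2, 0, 7)" and N = "(1, 3, 0, 7)", OF assms pos] pos
    by (simp add: mob_pos assms del: mob.simps)
  show "hm (mob (1, 3, 0, 7) (mob (gen_mat (T 1)) \<tau>)) = hm (mob (1, 4, 0, 7) \<tau>)"
    using hm_orbit_word[where w = "[]" and k = "1" and l = "1" and L = "(1, 3, 0, 7)" and N = "(1, 4, 0, 7)", OF assms pos] pos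
    by (simp add: mob_pos assms del: mob.simps)
  show "hm (mob (1, 4, 0, 7) (mob (gen_mat (T 1)) \<tau>)) = hm (mob (1, 5, 0, 7) \<tau>)"
    using hm_orbit_word[where w = "[]" and k = "1" and l = "1" and L = "(1, 4, 0, 7)" and N = "(1, 5, 0, 7)", OF assms pos] pos
    by (simp add: mob_pos assms del: mob.simps)
  show "hm (mob (1, 5, 0, 7) (mob (gen_mat (T 1)) \<tau>)) = hm (mob (1, 6, 0, 7) \<tau>)"
    using hm_orbit_word[where w = "[]" and k = "1" and l = "1" and L = "(1, 5, 0, 7)" and N = "(1, 6, 0, 7)", OF assms pos] pos
    by (simp add: mob_pos assms del: mob.simps)
  show "hm (mob (1, 6, 0, 7) (mob (gen_mat (T 1)) \<tau>)) = hm (mob (1, 0, 0, 7) \<tau>)"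
    using hm_orbit_word[where w = "[T 1]" and k = "1" and l = "1" and L = "(1, 6, 0, 7)" and N = "(1, 0, 0, 7)", OF assms pos] pos
    by (simp add: mob_pos assms del: mob.simps)
  show "hm (mob (7, 0, 0, 1) (mob (gen_mat (T 1)) \<tau>)) = hm (mob (7, 0, 0, 1) \<tau>)"
    using hm_orbit_word[where w = "[T 7]" and k = "1" and l = "1" and L = "(7, 0, 0, 1)" and N = "(7, 0, 0, 1)", OF assms pos] pos
    by (simp add: mob_pos assms del: mob.simps)
  show "hm (mob (7, 1, 0, 7) (mob (gen_mat (T 1)) \<tau>)) = hm (mob (7, 1, 0, 7) \<tau>)"
    using hm_orbit_word[where w = "[T 1]" and k = "1" and l = "1" and L = "(7, 1, 0, 7)" and N = "(7, 1, 0, 7)", OF assms pos] pos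
    by (simp add: mob_pos assms del: mob.simps)
  show "hm (mob (7, 2, 0, 7) (mob (gen_mat (T 1)) \<tau>)) = hm (mob (7, 2, 0, 7) \<tau>)"
    using hm_orbit_word[where w = "[T 1]" and k = "1" and l = "1" and L = "(7, 2, 0, 7)" and N = "(7, 2, 0, 7)", OF assms pos] pos
    by (simp add: mob_pos assms del: mob.simps)
  show "hm (mob (7, 3, 0, 7) (mob (gen_mat (T 1)) \<tau>)) = hm (mob (7, 3, 0, 7) \<tau>)"
    using hm_orbit_word[where w = "[T 1]" and k = "1" and l = "1" and L = "(7, 3, 0, 7)" and N = "(7, 3, 0, 7)", OF assms pos] pos
    by (simp add: mob_pos assms del: mob.simps)
  show "hm (mob (7, 4, 0, 7) (mob (gen_mat (T 1)) \<tau>)) = hm (mob (7, 4, 0, 7) \<tau>)"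
    using hm_orbit_word[where w = "[T 1]" and k = "1" and l = "1" and L = "(7, 4, 0, 7)" and N = "(7, 4, 0, 7)", OF assms pos] pos
    by (simp add: mob_pos assms del: mob.simps)
  show "hm (mob (7, 5, 0, 7) (mob (gen_mat (T 1)) \<tau>)) = hm (mob (7, 5, 0, 7) \<tau>)"
    using hm_orbit_word[where w = "[T 1]" and k = "1" and l = "1" and L = "(7, 5, 0, 7)" and N = "(7, 5, 0, 7)", OF assms pos] pos
    by (simp add: mob_pos assms del: mob.simps)
  show "hm (mob (7, 6, 0, 7) (mob (gen_mat (T 1)) \<tau>)) = hm (mob (7, 6, 0, 7) \<tau>)"
    using hm_orbit_word[where w = "[T 1]" and k = "1" and l = "1" and L = "(7, 6, 0, 7)" and N = "(7, 6, 0, 7)", OF assms pos] pos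
    by (simp add: mob_pos assms del: mob.simps)
qed

text \<open>For nonzero j the partner k satisfies j k = 2 mod 7: then 7 divides 3 j k + 1, and the
  connecting matrix (3 j, -(3 j k + 1) / 7, 21, -3 k) is integral of the shape in
  \<open>hm_pow24\<close>. Writing it as a word shows that its multiplier is 1. For j = 0 the
  partner is 7 \<tau> and \<open>W\<close> itself connects them, whence the inversion.\<close>

lemma hm_orbit_W:
  assumes "Im \<tau> > 0"
  shows
    "hm (mob (1, 0, 0, 7) (mob (gen_mat W) \<tau>)) = 7 / hm (mob (7, 0, 0, 1) \<tau>)"
    "hm (mob (1, 1, 0, 7) (mob (gen_mat W) \<tau>)) = hm (mob (7, 2, 0, 7) \<tau>)"
    "hm (mob (1, 2, 0, 7) (mob (gen_mat W) \<tau>)) = hm (mob (7, 1, 0, 7) \<tau>)"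
    "hm (mob (1, 3, 0, 7) (mob (gen_mat W) \<tau>)) = hm (mob (7, 3, 0, 7) \<tau>)"
    "hm (mob (1, 4, 0, 7) (mob (gen_mat W) \<tau>)) = hm (mob (7, 4, 0, 7) \<tau>)"
    "hm (mob (1, 5, 0, 7) (mob (gen_mat W) \<tau>)) = hm (mob (7, 6, 0, 7) \<tau>)"
    "hm (mob (1, 6, 0, 7) (mob (gen_mat W) \<tau>)) = hm (mob (7, 5, 0, 7) \<tau>)"
    "hm (mob (7, 0, 0, 1) (mob (gen_mat W) \<tau>)) = 7 / hm (mob (1, 0, 0, 7) \<tau>)"
    "hm (mob (7, 1, 0, 7) (mob (gen_mat W) \<tau>)) = hm (mob (1, 2, 0, 7) \<tau>)"
    "hm (mob (7, 2, 0, 7) (mob (gen_mat W) \<tau>)) = hm (mob (1, 1, 0, 7) \<tau>)"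
    "hm (mob (7, 3, 0, 7) (mob (gen_mat W) \<tau>)) = hm (mob (1, 3, 0, 7) \<tau>)"
    "hm (mob (7, 4, 0, 7) (mob (gen_mat W) \<tau>)) = hm (mob (1, 4, 0, 7) \<tau>)"
    "hm (mob (7, 5, 0, 7) (mob (gen_mat W) \<tau>)) = hm (mob (1, 6, 0, 7) \<tau>)"
    "hm (mob (7, 6, 0, 7) (mob (gen_mat W) \<tau>)) = hm (mob (1, 5, 0, 7) \<tau>)"
proof -
  note pos = mob_gen_pos[OF assms, of "W"]
  show "hm (mob (1, 0, 0, 7) (mob (gen_mat W) \<tau>)) = 7 / hm (mob (7, 0, 0, 1) \<tau>)"
    using hm_orbit_word[where w = "[W]" and k = "1" and l = "1" and L = "(1, 0, 0, 7)" and N = "(7, 0, 0, 1)", OF assms pos] pos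
    by (simp add: mob_pos assms del: mob.simps)
  show "hm (mob (1, 1, 0, 7) (mob (gen_mat W) \<tau>)) = hm (mob (7, 2, 0, 7) \<tau>)"
    using hm_orbit_word[where w = "[R']" and k = "-1" and l = "1" and L = "(1, 1, 0, 7)" and N = "(7, 2, 0, 7)", OF assms pos] pos
    by (simp add: mob_pos assms del: mob.simps)
  show "hm (mob (1, 2, 0, 7) (mob (gen_mat W) \<tau>)) = hm (mob (7, 1, 0, 7) \<tau>)"
    using hm_orbit_word[where w = "[R]" and k = "1" and l = "1" and L = "(1, 2, 0, 7)" and N = "(7, 1, 0, 7)", OF assms pos] pos
    by (simp add: mob_pos assms del: mob.simps)
  show "hm (mob (1, 3, 0, 7) (mob (gen_mat W) \<tau>)) = hm (mob (7, 3, 0, 7) \<tau>)"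
    using hm_orbit_word[where w = "[X]" and k = "1" and l = "1" and L = "(1, 3, 0, 7)" and N = "(7, 3, 0, 7)", OF assms pos] pos
    by (simp add: mob_pos assms del: mob.simps)
  show "hm (mob (1, 4, 0, 7) (mob (gen_mat W) \<tau>)) = hm (mob (7, 4, 0, 7) \<tau>)"
    using hm_orbit_word[where w = "[T 1, W, R', X, R, W, T (-1)]" and k = "-63" and l = "1" and L = "(1, 4, 0, 7)" and N = "(7, 4, 0, 7)", OF assms pos] pos
    by (simp add: mob_pos assms del: mob.simps)
  show "hm (mob (1, 5, 0, 7) (mob (gen_mat W) \<tau>)) = hm (mob (7, 6, 0, 7) \<tau>)"
    using hm_orbit_word[where w = "[T 1, W, R', W, T (-1)]" and k = "21" and l = "1" and L = "(1, 5, 0, 7)" and N = "(7, 6, 0, 7)", OF assms pos] pos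
    by (simp add: mob_pos assms del: mob.simps)
  show "hm (mob (1, 6, 0, 7) (mob (gen_mat W) \<tau>)) = hm (mob (7, 5, 0, 7) \<tau>)"
    using hm_orbit_word[where w = "[T 1, W, R, W, T (-1)]" and k = "-21" and l = "1" and L = "(1, 6, 0, 7)" and N = "(7, 5, 0, 7)", OF assms pos] pos
    by (simp add: mob_pos assms del: mob.simps)
  show "hm (mob (7, 0, 0, 1) (mob (gen_mat W) \<tau>)) = 7 / hm (mob (1, 0, 0, 7) \<tau>)"
    using hm_orbit_word[where w = "[W]" and k = "1" and l = "1" and L = "(7, 0, 0, 1)" and N = "(1, 0, 0, 7)", OF assms pos] pos
    by (simp add: mob_pos assms del: mob.simps)
  show "hm (mob (7, 1, 0, 7) (mob (gen_mat W) \<tau>)) = hm (mob (1, 2, 0, 7) \<tau>)"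
    using hm_orbit_word[where w = "[R']" and k = "-1" and l = "7" and L = "(7, 1, 0, 7)" and N = "(1, 2, 0, 7)", OF assms pos] pos
    by (simp add: mob_pos assms del: mob.simps)
  show "hm (mob (7, 2, 0, 7) (mob (gen_mat W) \<tau>)) = hm (mob (1, 1, 0, 7) \<tau>)"
    using hm_orbit_word[where w = "[R]" and k = "1" and l = "7" and L = "(7, 2, 0, 7)" and N = "(1, 1, 0, 7)", OF assms pos] pos
    by (simp add: mob_pos assms del: mob.simps)
  show "hm (mob (7, 3, 0, 7) (mob (gen_mat W) \<tau>)) = hm (mob (1, 3, 0, 7) \<tau>)"
    using hm_orbit_word[where w = "[X]" and k = "1" and l = "7" and L = "(7, 3, 0, 7)" and N = "(1, 3, 0, 7)", OF assms pos] pos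
    by (simp add: mob_pos assms del: mob.simps)
  show "hm (mob (7, 4, 0, 7) (mob (gen_mat W) \<tau>)) = hm (mob (1, 4, 0, 7) \<tau>)"
    using hm_orbit_word[where w = "[T 1, W, R', X, R, W, T (-1)]" and k = "-9" and l = "1" and L = "(7, 4, 0, 7)" and N = "(1, 4, 0, 7)", OF assms pos] pos
    by (simp add: mob_pos assms del: mob.simps)
  show "hm (mob (7, 5, 0, 7) (mob (gen_mat W) \<tau>)) = hm (mob (1, 6, 0, 7) \<tau>)"
    using hm_orbit_word[where w = "[T 1, W, R', W, T (-1)]" and k = "3" and l = "1" and L = "(7, 5, 0, 7)" and N = "(1, 6, 0, 7)", OF assms pos] pos
    by (simp add: mob_pos assms del: mob.simps)
  show "hm (mob (7, 6, 0, 7) (mob (gen_mat W) \<tau>)) = hm (mob (1, 5, 0, 7) \<tau>)"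
    using hm_orbit_word[where w = "[T 1, W, R, W, T (-1)]" and k = "-3" and l = "1" and L = "(7, 6, 0, 7)" and N = "(1, 5, 0, 7)", OF assms pos] pos
    by (simp add: mob_pos assms del: mob.simps)
qed

text \<open>Up to symmetries of \<open>hm\<close>, the seven points (\<tau> + j) / 7 are permuted
  among themselves, and so are 7 \<tau> and the six \<tau> + k / 7. In the second set 7 \<tau> takes
  the place of k = 0, and moving between it and the others inverts the value; hence
  \<open>modeq_orbit\<close> uses \<open>hm\<close> at 7 \<tau> but 7 / \<open>hm\<close> for the
  other six.\<close>

lemma hm_orbit_R:
  assumes "Im \<tau> > 0"
  shows
    "hm (mob (1, 0, 0, 7) (mob (gen_mat R) \<tau>)) = hm (mob (1, 1, 0, 7) \<tau>)"
    "hm (mob (1, 1, 0, 7) (mob (gen_mat R) \<tau>)) = hm (mob (1, 4, 0, 7) \<tau>)"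
    "hm (mob (1, 2, 0, 7) (mob (gen_mat R) \<tau>)) = hm (mob (1, 0, 0, 7) \<tau>)"
    "hm (mob (1, 3, 0, 7) (mob (gen_mat R) \<tau>)) = hm (mob (1, 3, 0, 7) \<tau>)"
    "hm (mob (1, 4, 0, 7) (mob (gen_mat R) \<tau>)) = hm (mob (1, 6, 0, 7) \<tau>)"
    "hm (mob (1, 5, 0, 7) (mob (gen_mat R) \<tau>)) = hm (mob (1, 2, 0, 7) \<tau>)"
    "hm (mob (1, 6, 0, 7) (mob (gen_mat R) \<tau>)) = hm (mob (1, 5, 0, 7) \<tau>)"
    "hm (mob (7, 0, 0, 1) (mob (gen_mat R) \<tau>)) = 7 / hm (mob (7, 6, 0, 7) \<tau>)"
    "hm (mob (7, 1, 0, 7) (mob (gen_mat R) \<tau>)) = hm (mob (7, 2, 0, 7) \<tau>)"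
    "hm (mob (7, 2, 0, 7) (mob (gen_mat R) \<tau>)) = hm (mob (7, 3, 0, 7) \<tau>)"
    "hm (mob (7, 3, 0, 7) (mob (gen_mat R) \<tau>)) = hm (mob (7, 5, 0, 7) \<tau>)"
    "hm (mob (7, 4, 0, 7) (mob (gen_mat R) \<tau>)) = hm (mob (7, 4, 0, 7) \<tau>)"
    "hm (mob (7, 5, 0, 7) (mob (gen_mat R) \<tau>)) = 7 / hm (mob (7, 0, 0, 1) \<tau>)"
    "hm (mob (7, 6, 0, 7) (mob (gen_mat R) \<tau>)) = hm (mob (7, 1, 0, 7) \<tau>)"
proof -
  note pos = mob_gen_pos[OF assms, of "R"]
  show "hm (mob (1, 0, 0, 7) (mob (gen_mat R) \<tau>)) = hm (mob (1, 1, 0, 7) \<tau>)"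
    using hm_orbit_word[where w = "[W, T (-1), W, R]" and k = "-21" and l = "1" and L = "(1, 0, 0, 7)" and N = "(1, 1, 0, 7)", OF assms pos] pos
    by (simp add: mob_pos assms del: mob.simps)
  show "hm (mob (1, 1, 0, 7) (mob (gen_mat R) \<tau>)) = hm (mob (1, 4, 0, 7) \<tau>)"
    using hm_orbit_word[where w = "[R', R', X, R, W, T (-1), R, W, T (-1)]" and k = "-189" and l = "1" and L = "(1, 1, 0, 7)" and N = "(1, 4, 0, 7)", OF assms pos] pos
    by (simp add: mob_pos assms del: mob.simps)
  show "hm (mob (1, 2, 0, 7) (mob (gen_mat R) \<tau>)) = hm (mob (1, 0, 0, 7) \<tau>)"
    using hm_orbit_word[where w = "[R, W, T 2, W]" and k = "-21" and l = "1" and L = "(1, 2, 0, 7)" and N = "(1, 0, 0, 7)", OF assms pos] pos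
    by (simp add: mob_pos assms del: mob.simps)
  show "hm (mob (1, 3, 0, 7) (mob (gen_mat R) \<tau>)) = hm (mob (1, 3, 0, 7) \<tau>)"
    using hm_orbit_word[where w = "[X, R, X]" and k = "-3" and l = "1" and L = "(1, 3, 0, 7)" and N = "(1, 3, 0, 7)", OF assms pos] pos
    by (simp add: mob_pos assms del: mob.simps)
  show "hm (mob (1, 4, 0, 7) (mob (gen_mat R) \<tau>)) = hm (mob (1, 6, 0, 7) \<tau>)"
    using hm_orbit_word[where w = "[T 1, W, R', T 1, W, R', T 1, W, R', W, T (-1)]" and k = "1323" and l = "1" and L = "(1, 4, 0, 7)" and N = "(1, 6, 0, 7)", OF assms pos] pos
    by (simp add: mob_pos assms del: mob.simps)
  show "hm (mob (1, 5, 0, 7) (mob (gen_mat R) \<tau>)) = hm (mob (1, 2, 0, 7) \<tau>)"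
    using hm_orbit_word[where w = "[T 1, W, R', R', W, R']" and k = "-63" and l = "1" and L = "(1, 5, 0, 7)" and N = "(1, 2, 0, 7)", OF assms pos] pos
    by (simp add: mob_pos assms del: mob.simps)
  show "hm (mob (1, 6, 0, 7) (mob (gen_mat R) \<tau>)) = hm (mob (1, 5, 0, 7) \<tau>)"
    using hm_orbit_word[where w = "[T 1, W, X, R, R, W, T (-1)]" and k = "63" and l = "1" and L = "(1, 6, 0, 7)" and N = "(1, 5, 0, 7)", OF assms pos] pos
    by (simp add: mob_pos assms del: mob.simps)
  show "hm (mob (7, 0, 0, 1) (mob (gen_mat R) \<tau>)) = 7 / hm (mob (7, 6, 0, 7) \<tau>)"
    using hm_orbit_word[where w = "[T 2, W, T (-1)]" and k = "7" and l = "1" and L = "(7, 0, 0, 1)" and N = "(7, 6, 0, 7)", OF assms pos] pos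
    by (simp add: mob_pos assms del: mob.simps)
  show "hm (mob (7, 1, 0, 7) (mob (gen_mat R) \<tau>)) = hm (mob (7, 2, 0, 7) \<tau>)"
    using hm_orbit_word[where w = "[X]" and k = "1" and l = "1" and L = "(7, 1, 0, 7)" and N = "(7, 2, 0, 7)", OF assms pos] pos
    by (simp add: mob_pos assms del: mob.simps)
  show "hm (mob (7, 2, 0, 7) (mob (gen_mat R) \<tau>)) = hm (mob (7, 3, 0, 7) \<tau>)"
    using hm_orbit_word[where w = "[T 1, W, R', X, R, W, T (-1)]" and k = "-63" and l = "1" and L = "(7, 2, 0, 7)" and N = "(7, 3, 0, 7)", OF assms pos] pos
    by (simp add: mob_pos assms del: mob.simps)
  show "hm (mob (7, 3, 0, 7) (mob (gen_mat R) \<tau>)) = hm (mob (7, 5, 0, 7) \<tau>)"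
    using hm_orbit_word[where w = "[T 1, W, R', W, T (-1)]" and k = "21" and l = "1" and L = "(7, 3, 0, 7)" and N = "(7, 5, 0, 7)", OF assms pos] pos
    by (simp add: mob_pos assms del: mob.simps)
  show "hm (mob (7, 4, 0, 7) (mob (gen_mat R) \<tau>)) = hm (mob (7, 4, 0, 7) \<tau>)"
    using hm_orbit_word[where w = "[T 1, W, R, W, T (-1)]" and k = "-21" and l = "1" and L = "(7, 4, 0, 7)" and N = "(7, 4, 0, 7)", OF assms pos] pos
    by (simp add: mob_pos assms del: mob.simps)
  show "hm (mob (7, 5, 0, 7) (mob (gen_mat R) \<tau>)) = 7 / hm (mob (7, 0, 0, 1) \<tau>)"
    using hm_orbit_word[where w = "[T 1, W, T (-1)]" and k = "1" and l = "1" and L = "(7, 5, 0, 7)" and N = "(7, 0, 0, 1)", OF assms pos] pos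
    by (simp add: mob_pos assms del: mob.simps)
  show "hm (mob (7, 6, 0, 7) (mob (gen_mat R) \<tau>)) = hm (mob (7, 1, 0, 7) \<tau>)"
    using hm_orbit_word[where w = "[T 1, R']" and k = "-1" and l = "1" and L = "(7, 6, 0, 7)" and N = "(7, 1, 0, 7)", OF assms pos] pos
    by (simp add: mob_pos assms del: mob.simps)
qed

lemma hm_orbit_X:
  assumes "Im \<tau> > 0"
  shows
    "hm (mob (1, 0, 0, 7) (mob (gen_mat X) \<tau>)) = hm (mob (1, 5, 0, 7) \<tau>)"
    "hm (mob (1, 1, 0, 7) (mob (gen_mat X) \<tau>)) = hm (mob (1, 4, 0, 7) \<tau>)"
    "hm (mob (1, 2, 0, 7) (mob (gen_mat X) \<tau>)) = hm (mob (1, 3, 0, 7) \<tau>)"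
    "hm (mob (1, 3, 0, 7) (mob (gen_mat X) \<tau>)) = hm (mob (1, 2, 0, 7) \<tau>)"
    "hm (mob (1, 4, 0, 7) (mob (gen_mat X) \<tau>)) = hm (mob (1, 1, 0, 7) \<tau>)"
    "hm (mob (1, 5, 0, 7) (mob (gen_mat X) \<tau>)) = hm (mob (1, 0, 0, 7) \<tau>)"
    "hm (mob (1, 6, 0, 7) (mob (gen_mat X) \<tau>)) = hm (mob (1, 6, 0, 7) \<tau>)"
    "hm (mob (7, 0, 0, 1) (mob (gen_mat X) \<tau>)) = 7 / hm (mob (7, 4, 0, 7) \<tau>)"
    "hm (mob (7, 1, 0, 7) (mob (gen_mat X) \<tau>)) = hm (mob (7, 1, 0, 7) \<tau>)"
    "hm (mob (7, 2, 0, 7) (mob (gen_mat X) \<tau>)) = hm (mob (7, 3, 0, 7) \<tau>)"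
    "hm (mob (7, 3, 0, 7) (mob (gen_mat X) \<tau>)) = hm (mob (7, 2, 0, 7) \<tau>)"
    "hm (mob (7, 4, 0, 7) (mob (gen_mat X) \<tau>)) = 7 / hm (mob (7, 0, 0, 1) \<tau>)"
    "hm (mob (7, 5, 0, 7) (mob (gen_mat X) \<tau>)) = hm (mob (7, 6, 0, 7) \<tau>)"
    "hm (mob (7, 6, 0, 7) (mob (gen_mat X) \<tau>)) = hm (mob (7, 5, 0, 7) \<tau>)"
proof -
  note pos = mob_gen_pos[OF assms, of "X"]
  show "hm (mob (1, 0, 0, 7) (mob (gen_mat X) \<tau>)) = hm (mob (1, 5, 0, 7) \<tau>)"
    using hm_orbit_word[where w = "[W, T (-1), R, R, R, W, T (-1)]" and k = "63" and l = "1" and L = "(1, 0, 0, 7)" and N = "(1, 5, 0, 7)", OF assms pos] pos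
    by (simp add: mob_pos assms del: mob.simps)
  show "hm (mob (1, 1, 0, 7) (mob (gen_mat X) \<tau>)) = hm (mob (1, 4, 0, 7) \<tau>)"
    using hm_orbit_word[where w = "[R', R', W, T (-1), R, W, T (-1)]" and k = "63" and l = "1" and L = "(1, 1, 0, 7)" and N = "(1, 4, 0, 7)", OF assms pos] pos
    by (simp add: mob_pos assms del: mob.simps)
  show "hm (mob (1, 2, 0, 7) (mob (gen_mat X) \<tau>)) = hm (mob (1, 3, 0, 7) \<tau>)"
    using hm_orbit_word[where w = "[R, W, T (-1), W, R', X]" and k = "-63" and l = "1" and L = "(1, 2, 0, 7)" and N = "(1, 3, 0, 7)", OF assms pos] pos
    by (simp add: mob_pos assms del: mob.simps)
  show "hm (mob (1, 3, 0, 7) (mob (gen_mat X) \<tau>)) = hm (mob (1, 2, 0, 7) \<tau>)"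
    using hm_orbit_word[where w = "[X, R, W, T 1, W, R']" and k = "-63" and l = "1" and L = "(1, 3, 0, 7)" and N = "(1, 2, 0, 7)", OF assms pos] pos
    by (simp add: mob_pos assms del: mob.simps)
  show "hm (mob (1, 4, 0, 7) (mob (gen_mat X) \<tau>)) = hm (mob (1, 1, 0, 7) \<tau>)"
    using hm_orbit_word[where w = "[T 1, W, R', T 1, W, R, R]" and k = "-63" and l = "1" and L = "(1, 4, 0, 7)" and N = "(1, 1, 0, 7)", OF assms pos] pos
    by (simp add: mob_pos assms del: mob.simps)
  show "hm (mob (1, 5, 0, 7) (mob (gen_mat X) \<tau>)) = hm (mob (1, 0, 0, 7) \<tau>)"
    using hm_orbit_word[where w = "[T 1, W, R', R', R', T 1, W]" and k = "-63" and l = "1" and L = "(1, 5, 0, 7)" and N = "(1, 0, 0, 7)", OF assms pos] pos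
    by (simp add: mob_pos assms del: mob.simps)
  show "hm (mob (1, 6, 0, 7) (mob (gen_mat X) \<tau>)) = hm (mob (1, 6, 0, 7) \<tau>)"
    using hm_orbit_word[where w = "[T 1, W, T 1, W, R', X, R, W, T (-1), W, T (-1)]" and k = "1323" and l = "1" and L = "(1, 6, 0, 7)" and N = "(1, 6, 0, 7)", OF assms pos] pos
    by (simp add: mob_pos assms del: mob.simps)
  show "hm (mob (7, 0, 0, 1) (mob (gen_mat X) \<tau>)) = 7 / hm (mob (7, 4, 0, 7) \<tau>)"
    using hm_orbit_word[where w = "[T 3, W, T (-1)]" and k = "7" and l = "1" and L = "(7, 0, 0, 1)" and N = "(7, 4, 0, 7)", OF assms pos] pos
    by (simp add: mob_pos assms del: mob.simps)
  show "hm (mob (7, 1, 0, 7) (mob (gen_mat X) \<tau>)) = hm (mob (7, 1, 0, 7) \<tau>)"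
    using hm_orbit_word[where w = "[T 1, W, R', X, R, W, T (-1)]" and k = "-63" and l = "1" and L = "(7, 1, 0, 7)" and N = "(7, 1, 0, 7)", OF assms pos] pos
    by (simp add: mob_pos assms del: mob.simps)
  show "hm (mob (7, 2, 0, 7) (mob (gen_mat X) \<tau>)) = hm (mob (7, 3, 0, 7) \<tau>)"
    using hm_orbit_word[where w = "[T 1, W, R', W, T (-1)]" and k = "21" and l = "1" and L = "(7, 2, 0, 7)" and N = "(7, 3, 0, 7)", OF assms pos] pos
    by (simp add: mob_pos assms del: mob.simps)
  show "hm (mob (7, 3, 0, 7) (mob (gen_mat X) \<tau>)) = hm (mob (7, 2, 0, 7) \<tau>)"
    using hm_orbit_word[where w = "[T 1, W, R, W, T (-1)]" and k = "-21" and l = "1" and L = "(7, 3, 0, 7)" and N = "(7, 2, 0, 7)", OF assms pos] pos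
    by (simp add: mob_pos assms del: mob.simps)
  show "hm (mob (7, 4, 0, 7) (mob (gen_mat X) \<tau>)) = 7 / hm (mob (7, 0, 0, 1) \<tau>)"
    using hm_orbit_word[where w = "[T 1, W, T (-3)]" and k = "1" and l = "1" and L = "(7, 4, 0, 7)" and N = "(7, 0, 0, 1)", OF assms pos] pos
    by (simp add: mob_pos assms del: mob.simps)
  show "hm (mob (7, 5, 0, 7) (mob (gen_mat X) \<tau>)) = hm (mob (7, 6, 0, 7) \<tau>)"
    using hm_orbit_word[where w = "[T 1, R', T (-1)]" and k = "-1" and l = "1" and L = "(7, 5, 0, 7)" and N = "(7, 6, 0, 7)", OF assms pos] pos
    by (simp add: mob_pos assms del: mob.simps)
  show "hm (mob (7, 6, 0, 7) (mob (gen_mat X) \<tau>)) = hm (mob (7, 5, 0, 7) \<tau>)"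
    using hm_orbit_word[where w = "[T 1, R, T (-1)]" and k = "1" and l = "1" and L = "(7, 6, 0, 7)" and N = "(7, 5, 0, 7)", OF assms pos] pos
    by (simp add: mob_pos assms del: mob.simps)
qed

text \<open>Difference of the two sides of the modular equation, with \<open>a\<close> and \<open>b\<close> in place of \<open>1 / x\<close> and \<open>1 / y\<close>.\<close>

definition modeq_poly :: "complex \<Rightarrow> complex \<Rightarrow> complex \<Rightarrow> complex \<Rightarrow> complex" where
  "modeq_poly x y a b = y ^ 3 * a ^ 3 - (161 * y ^ 2 * a + 112 * y ^ 2 * a ^ 2
    + 196 * (x * y + 49 * (a * b))
    + 28 * (x ^ 2 * y ^ 2 + 7 ^ 4 * (a ^ 2 * b ^ 2))
    + 1372 + 980 * y * a + 1127 * y * a ^ 2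
    + (x ^ 4 * y ^ 2 + 7 ^ 6 * (a ^ 2 * b ^ 4))
    + 539 * (y + 7 * a) + 343 * (x + 7 * b)
    + 77 * (y ^ 2 * x + 7 ^ 3 * (a ^ 2 * b))
    + 49 * (y * x ^ 2 + 7 ^ 3 * (a * b ^ 2))
    + 7 * (y ^ 2 * x ^ 3 + 7 ^ 5 * (a ^ 2 * b ^ 3))
    + 49 * (x ^ 2 + 7 ^ 2 * b ^ 2)
    + 140 * (y ^ 2 + 7 ^ 2 * a ^ 2)
    + 7 * (x ^ 3 * y + 7 ^ 4 * (a * b ^ 3))
    + 343 * x * b)"

definition modeq :: "complex \<Rightarrow> complex \<Rightarrow> complex" where
  "modeq x y = modeq_poly x y (1 / x) (1 / y)"

text \<open>The map \<tau> -> -1 / (147 \<tau>) sends the pair of \<open>hm \<tau>\<close> and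
  \<open>hm (7 * \<tau>)\<close>, written (x, y), to (7 / y, 7 / x). The two summands in each
  bracket of the equation are exchanged by this.\<close>

lemma modeq_poly_symmetry: "modeq_poly (7 * b) (7 * a) (y / 7) (x / 7) = modeq_poly x y a b"
  unfolding modeq_poly_def by (simp add: power_mult_distrib power_divide)

lemma modeq_symmetry: "modeq (7 / y) (7 / x) = modeq x y"
  using modeq_poly_symmetry[of "1 / y" "1 / x" y x] by (simp add: modeq_def)

lemma modeq_symmetry': "modeq x (7 / y) = modeq y (7 / x)"
  using modeq_symmetry[of "7 / x" y] by simp

text \<open>The fourteen factors are the translates of \<open>modeq (hm \<tau>) (hm (7 \<tau>))\<close> under \<open>\<Gamma>\<^sub>0(21)+\<close>.\<close>

definition modeq_orbit :: "complex \<Rightarrow> complex" where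
  "modeq_orbit \<tau> =
    (modeq (hm (mob (1, 0, 0, 7) \<tau>)) (hm \<tau>) *
     modeq (hm (mob (1, 1, 0, 7) \<tau>)) (hm \<tau>) *
     modeq (hm (mob (1, 2, 0, 7) \<tau>)) (hm \<tau>) *
     modeq (hm (mob (1, 3, 0, 7) \<tau>)) (hm \<tau>) *
     modeq (hm (mob (1, 4, 0, 7) \<tau>)) (hm \<tau>) *
     modeq (hm (mob (1, 5, 0, 7) \<tau>)) (hm \<tau>) *
     modeq (hm (mob (1, 6, 0, 7) \<tau>)) (hm \<tau>)) *
    (modeq (hm \<tau>) (hm (mob (7, 0, 0, 1) \<tau>)) *
     modeq (hm \<tau>) (7 / hm (mob (7, 1, 0, 7) \<tau>)) *
     modeq (hm \<tau>) (7 / hm (mob (7, 2, 0, 7) \<tau>)) *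
     modeq (hm \<tau>) (7 / hm (mob (7, 3, 0, 7) \<tau>)) *
     modeq (hm \<tau>) (7 / hm (mob (7, 4, 0, 7) \<tau>)) *
     modeq (hm \<tau>) (7 / hm (mob (7, 5, 0, 7) \<tau>)) *
     modeq (hm \<tau>) (7 / hm (mob (7, 6, 0, 7) \<tau>)))"

text \<open>Every generator only permutes the factors. \<open>T 1\<close>, \<open>R\<close> and
  \<open>X\<close> preserve each group of seven; \<open>W\<close> exchanges the groups, and the
  factors match there after \<open>modeq_symmetry\<close>. The case \<open>R'\<close> is reduced to
  \<open>R\<close> because \<open>R\<close> after \<open>R'\<close> is the identity map.\<close>

lemma modeq_orbit_gen:
  assumes "Im \<tau> > 0"
  shows "modeq_orbit (mob (gen_mat g) \<tau>) = modeq_orbit \<tau>"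
proof -
  have hm_gen: "hm (mob (gen_mat g) \<tau>) = (if g = W then 7 / hm \<tau> else hm \<tau>)" if "Im \<tau> > 0" for g \<tau>
    using hm_word(2)[OF that, of "[g]"] by (cases g) simp_all
  have 1: "modeq_orbit (mob (gen_mat (T 1)) \<tau>) = modeq_orbit \<tau>" if "Im \<tau> > 0" for \<tau>
    unfolding modeq_orbit_def hm_orbit_T[OF that] hm_gen[OF that] by (simp only: gen.distinct if_False mult_ac)
  have T: "modeq_orbit (mob (gen_mat (T k)) \<tau>) = modeq_orbit \<tau>" if "Im \<tau> > 0" for k \<tau>
  proof -
    have 2: "modeq_orbit (\<tau> + 1) = modeq_orbit \<tau>" if "Im \<tau> > 0" for \<tau>
      using 1[OF that] by (simp add: moeb_def)
    have nat: "modeq_orbit (\<tau> + of_nat k) = modeq_orbit \<tau>" if "Im \<tau> > 0" for \<tau> k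
    proof (induction k)
      case (Suc k)
      have "modeq_orbit (\<tau> + of_nat (Suc k)) = modeq_orbit (\<tau> + of_nat k + 1)" by (simp add: algebra_simps)
      thus ?case using Suc 2[of "\<tau> + of_nat k"] that by simp
    qed auto
    have "modeq_orbit (\<tau> + of_int k) = modeq_orbit \<tau>"
    proof (cases "k \<ge> 0")
      case True
      thus ?thesis using nat[OF that, of "nat k"] by simp
    next
      case False
      thus ?thesis using nat[of "\<tau> + of_int k" "nat (- k)"] that by simp
    qed
    thus ?thesis by (simp add: moeb_def)
  qed
  have R: "modeq_orbit (mob (gen_mat R) \<tau>) = modeq_orbit \<tau>" if "Im \<tau> > 0" for \<tau>
    unfolding modeq_orbit_def hm_orbit_R[OF that] hm_gen[OF that] by (simp add: mult_ac)
  show ?thesis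
  proof (cases g)
    case (T k)
    thus ?thesis using \<open>\<And>\<tau> k. Im \<tau> > 0 \<Longrightarrow> modeq_orbit (mob (gen_mat (T k)) \<tau>) = modeq_orbit \<tau>\<close> assms by simp
  next
    case W
    show ?thesis
      unfolding W modeq_orbit_def hm_orbit_W[OF assms] hm_gen[OF assms]
      by (simp only: if_True refl modeq_symmetry modeq_symmetry'[of "hm (mob L \<tau>)" "hm \<tau>" for L])
         (simp only: mult_ac)
  next
    case R
    thus ?thesis using \<open>\<And>\<tau>. Im \<tau> > 0 \<Longrightarrow> modeq_orbit (mob (gen_mat R) \<tau>) = modeq_orbit \<tau>\<close> assms by simp
  next
    case R'
    have "mob (mat_mul (gen_mat R) (gen_mat R')) \<tau> = \<tau>" by (simp add: moeb_def)
    hence "mob (gen_mat R) (mob (gen_mat R') \<tau>) = \<tau>"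
      unfolding mob_mat_mul[OF assms mob_gen_pos[OF assms]] .
    thus ?thesis
      using \<open>\<And>\<tau>. Im \<tau> > 0 \<Longrightarrow> modeq_orbit (mob (gen_mat R) \<tau>) = modeq_orbit \<tau>\<close>[OF mob_gen_pos[OF assms, of R']] R' by simp
  next
    case X
    show ?thesis
      unfolding X modeq_orbit_def hm_orbit_X[OF assms] hm_gen[OF assms] by (simp add: mult_ac)
  qed
qed

lemma modeq_orbit_word:
  assumes "Im \<tau> > 0"
  shows "modeq_orbit (mob (word_mat w) \<tau>) = modeq_orbit \<tau>"
proof (induction w)
  case Nil
  thus ?case by (simp add: moeb_def)
next
  case (Cons g w)
  have "mob (word_mat (g # w)) \<tau> = mob (gen_mat g) (mob (word_mat w) \<tau>)"
    using mob_mat_mul[OF assms hm_word(1)[OF assms, of w]] by simp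
  thus ?case using modeq_orbit_gen[OF hm_word(1)[OF assms, of w]] Cons by simp
qed

section \<open>Moving points up, away from the real axis\<close>

lemma Im_mob:
  "Im (mob (a, b, c, d) \<tau>) = of_int (a * d - b * c) * Im \<tau> / ((of_int c * Re \<tau> + of_int d)\<^sup>2 + (of_int c * Im \<tau>)\<^sup>2)"
  by (simp add: moeb_def Im_divide algebra_simps)

text \<open>Inside the isometric circle the height grows. A fixed factor above 1, rather than mere
  growth, is what makes the iteration in \<open>reduction\<close> stop.\<close>

lemma Im_mob_ge:
  assumes "(of_int c * Re \<tau> + of_int d)\<^sup>2 + (of_int c * Im \<tau>)\<^sup>2 \<le> of_int (a * d - b * c) / (101/100)"
    and "Im \<tau> > 0" "c \<noteq> 0"
  shows "Im (mob (a, b, c, d) \<tau>) \<ge> 101/100 * Im \<tau>"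
proof -
  let ?N = "(of_int c * Re \<tau> + of_int d)\<^sup>2 + (of_int c * Im \<tau>)\<^sup>2"
  have N: "?N > 0" using assms(2,3) by (intro add_nonneg_pos) auto
  have "101/100 * Im \<tau> * ?N = Im \<tau> * (101/100 * ?N)" by simp
  also have "\<dots> \<le> Im \<tau> * of_int (a * d - b * c)"
    using assms by (intro mult_left_mono) (auto simp: field_simps)
  finally show ?thesis unfolding Im_mob using N by (simp add: pos_le_divide_eq mult_ac)
qed

text \<open>Near the real axis, every point of the strip lies in the isometric circle of one of five elements,
  with centres \<open>0\<close>, \<open>\<plusminus>1/3\<close> and \<open>\<plusminus>3/7\<close>.\<close>

lemma raise_Im:
  assumes \<tau>: "0 < Im \<tau>" "Im \<tau> < 1/50"
  shows "\<exists>w. Im (mob (word_mat w) \<tau>) \<ge> 101/100 * Im \<tau>"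
proof -
  define k where "k = - round (Re \<tau>)"
  define \<sigma> where "\<sigma> = mob (word_mat [T k]) \<tau>"
  define x where "x = Re \<sigma>"
  define y where "y = Im \<sigma>"
  have "\<bar>x\<bar> \<le> 1/2"
    using of_int_round_abs_le[of "Re \<tau>"] unfolding x_def \<sigma>_def k_def by (simp add: moeb_def abs_minus_commute)
  have y: "y = Im \<tau>" by (simp add: y_def \<sigma>_def moeb_def)
  have ypos: "0 < Im \<sigma>" using y \<tau> by (simp add: y_def)
  have y2: "y\<^sup>2 \<le> 1 / 2500"
    using power_mono[of y "1/50" 2] y \<tau> by (simp add: power2_eq_square)
  have sq: "(x - c)\<^sup>2 \<le> r\<^sup>2" if "\<bar>x - c\<bar> \<le> r" for c r
    using power_mono[OF that, of 2] by simp
  have key: ?thesis if "word_mat w = (a, b, c, d)" "c \<noteq> 0"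
      "(of_int c * x + of_int d)\<^sup>2 + (of_int c * y)\<^sup>2 \<le> of_int (a * d - b * c) / (101/100)" for w a b c d
  proof -
    have "Im (mob (word_mat w) \<sigma>) \<ge> 101/100 * Im \<sigma>"
      unfolding that(1) by (rule Im_mob_ge) (use that ypos in \<open>auto simp: x_def y_def\<close>)
    moreover have "mob (word_mat w) \<sigma> = mob (word_mat (w @ [T k])) \<tau>"
    proof (induction w)
      case (Cons g w)
      have "mob (word_mat (g # w)) \<sigma> = mob (gen_mat g) (mob (word_mat w) \<sigma>)"
        using mob_mat_mul[OF ypos hm_word(1)[OF ypos, of w]] by simp
      also have "\<dots> = mob (word_mat (g # w @ [T k])) \<tau>"
        unfolding Cons using mob_mat_mul[OF \<tau>(1) hm_word(1)[OF \<tau>(1), of "w @ [T k]"]] by simp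
      finally show ?case by simp
    qed (simp add: \<sigma>_def moeb_def)
    ultimately show ?thesis using y by (auto simp: y_def)
  qed
  \<comment> \<open>The isometric circles have radii 1 / sqrt 21, 1 / sqrt 63 and sqrt 3 / 21, about
    0.218, 0.126 and 0.082. The intervals are slightly shorter, leaving room for the height 1/50 and
    the factor 101/100, and still cover: 0.215 > 1/3 - 0.1185, 1/3 + 0.1185 > 3/7 - 0.075 and 3/7 +
    0.075 > 1/2.\<close>
  consider "\<bar>x - 0\<bar> \<le> 215/1000" | "\<bar>x - 1/3\<bar> \<le> 1185/10000" | "\<bar>x - (-1/3)\<bar> \<le> 1185/10000"
    | "\<bar>x - 3/7\<bar> \<le> 75/1000" | "\<bar>x - (-3/7)\<bar> \<le> 75/1000"
    using \<open>\<bar>x\<bar> \<le> 1/2\<close> by linarith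
  thus ?thesis
  proof cases
    case 1
    show ?thesis
      by (rule key[of "[W]"]) (use sq[OF 1] y2 in \<open>auto simp: power2_eq_square algebra_simps\<close>)
  next
    case 2
    show ?thesis
      by (rule key[of "[W, R']"]) (use sq[OF 2] y2 in \<open>auto simp: power2_eq_square algebra_simps\<close>)
  next
    case 3
    show ?thesis
      by (rule key[of "[R, W]"]) (use sq[OF 3] y2 in \<open>auto simp: power2_eq_square algebra_simps\<close>)
  next
    case 4
    show ?thesis
      by (rule key[of "[X]"]) (use sq[OF 4] y2 in \<open>auto simp: power2_eq_square algebra_simps\<close>)
  next
    case 5
    show ?thesis
      by (rule key[of "[W, R', X, R, W]"]) (use sq[OF 5] y2 in \<open>auto simp: power2_eq_square algebra_simps\<close>)
  qed
qed

text \<open>The height grows geometrically under \<open>raise_Im\<close>, so 1/50 is reached in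
  finitely many steps; a final translation bounds the real part. The region reached need not be a
  fundamental domain, only bounded below and in width.\<close>

lemma reduction:
  assumes "Im \<tau> > 0"
  shows "\<exists>\<tau>'. Im \<tau>' \<ge> 1/50 \<and> 0 \<le> Re \<tau>' \<and> Re \<tau>' \<le> 1 \<and> modeq_orbit \<tau>' = modeq_orbit \<tau>"
proof -
  have *: "\<exists>\<tau>'. Im \<tau>' \<ge> 1/50 \<and> modeq_orbit \<tau>' = modeq_orbit \<tau>"
    if "Im \<tau> > 0" "(101/100) ^ n * Im \<tau> \<ge> 1/50" for n
    using that
  proof (induction n arbitrary: \<tau>)
    case (Suc n)
    show ?case
    proof (cases "Im \<tau> \<ge> 1/50")
      case False
      then obtain w where w: "Im (mob (word_mat w) \<tau>) \<ge> 101/100 * Im \<tau>"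
        using raise_Im Suc.prems by (metis not_le)
      have "1/50 \<le> (101/100) ^ n * (101/100 * Im \<tau>)" using Suc.prems by (simp add: mult_ac)
      also have "\<dots> \<le> (101/100) ^ n * Im (mob (word_mat w) \<tau>)" using w by (intro mult_left_mono) auto
      finally show ?thesis
        using Suc.IH[OF hm_word(1)[OF Suc.prems(1), of w]] modeq_orbit_word[OF Suc.prems(1), of w] by auto
    qed auto
  qed auto
  obtain n where "1 / 50 / Im \<tau> < (101/100) ^ n"
    using real_arch_pow[of "101/100" "1 / 50 / Im \<tau>"] by auto
  hence "(101/100) ^ n * Im \<tau> \<ge> 1/50" using assms by (simp add: field_simps)
  from *[OF assms this] obtain \<sigma> where s: "Im \<sigma> \<ge> 1/50" "modeq_orbit \<sigma> = modeq_orbit \<tau>" by blast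
  define k where "k = - \<lfloor>Re \<sigma>\<rfloor>"
  have "modeq_orbit (mob (gen_mat (T k)) \<sigma>) = modeq_orbit \<tau>"
    using modeq_orbit_gen[of \<sigma> "T k"] s by simp
  moreover have "Im (mob (gen_mat (T k)) \<sigma>) = Im \<sigma>" "Re (mob (gen_mat (T k)) \<sigma>) = Re \<sigma> - of_int \<lfloor>Re \<sigma>\<rfloor>"
    by (simp_all add: moeb_def k_def)
  moreover have "0 \<le> Re \<sigma> - of_int \<lfloor>Re \<sigma>\<rfloor>" "Re \<sigma> - of_int \<lfloor>Re \<sigma>\<rfloor> \<le> 1" by linarith+
  ultimately show ?thesis using s by metis
qed

section \<open>Expansions at the cusp\<close>

text \<open>An entry \<open>(c, i, j, k, l)\<close> stands for the monomial \<open>c x\<^sup>i y\<^sup>j a\<^sup>k b\<^sup>l\<close>.\<close>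

definition modeq_terms :: "(int \<times> nat \<times> nat \<times> nat \<times> nat) list" where
  "modeq_terms =
  [(1, 0, 3, 3, 0), (-161, 0, 2, 1, 0), (-112, 0, 2, 2, 0), (-196, 1, 1, 0, 0), (-9604, 0, 0, 1, 1),
   (-28, 2, 2, 0, 0), (-67228, 0, 0, 2, 2), (-1372, 0, 0, 0, 0), (-980, 0, 1, 1, 0), (-1127, 0, 1, 2, 0),
   (-1, 4, 2, 0, 0), (-117649, 0, 0, 2, 4), (-539, 0, 1, 0, 0), (-3773, 0, 0, 1, 0), (-343, 1, 0, 0, 0),
   (-2401, 0, 0, 0, 1), (-77, 1, 2, 0, 0), (-26411, 0, 0, 2, 1), (-49, 2, 1, 0, 0), (-16807, 0, 0, 1, 2),
   (-7, 3, 2, 0, 0), (-117649, 0, 0, 2, 3), (-49, 2, 0, 0, 0), (-2401, 0, 0, 0, 2), (-140, 0, 2, 0, 0),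
   (-6860, 0, 0, 2, 0), (-7, 3, 1, 0, 0), (-16807, 0, 0, 1, 3), (-343, 1, 0, 0, 1)]"

lemma modeq_poly_terms:
  "modeq_poly x y a b = (\<Sum>(c, i, j, k, l)\<leftarrow>modeq_terms. of_int c * x ^ i * y ^ j * a ^ k * b ^ l)"
  unfolding modeq_poly_def modeq_terms_def by simp

section \<open>Truncated power series as integer lists\<close>

fun ev :: "int list \<Rightarrow> complex \<Rightarrow> complex" where
  "ev [] q = 0"
| "ev (a # as) q = of_int a + q * ev as q"

fun list_add :: "int list \<Rightarrow> int list \<Rightarrow> int list" where
  "list_add [] ys = ys"
| "list_add xs [] = xs"
| "list_add (x # xs) (y # ys) = (x + y) # list_add xs ys"

text \<open>The shortcut for zero entries serves evaluation: series in a power of q consist mostly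
  of zeros.\<close>

fun list_mul :: "int list \<Rightarrow> int list \<Rightarrow> int list" where
  "list_mul [] ys = []"
| "list_mul (x # xs) ys = (if x = 0 then 0 # list_mul xs ys else list_add (map ((*) x) ys) (0 # list_mul xs ys))"

fun list_mul_trunc :: "nat \<Rightarrow> int list \<Rightarrow> int list \<Rightarrow> int list" where
  "list_mul_trunc n xs ys = take n (list_mul (take n xs) (take n ys))"

fun list_pow :: "nat \<Rightarrow> int list \<Rightarrow> nat \<Rightarrow> int list" where
  "list_pow n xs 0 = [1]"
| "list_pow n xs (Suc k) = list_mul_trunc n xs (list_pow n xs k)"

text \<open>The substitution of q^k for q on coefficient lists.\<close>

fun spread :: "nat \<Rightarrow> int list \<Rightarrow> int list" where
  "spread k [] = []"
| "spread k (x # xs) = x # replicate (k - 1) 0 @ spread k xs"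

lemma ev_add: "ev (list_add xs ys) q = ev xs q + ev ys q"
  by (induction xs ys rule: list_add.induct) (auto simp: algebra_simps)

lemma ev_scale: "ev (map ((*) c) xs) q = of_int c * ev xs q"
  by (induction xs) (auto simp: algebra_simps)

lemma ev_mul: "ev (list_mul xs ys) q = ev xs q * ev ys q"
  by (induction xs) (auto simp: ev_add ev_scale algebra_simps)

lemma ev_shift: "ev (replicate k 0 @ xs) q = q ^ k * ev xs q"
  by (induction k) (auto simp: algebra_simps)

lemma ev_spread: "k > 0 \<Longrightarrow> ev (spread k xs) q = ev xs (q ^ k)"
proof (induction xs)
  case (Cons x xs)
  hence "q * q ^ (k - 1) = q ^ k" by (metis Suc_diff_1 power_Suc)
  thus ?case using Cons by (auto simp: ev_shift mult.assoc[symmetric])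
qed auto

lemma ev_take_drop: "ev xs q = ev (take n xs) q + q ^ n * ev (drop n xs) q"
proof (induction n arbitrary: xs)
  case (Suc n)
  show ?case
  proof (cases xs)
    case (Cons x xs')
    show ?thesis unfolding Cons using Suc[of xs'] by (simp add: algebra_simps)
  qed auto
qed auto

lemma ev_bigo: "ev xs \<in> O[at 0](\<lambda>_. 1)"
proof -
  have "continuous_on UNIV (ev xs)"
    by (induction xs) (auto intro!: continuous_intros simp: fun_eq_iff cong: continuous_on_cong)
  hence "(ev xs \<longlongrightarrow> ev xs 0) (at 0)"
    by (simp add: continuous_on_def)
  thus ?thesis by (intro bigoI_tendsto) auto
qed

text \<open>Equality of f with a power series modulo \<open>q ^ n\<close>. The filter is punctured,
  so values at q = 0, where the quotients carry no information, are irrelevant; entries from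
  position n on may be changed freely.\<close>

definition agree :: "nat \<Rightarrow> (complex \<Rightarrow> complex) \<Rightarrow> int list \<Rightarrow> bool" where
  "agree n f xs \<longleftrightarrow> (\<lambda>q. f q - ev xs q) \<in> O[at 0](\<lambda>q. q ^ n)"

lemma bigo_power_mono:
  assumes "m \<le> n"
  shows "(\<lambda>q::complex. q ^ n) \<in> O[at 0](\<lambda>q. q ^ m)"
proof -
  have "((\<lambda>q::complex. q ^ (n - m)) \<longlongrightarrow> 0 ^ (n - m)) (at 0)" by (intro tendsto_intros)
  hence "(\<lambda>q::complex. q ^ (n - m)) \<in> O[at 0](\<lambda>_. 1)" by (intro bigoI_tendsto) auto
  hence "(\<lambda>q::complex. q ^ m * q ^ (n - m)) \<in> O[at 0](\<lambda>q. q ^ m * 1)" by (intro landau_o.big.mult) auto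
  thus ?thesis using assms by (simp flip: power_add)
qed

lemma agree_mono: "agree n f xs \<Longrightarrow> m \<le> n \<Longrightarrow> agree m f xs"
  unfolding agree_def using bigo_power_mono landau_o.big_trans by blast

lemma agree_bigo: "agree n f xs \<Longrightarrow> f \<in> O[at 0](\<lambda>_. 1)"
proof -
  assume "agree n f xs"
  hence "agree 0 f xs" by (rule agree_mono) simp
  hence "(\<lambda>q. f q - ev xs q) \<in> O[at 0](\<lambda>_. 1)" by (simp add: agree_def)
  from sum_in_bigo(1)[OF this ev_bigo[of xs]] show ?thesis by simp
qed

lemma agree_ev: "agree n (ev xs) xs"
  by (simp add: agree_def)

lemma agree_cong_list:
  assumes "agree n f xs" "\<And>q. ev xs q = ev ys q + q ^ n * ev zs q"
  shows "agree n f ys"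
proof -
  have "(\<lambda>q. q ^ n * ev zs q) \<in> O[at 0](\<lambda>q. q ^ n * 1)"
    by (intro landau_o.big.mult ev_bigo) auto
  hence "(\<lambda>q. q ^ n * ev zs q) \<in> O[at 0](\<lambda>q. q ^ n)" by simp
  with assms(1) have "(\<lambda>q. (f q - ev xs q) + q ^ n * ev zs q) \<in> O[at 0](\<lambda>q. q ^ n)"
    unfolding agree_def by (rule sum_in_bigo(1))
  thus ?thesis unfolding agree_def assms(2) by simp
qed

lemma agree_take: "agree n f xs \<Longrightarrow> agree n f (take n xs)"
  by (erule agree_cong_list) (rule ev_take_drop)

lemma agree_mult:
  assumes f: "agree n f xs" and g: "agree n g ys"
  shows "agree n (\<lambda>q. f q * g q) (list_mul_trunc n xs ys)"
proof -
  note f = agree_take[OF f] and g = agree_take[OF g]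
  let ?x = "ev (take n xs)" and ?y = "ev (take n ys)"
  have "(\<lambda>q. (f q - ?x q) * g q) \<in> O[at 0](\<lambda>q. q ^ n * 1)"
    using f agree_bigo[OF g] unfolding agree_def by (rule landau_o.big.mult)
  moreover have "(\<lambda>q. ?x q * (g q - ?y q)) \<in> O[at 0](\<lambda>q. 1 * q ^ n)"
    using ev_bigo g unfolding agree_def by (rule landau_o.big.mult)
  ultimately have "(\<lambda>q. (f q - ?x q) * g q + ?x q * (g q - ?y q)) \<in> O[at 0](\<lambda>q. q ^ n)"
    by (intro sum_in_bigo) auto
  hence "agree n (\<lambda>q. f q * g q) (list_mul (take n xs) (take n ys))"
    by (simp add: agree_def ev_mul algebra_simps)
  thus ?thesis by (simp add: agree_take)
qed

lemma agree_power: "agree n f xs \<Longrightarrow> agree n (\<lambda>q. f q ^ k) (list_pow n xs k)"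
proof (induction k)
  case 0
  show ?case by (simp add: agree_def)
next
  case (Suc k)
  thus ?case unfolding power_Suc list_pow.simps by (intro agree_mult)
qed

lemma agree_scale: "agree n f xs \<Longrightarrow> agree n (\<lambda>q. of_int c * f q) (map ((*) c) xs)"
  unfolding agree_def ev_scale right_diff_distrib[symmetric]
  using landau_o.big.mult[of "\<lambda>_. of_int c" "at 0" "\<lambda>_. 1"] by fastforce

lemma agree_add: "agree n f xs \<Longrightarrow> agree n g ys \<Longrightarrow> agree n (\<lambda>q. f q + g q) (list_add xs ys)"
  unfolding agree_def ev_add by (drule (1) sum_in_bigo(1)) (simp add: algebra_simps)

lemma agree_shift:
  assumes "agree m f xs" "m + k \<ge> n"
  shows "agree n (\<lambda>q. q ^ k * f q) (replicate k 0 @ xs)"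
proof -
  have "(\<lambda>q. q ^ k * (f q - ev xs q)) \<in> O[at 0](\<lambda>q. q ^ k * q ^ m)"
    using assms(1) unfolding agree_def by (intro landau_o.big.mult) auto
  hence "agree (k + m) (\<lambda>q. q ^ k * f q) (replicate k 0 @ xs)"
    by (simp add: agree_def ev_shift power_add algebra_simps)
  thus ?thesis by (rule agree_mono) (use assms in simp)
qed

lemma agree_compose_power:
  assumes "agree n f xs" "k > 0"
  shows "agree n (\<lambda>q. f (q ^ k)) (spread k xs)"
proof -
  have "filterlim (\<lambda>q::complex. q ^ k) (at 0) (at 0)"
    using assms(2) by (auto simp: filterlim_at eventually_at_filter intro!: tendsto_eq_intros)
  hence "(\<lambda>q. f (q ^ k) - ev xs (q ^ k)) \<in> O[at 0](\<lambda>q. (q ^ k) ^ n)"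
    using assms(1) unfolding agree_def by (rule landau_o.big.compose[rotated])
  hence "agree (k * n) (\<lambda>q. f (q ^ k)) (spread k xs)"
    using assms(2) by (simp add: agree_def ev_spread power_mult)
  thus ?thesis by (rule agree_mono) (use assms in simp)
qed

lemma bigo_id_tendsto_0:
  fixes f :: "complex \<Rightarrow> complex"
  assumes "f \<in> O[at 0](\<lambda>q. q)"
  shows "(f \<longlongrightarrow> 0) (at 0)"
proof -
  obtain c where c: "eventually (\<lambda>q. norm (f q) \<le> c * norm q) (at 0)"
    using landau_o.bigE[OF assms] by blast
  have "((\<lambda>q::complex. c * norm q) \<longlongrightarrow> c * norm (0::complex)) (at 0)"
    by (intro tendsto_intros)
  with Lim_null_comparison[OF c] show ?thesis by simp
qed

lemma agree_tendsto:
  assumes "agree (Suc n) f (x # xs)"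
  shows "(f \<longlongrightarrow> of_int x) (at 0)"
proof -
  have "agree 1 f (x # xs)" using assms by (rule agree_mono) simp
  hence "agree 1 f [x]" using agree_take[of 1 f "x # xs"] by simp
  hence "(\<lambda>q. f q - of_int x) \<in> O[at 0](\<lambda>q. q)" by (simp add: agree_def)
  hence "((\<lambda>q. f q - of_int x) \<longlongrightarrow> 0) (at 0)" by (rule bigo_id_tendsto_0)
  thus ?thesis by (simp add: LIM_zero_iff)
qed

text \<open>The reciprocal list is guessed and checked by one multiplication. The leading
  coefficient 1 keeps f away from 0 near the puncture, so the error in f times \<open>ev ys\<close>
  - 1 may be divided by f.\<close>

lemma agree_inverse:
  assumes f: "agree (Suc n) f (1 # xs)" and eq: "list_mul_trunc (Suc n) (1 # xs) ys = 1 # replicate n 0"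
  shows "agree (Suc n) (\<lambda>q. 1 / f q) ys"
proof -
  have lim: "(f \<longlongrightarrow> 1) (at 0)" using agree_tendsto[OF f] by simp
  hence nz: "eventually (\<lambda>q. f q \<noteq> 0) (at 0)" by (rule tendsto_imp_eventually_ne) simp
  have "((\<lambda>q. 1 / f q) \<longlongrightarrow> 1 / 1) (at 0)" by (intro tendsto_intros lim) simp
  hence inv: "(\<lambda>q. 1 / f q) \<in> O[at 0](\<lambda>_. 1)" by (intro bigoI_tendsto) auto
  have "ev (replicate n 0) q = 0" for q using ev_shift[of n "[]" q] by simp
  hence "(\<lambda>q. f q * ev ys q - 1) \<in> O[at 0](\<lambda>q. q ^ Suc n)"
    using agree_mult[OF f agree_ev[of _ ys]] unfolding eq by (simp add: agree_def)
  hence "(\<lambda>q. (f q * ev ys q - 1) * (1 / f q)) \<in> O[at 0](\<lambda>q. q ^ Suc n * 1)"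
    using inv by (rule landau_o.big.mult)
  hence "(\<lambda>q. - ((f q * ev ys q - 1) * (1 / f q))) \<in> O[at 0](\<lambda>q. q ^ Suc n)"
    by simp
  moreover have "eventually (\<lambda>q. - ((f q * ev ys q - 1) * (1 / f q)) = 1 / f q - ev ys q) (at 0)"
    using nz by eventually_elim (simp add: field_simps)
  ultimately show ?thesis
    unfolding agree_def by (subst (asm) landau_o.big.in_cong)
qed

section \<open>The expansion of the eta quotient at infinity\<close>

lemma agree_f_neg: "agree 19 f_neg [1, -1, -1, 0, 0, 1, 0, 1, 0, 0, 0, 0, -1, 0, 0, -1]"
proof -
  have eq: "ev [1, -1, -1, 0, 0, 1, 0, 1, 0, 0, 0, 0, -1, 0, 0, -1] q = 1 - q - q^2 + q^5 + q^7 - q^12 - q^15" for q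
    by (simp add: algebra_simps eval_nat_numeral)
  have "agree 22 f_neg [1, -1, -1, 0, 0, 1, 0, 1, 0, 0, 0, 0, -1, 0, 0, -1]"
    unfolding agree_def eq by (rule f_neg_bigo)
  thus ?thesis by (rule agree_mono) simp
qed

text \<open>The eta quotient with its simple pole at q = 0 removed: \<open>hm \<tau>\<close> is
  \<open>ueta q / q\<close>.\<close>

definition ueta :: "complex \<Rightarrow> complex" where
  "ueta q = f_neg (q ^ 1) * f_neg (q ^ 3) * (1 / (f_neg (q ^ 7) * f_neg (q ^ 21)))"

abbreviation "ueta_list \<equiv> [1, -1, -1, -1, 1, 2, -1, 3, -1, -1, -2, 0, 1, -2, 4, -1, -3, -4, 3] :: int list"
abbreviation "ueta_inv_list \<equiv> [1, 1, 2, 4, 6, 9, 16, 21, 32, 48, 66, 92, 134, 177, 243, 334, 441, 585, 788] :: int list"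
abbreviation "ueta7_list \<equiv> [1, 0, 0, 0, 0, 0, 0, -1, 0, 0, 0, 0, 0, 0, -1] :: int list"
abbreviation "ueta7_inv_list \<equiv> [1, 0, 0, 0, 0, 0, 0, 1, 0, 0, 0, 0, 0, 0, 2] :: int list"

lemma agree_ueta: "agree 19 ueta ueta_list"
proof -
  let ?f = "[1, -1, -1, 0, 0, 1, 0, 1, 0, 0, 0, 0, -1, 0, 0, -1] :: int list"
  have a: "agree 19 (\<lambda>q. f_neg (q ^ k)) (spread k ?f)" if "k > 0" for k
    using agree_f_neg that by (rule agree_compose_power)
  have d: "agree 19 (\<lambda>q. f_neg (q ^ 7) * f_neg (q ^ 21)) (list_mul_trunc 19 (spread 7 ?f) (spread 21 ?f))"
    by (intro agree_mult a) auto
  have "list_mul_trunc 19 (spread 7 ?f) (spread 21 ?f) = 1 # [0, 0, 0, 0, 0, 0, -1, 0, 0, 0, 0, 0, 0, -1, 0, 0, 0, 0]"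
    by code_simp
  \<comment> \<open>Below \<open>q ^ 19\<close> the factor \<open>f_neg (q ^ 21)\<close> is 1, so
    the reciprocal is the partition series 1 + q^7 + 2 q^14.\<close>
  moreover have "list_mul_trunc (Suc 18) (1 # [0, 0, 0, 0, 0, 0, -1, 0, 0, 0, 0, 0, 0, -1, 0, 0, 0, 0])
      [1, 0, 0, 0, 0, 0, 0, 1, 0, 0, 0, 0, 0, 0, 2, 0, 0, 0, 0] = 1 # replicate 18 0"
    by code_simp
  ultimately have i: "agree 19 (\<lambda>q. 1 / (f_neg (q ^ 7) * f_neg (q ^ 21))) [1, 0, 0, 0, 0, 0, 0, 1, 0, 0, 0, 0, 0, 0, 2, 0, 0, 0, 0]"
    using d agree_inverse[of 18] by simp
  have "agree 19 ueta (list_mul_trunc 19 (list_mul_trunc 19 (spread 1 ?f) (spread 3 ?f))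
     [1, 0, 0, 0, 0, 0, 0, 1, 0, 0, 0, 0, 0, 0, 2, 0, 0, 0, 0])"
    unfolding ueta_def by (intro agree_mult a i) auto
  also have "list_mul_trunc 19 (list_mul_trunc 19 (spread 1 ?f) (spread 3 ?f))
     [1, 0, 0, 0, 0, 0, 0, 1, 0, 0, 0, 0, 0, 0, 2, 0, 0, 0, 0] = ueta_list"
    by code_simp
  finally show ?thesis .
qed

lemma agree_ueta_inv: "agree 19 (\<lambda>q. 1 / ueta q) ueta_inv_list"
proof -
  have "list_mul_trunc (Suc 18) ueta_list ueta_inv_list = 1 # replicate 18 0"
    by code_simp
  thus ?thesis using agree_ueta agree_inverse[of 18 ueta] by simp
qed

lemma agree_ueta7: "agree 19 (\<lambda>q. ueta (q ^ 7)) ueta7_list"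
proof -
  have "agree 19 (\<lambda>q. ueta (q ^ 7)) (take 19 (spread 7 ueta_list))"
    by (intro agree_take agree_compose_power agree_ueta) simp
  \<comment> \<open>\<open>ueta7_list\<close> is stored without trailing zeros; adding 19 zeros pads
    it to the length of the truncated list.\<close>
  also have "take 19 (spread 7 ueta_list) = list_add ueta7_list (replicate 19 0)"
    by code_simp
  finally show ?thesis
    by (rule agree_cong_list[where zs = "[]"]) (simp add: ev_add ev_shift[of 19 "[]", simplified] del: list_add.simps)
qed

lemma agree_ueta7_inv: "agree 19 (\<lambda>q. 1 / ueta (q ^ 7)) ueta7_inv_list"
proof -
  have "agree 19 (\<lambda>q. 1 / ueta (q ^ 7)) (take 19 (spread 7 ueta_inv_list))"
    by (intro agree_take agree_compose_power[where f = "\<lambda>q. 1 / ueta q"] agree_ueta_inv) simp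
  also have "take 19 (spread 7 ueta_inv_list) = list_add ueta7_inv_list (replicate 19 0)"
    by code_simp
  finally show ?thesis
    by (rule agree_cong_list[where zs = "[]"]) (simp add: ev_add ev_shift[of 19 "[]", simplified] del: list_add.simps)
qed

text \<open>Expansion of \<open>q\<^sup>1\<^sup>8\<close> times a monomial of the modular equation at \<open>x = ueta q / q\<close>, \<open>y = ueta (q\<^sup>7) / q\<^sup>7\<close>.\<close>

fun term_expansion :: "int \<times> nat \<times> nat \<times> nat \<times> nat \<Rightarrow> int list" where
  "term_expansion (c, i, j, k, l) =
    (let e = 18 + k + 7 * l - (i + 7 * j); n = 19 - e in
      if n = 0 then [] else
      replicate e 0 @ map ((*) c) (list_mul_trunc n (list_mul_trunc n (list_pow n ueta7_list j) (list_pow n ueta7_inv_list l))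
         (list_mul_trunc n (list_pow n ueta_list i) (list_pow n ueta_inv_list k))))"

text \<open>Here the coefficients of the modular equation are tested at infinity: the polar part and
  the constant term cancel over all 29 monomials. The monomials of highest pole order, y^3 / x^3 and
  x^4 y^2, already cancel in the leading coefficient.\<close>

lemma modeq_expansion: "take 19 (foldr list_add (map term_expansion modeq_terms) []) = replicate 19 0"
  by code_simp


text \<open>A term starting at \<open>q ^ e\<close> needs its factors only modulo
  \<open>q ^ (19 - e)\<close>, and is invisible if e \<ge> 19. This keeps the evaluation
  small.\<close>

lemma agree_term_expansion:
  "agree 19 (\<lambda>q. q ^ (18 + k + 7 * l - (i + 7 * j)) * (of_int c *
      ((ueta (q ^ 7) ^ j * (1 / ueta (q ^ 7)) ^ l) * (ueta q ^ i * (1 / ueta q) ^ k))))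
    (term_expansion (c, i, j, k, l))"
proof -
  define e where "e = 18 + k + 7 * l - (i + 7 * j)"
  define n where "n = 19 - e"
  define f where "f q = of_int c *
      ((ueta (q ^ 7) ^ j * (1 / ueta (q ^ 7)) ^ l) * (ueta q ^ i * (1 / ueta q) ^ k))" for q
  define xs where "xs = map ((*) c) (list_mul_trunc n (list_mul_trunc n (list_pow n ueta7_list j) (list_pow n ueta7_inv_list l))
         (list_mul_trunc n (list_pow n ueta_list i) (list_pow n ueta_inv_list k)))"
  have n: "n \<le> 19" by (simp add: n_def)
  have f: "agree n f xs"
    unfolding f_def xs_def
    by (intro agree_scale agree_mult agree_power agree_mono[OF agree_ueta n] agree_mono[OF agree_ueta_inv n]
      agree_mono[OF agree_ueta7 n] agree_mono[OF agree_ueta7_inv n])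
  have 1: "agree 19 (\<lambda>q. q ^ e * f q) (replicate e 0 @ xs)"
    by (rule agree_shift[OF f]) (simp add: n_def)
  have "agree 19 (\<lambda>q. q ^ e * f q) (if n = 0 then [] else replicate e 0 @ xs)"
  proof (cases "n = 0")
    case True
    hence "e \<ge> 19" by (simp add: n_def)
    have "agree 19 (\<lambda>q. q ^ e * f q) (take 19 (replicate e 0 @ xs))"
      by (rule agree_take[OF 1])
    also have "take 19 (replicate e 0 @ xs) = replicate 19 0 @ []" using \<open>e \<ge> 19\<close> by simp
    finally have A: "agree 19 (\<lambda>q. q ^ e * f q) (replicate 19 0 @ [])" .
    have "agree 19 (\<lambda>q. q ^ e * f q) []"
      by (rule agree_cong_list[OF A, where zs = "[]"]) (simp only: ev_shift ev.simps mult_zero_right add_0_right)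
    thus ?thesis using True by simp
  qed (use 1 in simp)
  thus ?thesis
    unfolding f_def xs_def by (simp only: term_expansion.simps Let_def e_def[symmetric] n_def[symmetric])
qed

lemma agree_sum_list:
  assumes "\<And>t. t \<in> set ts \<Longrightarrow> agree n (G t) (g t)"
  shows "agree n (\<lambda>q. \<Sum>t\<leftarrow>ts. G t q) (foldr list_add (map g ts) [])"
  using assms
proof (induction ts)
  case Nil
  show ?case by (simp add: agree_def)
next
  case (Cons t ts)
  thus ?case by (simp add: agree_add)
qed

text \<open>The sum multiplied by \<open>q ^ 18\<close> is O(q^19). The one power beyond boundedness
  makes this factor, and with it the orbit product, tend to 0 at the cusp.\<close>

lemma modeq_bigo: "(\<lambda>q. modeq (ueta q / q) (ueta (q ^ 7) / q ^ 7)) \<in> O[at 0](\<lambda>q. q)"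
proof -
  define G where "G = (\<lambda>(c, i, j, k, l) q. q ^ (18 + k + 7 * l - (i + 7 * j)) * (of_int c *
      ((ueta (q ^ 7) ^ j * (1 / ueta (q ^ 7)) ^ l) * (ueta q ^ i * (1 / ueta q) ^ k))))"
  define S where "S q = (\<Sum>t\<leftarrow>modeq_terms. G t q)" for q
  have "agree 19 (G t) (term_expansion t)" for t
  proof -
    obtain c i j k l where t: "t = (c, i, j, k, l)" by (cases t)
    show ?thesis unfolding t G_def using agree_term_expansion by simp
  qed
  hence "agree 19 S (foldr list_add (map term_expansion modeq_terms) [])"
    unfolding S_def by (intro agree_sum_list)
  from agree_take[OF this] have "agree 19 S (replicate 19 0)"
    unfolding modeq_expansion .
  moreover have "ev (replicate 19 0) q = 0" for q using ev_shift[of 19 "[]" q] by (simp only: append_Nil2 ev.simps mult_zero_right)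
  ultimately have S: "S \<in> O[at 0](\<lambda>q. q ^ 19)" by (simp add: agree_def)
  have eq: "modeq (ueta q / q) (ueta (q ^ 7) / q ^ 7) = S q / q ^ 18" if q: "q \<noteq> 0" for q
  proof -
    let ?m = "\<lambda>(c, i, j, k, l). of_int c * (ueta q / q) ^ i * (ueta (q ^ 7) / q ^ 7) ^ j *
        (1 / (ueta q / q)) ^ k * (1 / (ueta (q ^ 7) / q ^ 7)) ^ l"
    \<comment> \<open>No monomial has pole order above 18, so the natural subtraction in the
      exponent of \<open>G\<close> is exact.\<close>
    have le: "\<forall>(c, i, j, k, l)\<in>set modeq_terms. i + 7 * j \<le> 18 + k + 7 * l"
      by (simp add: modeq_terms_def)
    have "?m t = G t q / q ^ 18" if "t \<in> set modeq_terms" for t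
    proof -
      obtain c i j k l where t: "t = (c, i, j, k, l)" by (cases t)
      define e where "e = 18 + k + 7 * l - (i + 7 * j)"
      have e: "e + (i + 7 * j) = 18 + (k + 7 * l)" using le that unfolding t e_def by auto
      hence "q ^ e * q ^ (i + 7 * j) = q ^ 18 * q ^ (k + 7 * l)" by (simp only: power_add[symmetric])
      hence "q ^ e / q ^ 18 = q ^ (k + 7 * l) / q ^ (i + 7 * j)" using q by (simp add: field_simps)
      hence w: "q ^ e / q ^ 18 = q ^ k * (q ^ 7) ^ l / (q ^ i * (q ^ 7) ^ j)" by (simp only: power_add power_mult)
      have "?m t = (q ^ k * (q ^ 7) ^ l / (q ^ i * (q ^ 7) ^ j)) * (of_int c *
        ((ueta (q ^ 7) ^ j * (1 / ueta (q ^ 7)) ^ l) * (ueta q ^ i * (1 / ueta q) ^ k)))"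
        unfolding t by (simp add: power_divide power_mult_distrib mult_ac)
      also have "\<dots> = G t q / q ^ 18"
        unfolding w[symmetric] unfolding t G_def e_def by simp
      finally show ?thesis .
    qed
    hence "(\<Sum>t\<leftarrow>modeq_terms. ?m t) = (\<Sum>t\<leftarrow>modeq_terms. G t q / q ^ 18)"
      by (intro arg_cong[where f = sum_list] map_cong refl)
    also have "\<dots> = S q / q ^ 18"
      unfolding S_def by (simp add: divide_inverse sum_list_mult_const)
    finally show ?thesis
      unfolding modeq_def modeq_poly_terms .
  qed
  have b: "(\<lambda>q. S q / q ^ 18) \<in> O[at 0](\<lambda>q. q ^ 19 / q ^ 18)"
    using S by (intro landau_o.big.divide_right) (auto simp: eventually_at_filter)
  have e1: "eventually (\<lambda>q::complex. q ^ 19 / q ^ 18 = q) (at 0)"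
    by (auto simp: eventually_at_filter eval_nat_numeral)
  have e2: "eventually (\<lambda>q. S q / q ^ 18 = modeq (ueta q / q) (ueta (q ^ 7) / q ^ 7)) (at 0)"
    using eq by (auto simp: eventually_at_filter)
  show "(\<lambda>q. modeq (ueta q / q) (ueta (q ^ 7) / q ^ 7)) \<in> O[at 0](\<lambda>q. q)"
    using b unfolding landau_o.big.cong[OF e1] landau_o.big.in_cong[OF e2] .
qed

text \<open>First-order expansions with complex coefficients, as needed at the cusps with a 7th root of unity.\<close>

definition agree2 :: "(complex \<Rightarrow> complex) \<Rightarrow> complex \<Rightarrow> complex \<Rightarrow> bool" where
  "agree2 f c d \<longleftrightarrow> (\<lambda>q. f q - (c + d * q)) \<in> O[at 0](\<lambda>q. q ^ 2)"

lemma linear_bigo: "(\<lambda>q. c + d * q :: complex) \<in> O[at 0](\<lambda>_. 1)"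
proof -
  have "((\<lambda>q. c + d * q) \<longlongrightarrow> c + d * 0) (at 0)" by (intro tendsto_intros)
  thus ?thesis by (intro bigoI_tendsto) auto
qed

lemma agree2_bigo:
  assumes "agree2 f c d"
  shows "f \<in> O[at 0](\<lambda>_. 1)"
proof -
  have "(\<lambda>q::complex. q ^ 2) \<in> O[at 0](\<lambda>_. 1)" using bigo_power_mono[of 0 2] by simp
  with assms have "(\<lambda>q. f q - (c + d * q)) \<in> O[at 0](\<lambda>_. 1)"
    unfolding agree2_def by (rule landau_o.big_trans)
  from sum_in_bigo(1)[OF this linear_bigo[of c d]] show ?thesis by simp
qed

lemma agree2_mult:
  assumes f: "agree2 f c d" and g: "agree2 g c' d'"
  shows "agree2 (\<lambda>q. f q * g q) (c * c') (c * d' + d * c')"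
proof -
  have "(\<lambda>q. (f q - (c + d * q)) * g q) \<in> O[at 0](\<lambda>q. q ^ 2 * 1)"
    using f agree2_bigo[OF g] unfolding agree2_def by (rule landau_o.big.mult)
  moreover have "(\<lambda>q. (c + d * q) * (g q - (c' + d' * q))) \<in> O[at 0](\<lambda>q. 1 * q ^ 2)"
    using linear_bigo g unfolding agree2_def by (rule landau_o.big.mult)
  moreover have "(\<lambda>q::complex. d * d' * q ^ 2) \<in> O[at 0](\<lambda>q. q ^ 2)"
    by simp
  ultimately have "(\<lambda>q. (f q - (c + d * q)) * g q + (c + d * q) * (g q - (c' + d' * q)) + d * d' * q ^ 2) \<in> O[at 0](\<lambda>q. q ^ 2)"
    by (intro sum_in_bigo(1)) auto
  also have "(\<lambda>q. (f q - (c + d * q)) * g q + (c + d * q) * (g q - (c' + d' * q)) + d * d' * q ^ 2) =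
     (\<lambda>q. f q * g q - (c * c' + (c * d' + d * c') * q))"
    by (simp add: fun_eq_iff algebra_simps power2_eq_square)
  finally show ?thesis by (simp only: agree2_def)
qed

lemma agree2_power: "agree2 f 1 d \<Longrightarrow> agree2 (\<lambda>q. f q ^ n) 1 (of_nat n * d)"
proof (induction n)
  case 0
  show ?case by (simp add: agree2_def)
next
  case (Suc n)
  from agree2_mult[OF Suc.prems Suc.IH[OF Suc.prems]] show ?case by (simp add: algebra_simps)
qed

lemma agree2_const: "agree2 (\<lambda>_. c) c 0"
  by (simp add: agree2_def)

lemma agree2_power_id: "agree2 (\<lambda>q. q ^ e) (of_bool (e = 0)) (of_bool (e = 1))"
proof -
  consider "e = 0" | "e = 1" | "e \<ge> 2" by linarith
  thus ?thesis
    by cases (use bigo_power_mono[of 2 e] in \<open>auto simp: agree2_def\<close>)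
qed

lemma agree2_add: "agree2 f c d \<Longrightarrow> agree2 g c' d' \<Longrightarrow> agree2 (\<lambda>q. f q + g q) (c + c') (d + d')"
  unfolding agree2_def by (drule (1) sum_in_bigo(1)) (simp add: algebra_simps)

lemma agree2_of_agree:
  assumes "agree (Suc (Suc n)) f (a # b # xs)"
  shows "agree2 f (of_int a) (of_int b)"
proof -
  have "agree 2 f (a # b # xs)" using assms by (rule agree_mono) simp
  from agree_take[OF this] have "agree 2 f [a, b]" by simp
  thus ?thesis by (simp add: agree_def agree2_def mult.commute)
qed

lemma agree2_compose_mult:
  assumes "agree2 f c d" "z \<noteq> 0"
  shows "agree2 (\<lambda>q. f (z * q)) c (d * z)"
proof -
  have "filterlim (\<lambda>q. z * q) (at 0) (at 0)"
    using assms(2) by (auto simp: filterlim_at eventually_at_filter intro!: tendsto_eq_intros)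
  hence "(\<lambda>q. f (z * q) - (c + d * (z * q))) \<in> O[at 0](\<lambda>q. (z * q) ^ 2)"
    using assms(1) unfolding agree2_def by (rule landau_o.big.compose[rotated])
  moreover have "(\<lambda>q. (z * q) ^ 2) \<in> O[at 0](\<lambda>q. q ^ 2)"
    by (simp add: power_mult_distrib)
  ultimately show ?thesis
    unfolding agree2_def by (auto dest: landau_o.big_trans simp: mult.assoc)
qed

lemma agree2_sum_list:
  assumes "\<And>t. t \<in> set ts \<Longrightarrow> agree2 (G t) (c t) (d t)"
  shows "agree2 (\<lambda>q. \<Sum>t\<leftarrow>ts. G t q) (\<Sum>t\<leftarrow>ts. c t) (\<Sum>t\<leftarrow>ts. d t)"
  using assms by (induction ts) (auto simp: agree2_add agree2_const)


text \<open>Here x has a simple pole and y a simple zero, and the monomials have poles of order at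
  most 2. So only two Laurent coefficients must vanish; they are polynomials in z and are reduced
  modulo 1 + z + ... + z^6.\<close>

lemma modeq_bounded:
  assumes z: "z ^ 7 = 1" "z \<noteq> 1"
  shows "(\<lambda>q. modeq (ueta q / q) (7 / (ueta (z * q) / (z * q)))) \<in> O[at 0](\<lambda>_. 1)"
proof -
  have z0: "z \<noteq> 0" using z by auto
  have "(z - 1) * (1 + z + z^2 + z^3 + z^4 + z^5 + z^6) = 0"
    using z(1) by (simp add: algebra_simps eval_nat_numeral)
  hence "1 + z + z^2 + z^3 + z^4 + z^5 + z^6 = 0"
    using z(2) by (simp only: mult_eq_0_iff right_minus_eq simp_thms)
  hence z6: "z ^ 6 = - (1 + z + z^2 + z^3 + z^4 + z^5)"
    by (simp only: eq_neg_iff_add_eq_0 add_ac)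
  have zs: "z ^ (7 + m) = z ^ m" for m by (simp add: power_add z)
  have zp: "z ^ 7 = 1" "z ^ 8 = z" "z ^ 9 = z ^ 2" "z ^ 12 = z ^ 5" "z ^ 13 = z ^ 6" "z ^ 18 = z ^ 4" "z ^ 19 = z ^ 5"
      "z ^ 24 = z ^ 3" "z ^ 25 = z ^ 4"
    using zs[of 0] zs[of 1] zs[of 2] zs[of 5] zs[of 6] zs[of 11] zs[of 12] zs[of 4] zs[of 17] zs[of 18] zs[of 10] zs[of 3] by simp_all
  define e where "e = (\<lambda>(c::int, i, j, k, l). 2 + j + k - (i + l) :: nat)"
  \<comment> \<open>Since y is 7 z q / \<open>ueta (z * q)\<close>, each factor y contributes 7 z
    and each b its inverse; z^(6 l) replaces z^(-l) to stay polynomial. Below, \<open>p\<close> is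
    the linear coefficient of the remaining product, as \<open>ueta\<close> starts with 1 -
    q.\<close>
  define \<kappa> where "\<kappa> = (\<lambda>(c::int, i::nat, j, k::nat, l). of_int c * (7 ^ j / 7 ^ l) * (z ^ j * z ^ (6 * l)))"
  define p where "p = (\<lambda>(c::int, i, j, k, l). of_nat k - of_nat i + of_nat j * z - of_nat l * z)"
  define G where "G = (\<lambda>t q. q ^ e t * (\<kappa> t * (case t of (c, i, j, k, l) \<Rightarrow>
      ((1 / ueta (z * q)) ^ j * ueta (z * q) ^ l) * (ueta q ^ i * (1 / ueta q) ^ k))))"
  define S where "S q = (\<Sum>t\<leftarrow>modeq_terms. G t q)" for q
  have G: "agree2 (G t) (of_bool (e t = 0) * \<kappa> t) (of_bool (e t = 0) * (\<kappa> t * p t) + of_bool (e t = 1) * \<kappa> t)" for t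
  proof -
    obtain c i j k l where t: "t = (c, i, j, k, l)" by (cases t)
    have u: "agree2 ueta 1 (-1)" "agree2 (\<lambda>q. 1 / ueta q) 1 1"
      using agree2_of_agree[of 17] agree_ueta agree_ueta_inv by fastforce+
    have u': "agree2 (\<lambda>q. ueta (z * q)) 1 (- z)" "agree2 (\<lambda>q. 1 / ueta (z * q)) 1 z"
      using agree2_compose_mult[OF u(1) z0] agree2_compose_mult[OF u(2) z0] by auto
    note m = agree2_mult[OF agree2_power_id[of "e t"] agree2_mult[OF agree2_const[of "\<kappa> t"]
      agree2_mult[OF agree2_mult[OF agree2_power[OF u'(2), of j] agree2_power[OF u'(1), of l]]
        agree2_mult[OF agree2_power[OF u(1), of i] agree2_power[OF u(2), of k]]]]]
    show ?thesis
      using m unfolding G_def p_def t by (simp add: algebra_simps)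
  qed
  have "agree2 S (\<Sum>t\<leftarrow>modeq_terms. of_bool (e t = 0) * \<kappa> t)
     (\<Sum>t\<leftarrow>modeq_terms. of_bool (e t = 0) * (\<kappa> t * p t) + of_bool (e t = 1) * \<kappa> t)"
    unfolding S_def by (rule agree2_sum_list) (rule G)
  \<comment> \<open>Seven monomials have pole order 2, and their coefficients add up to -49 (1 + z +
    ... + z^6).\<close>
  moreover have "(\<Sum>t\<leftarrow>modeq_terms. of_bool (e t = 0) * \<kappa> t) = 0"
    unfolding modeq_terms_def e_def \<kappa>_def
    by (simp add: zp flip: power_add, use z6 in algebra)
  moreover have "(\<Sum>t\<leftarrow>modeq_terms. of_bool (e t = 0) * (\<kappa> t * p t) + of_bool (e t = 1) * \<kappa> t) = 0"
    unfolding modeq_terms_def e_def \<kappa>_def p_def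
    by (simp add: zp flip: power_add, use z6 in algebra)
  ultimately have S: "S \<in> O[at 0](\<lambda>q. q ^ 2)" by (simp add: agree2_def)
  have eq: "modeq (ueta q / q) (7 / (ueta (z * q) / (z * q))) = S q / q ^ 2" if q: "q \<noteq> 0" for q
  proof -
    let ?m = "\<lambda>(c, i, j, k, l). of_int c * (ueta q / q) ^ i * (7 / (ueta (z * q) / (z * q))) ^ j *
        (1 / (ueta q / q)) ^ k * (1 / (7 / (ueta (z * q) / (z * q)))) ^ l"
    have le: "\<forall>(c, i, j, k, l)\<in>set modeq_terms. i + l \<le> 2 + j + k"
      by (simp add: modeq_terms_def)
    have "?m t = G t q / q ^ 2" if "t \<in> set modeq_terms" for t
    proof -
      obtain c i j k l where t: "t = (c, i, j, k, l)" by (cases t)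
      have e: "e t + (i + l) = 2 + (j + k)" using le that unfolding t e_def by auto
      hence "q ^ e t * q ^ (i + l) = q ^ 2 * q ^ (j + k)" by (simp only: power_add[symmetric])
      hence "q ^ e t / q ^ 2 = q ^ (j + k) / q ^ (i + l)" using q by (simp add: field_simps)
      hence w: "q ^ e t / q ^ 2 = q ^ j * q ^ k / (q ^ i * q ^ l)" by (simp only: power_add)
      have "z ^ (6 * l) * z ^ l = (z ^ 7) ^ l" by (simp flip: power_add power_mult)
      hence zl: "z ^ (6 * l) = 1 / z ^ l" using z z0 by (simp add: field_simps)
      have "?m t = (q ^ j * q ^ k / (q ^ i * q ^ l)) * (\<kappa> t *
        (((1 / ueta (z * q)) ^ j * ueta (z * q) ^ l) * (ueta q ^ i * (1 / ueta q) ^ k)))"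
        unfolding t \<kappa>_def zl prod.case by (simp add: power_divide power_mult_distrib mult_ac)
      also have "\<dots> = G t q / q ^ 2"
        unfolding w[symmetric] unfolding t G_def by simp
      finally show ?thesis .
    qed
    hence "(\<Sum>t\<leftarrow>modeq_terms. ?m t) = (\<Sum>t\<leftarrow>modeq_terms. G t q / q ^ 2)"
      by (intro arg_cong[where f = sum_list] map_cong refl)
    also have "\<dots> = S q / q ^ 2"
      unfolding S_def by (simp add: divide_inverse sum_list_mult_const)
    finally show ?thesis
      unfolding modeq_def modeq_poly_terms .
  qed
  have b: "(\<lambda>q. S q / q ^ 2) \<in> O[at 0](\<lambda>q. q ^ 2 / q ^ 2)"
    using S by (intro landau_o.big.divide_right) (auto simp: eventually_at_filter)
  have e1: "eventually (\<lambda>q::complex. q ^ 2 / q ^ 2 = 1) (at 0)"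
    by (auto simp: eventually_at_filter)
  have e2: "eventually (\<lambda>q. S q / q ^ 2 = modeq (ueta q / q) (7 / (ueta (z * q) / (z * q)))) (at 0)"
    using eq by (auto simp: eventually_at_filter)
  show ?thesis
    using b unfolding landau_o.big.cong[OF e1] landau_o.big.in_cong[OF e2] .
qed

section \<open>Vanishing of the modular equation\<close>

lemma hm_eq_ueta:
  assumes "Im \<tau> > 0"
  shows "hm \<tau> = ueta (exp (2 * pi * \<i> * \<tau>)) / exp (2 * pi * \<i> * \<tau>)"
proof -
  have "hm (of_nat 1 * \<tau>) = u_quot 1 (exp (2 * pi * \<i> * \<tau>))"
    by (rule u_quot_eq_hm[symmetric]) (use assms in auto)
  thus ?thesis by (simp add: u_quot_def f_sub_def ueta_def)
qed

lemma eventually_nome: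
  assumes "eventually P (at (0::complex))"
  shows "\<exists>Y>0. \<forall>\<tau>. Im \<tau> > Y \<longrightarrow> P (exp (2 * pi * \<i> * \<tau>))"
proof -
  obtain d where d: "d > 0" "\<And>q. q \<noteq> 0 \<Longrightarrow> dist q 0 < d \<Longrightarrow> P q"
    using assms unfolding eventually_at by auto
  define Y where "Y = max 1 (- ln d / (2 * pi))"
  have "P (exp (2 * pi * \<i> * \<tau>))" if "Im \<tau> > Y" for \<tau>
  proof (rule d(2))
    have "- ln d / (2 * pi) < Im \<tau>" using that by (simp add: Y_def)
    hence "- (2 * pi * Im \<tau>) < ln d" by (simp add: field_simps)
    hence "exp (- (2 * pi * Im \<tau>)) < exp (ln d)" by (simp only: exp_less_cancel_iff)
    thus "dist (exp (2 * pi * \<i> * \<tau>)) 0 < d" using d(1) by simp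
  qed simp
  moreover have "Y > 0" by (simp add: Y_def)
  ultimately show ?thesis by blast
qed

section \<open>Holomorphy of the fourteen factors and their behaviour at the cusp\<close>

lemma modeq_holomorphic [holomorphic_intros]:
  assumes "f holomorphic_on A" "g holomorphic_on A" "\<And>z. z \<in> A \<Longrightarrow> f z \<noteq> 0" "\<And>z. z \<in> A \<Longrightarrow> g z \<noteq> 0"
  shows "(\<lambda>z. modeq (f z) (g z)) holomorphic_on A"
  unfolding modeq_def modeq_poly_def by (intro holomorphic_intros assms)

lemma hm_mob_holomorphic:
  assumes "a > 0" "d > 0"
  shows "(\<lambda>\<tau>. hm (mob (a, b, 0, d) \<tau>)) holomorphic_on upper_half"
proof (rule hm_holomorphic')
  show "mob (a, b, 0, d) holomorphic_on upper_half"
  proof -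
    have "(\<lambda>\<tau>. (of_int a * \<tau> + of_int b) / of_int d) holomorphic_on upper_half"
      using assms by (intro holomorphic_intros) auto
    thus ?thesis by (simp add: moeb_def[abs_def] cong: holomorphic_cong)
  qed
qed (use mob_pos[OF _ assms] in auto)

lemma hm_mob_nonzero: "a > 0 \<Longrightarrow> d > 0 \<Longrightarrow> \<tau> \<in> upper_half \<Longrightarrow> hm (mob (a, b, 0, d) \<tau>) \<noteq> 0"
  by (intro hm_nonzero mob_pos) auto

lemma modeq_u_holomorphic: "(\<lambda>\<tau>. modeq (hm (mob (1, j, 0, 7) \<tau>)) (hm \<tau>)) holomorphic_on upper_half"
  by (intro modeq_holomorphic hm_mob_holomorphic hm_holomorphic hm_mob_nonzero) (auto simp: hm_nonzero)

lemma modeq_v_infinity_holomorphic: "(\<lambda>\<tau>. modeq (hm \<tau>) (hm (mob (7, 0, 0, 1) \<tau>))) holomorphic_on upper_half"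
  by (intro modeq_holomorphic hm_mob_holomorphic hm_holomorphic hm_mob_nonzero) (auto simp: hm_nonzero)

lemma modeq_v_holomorphic: "(\<lambda>\<tau>. modeq (hm \<tau>) (7 / hm (mob (7, k, 0, 7) \<tau>))) holomorphic_on upper_half"
proof (intro modeq_holomorphic hm_holomorphic)
  show "(\<lambda>\<tau>. 7 / hm (mob (7, k, 0, 7) \<tau>)) holomorphic_on upper_half"
    by (intro holomorphic_on_divide holomorphic_on_const hm_mob_holomorphic hm_mob_nonzero) auto
  show "7 / hm (mob (7, k, 0, 7) \<tau>) \<noteq> 0" if "\<tau> \<in> upper_half" for \<tau>
    using hm_mob_nonzero[OF _ _ that, of 7 7 k] by simp
qed (auto simp: hm_nonzero)

lemma modeq_orbit_holomorphic: "modeq_orbit holomorphic_on upper_half"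
  unfolding modeq_orbit_def[abs_def]
  by (intro holomorphic_on_mult modeq_u_holomorphic modeq_v_infinity_holomorphic modeq_v_holomorphic)

lemma exp_translate:
  "exp (2 * pi * \<i> * (\<tau> + of_int k / 7)) = exp (2 * pi * \<i> * of_int k / 7) * exp (2 * pi * \<i> * \<tau>)"
  by (simp add: exp_add[symmetric] algebra_simps)

lemma root_of_unity_7:
  assumes "k \<in> {1..6}"
  shows "exp (2 * pi * \<i> * of_int k / 7) ^ 7 = 1" "exp (2 * pi * \<i> * of_int k / 7) \<noteq> 1"
proof -
  have "exp (2 * pi * \<i> * of_int k / 7) ^ 7 = exp (of_int k * (2 * pi * \<i>))"
    using exp_of_nat_mult[of 7 "2 * pi * \<i> * of_int k / 7"] by (simp add: mult_ac)
  also have "of_int k * (2 * pi * \<i>) = 2 * of_int k * pi * \<i>" by simp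
  also have "exp (2 * of_int k * pi * \<i>) = 1" by (rule exp_integer_2pi) simp
  finally show "exp (2 * pi * \<i> * of_int k / 7) ^ 7 = 1" .
  show "exp (2 * pi * \<i> * of_int k / 7) \<noteq> 1"
  proof
    assume "exp (2 * pi * \<i> * of_int k / 7) = 1"
    then obtain n :: int where "2 * pi * of_int k / 7 = of_int (2 * n) * pi"
      unfolding exp_eq_1 by auto
    hence "real_of_int k = of_int (7 * n)" by (simp add: field_simps)
    hence "k = 7 * n" by (simp only: of_int_eq_iff)
    with assms have "1 \<le> 7 * n" "7 * n \<le> 6" by auto
    thus False by presburger
  qed
qed

text \<open>The factor at 7 \<tau> is O(q) and outweighs the six bounded ones. The other seven are
  the same function at (\<tau> + j) / 7 and need only be at most 1 in norm. These points are seven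
  times lower, whence the threshold \<open>7 * Y\<close>; periodicity of \<open>hm\<close>
  identifies their second argument.\<close>

lemma modeq_orbit_small:
  assumes "\<epsilon> > 0"
  shows "\<exists>Y>0. \<forall>\<tau>. Im \<tau> > Y \<longrightarrow> norm (modeq_orbit \<tau>) < \<epsilon>"
proof -
  define F where "F q = modeq (ueta q / q) (ueta (q ^ 7) / q ^ 7)" for q
  define \<zeta> where "\<zeta> k = exp (2 * pi * \<i> * of_int k / 7)" for k
  define B where "B k q = modeq (ueta q / q) (7 / (ueta (\<zeta> k * q) / (\<zeta> k * q)))" for k q
  have F: "F \<in> O[at 0](\<lambda>q. q)" unfolding F_def by (rule modeq_bigo)
  have B: "B k \<in> O[at 0](\<lambda>_. 1)" if "k \<in> {1..6}" for k
    unfolding B_def \<zeta>_def by (rule modeq_bounded) (rule root_of_unity_7[OF that])+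
  have "(\<lambda>q. F q * (B 1 q * (B 2 q * (B 3 q * (B 4 q * (B 5 q * B 6 q)))))) \<in> O[at 0](\<lambda>q. q * (1 * (1 * (1 * (1 * (1 * 1))))))"
    by (intro landau_o.big.mult F B) auto
  hence "((\<lambda>q. F q * (B 1 q * (B 2 q * (B 3 q * (B 4 q * (B 5 q * B 6 q)))))) \<longlongrightarrow> 0) (at 0)"
    by (intro bigo_id_tendsto_0) simp
  hence "eventually (\<lambda>q. norm (F q * (B 1 q * (B 2 q * (B 3 q * (B 4 q * (B 5 q * B 6 q)))))) < \<epsilon>) (at 0)"
    using assms by (simp add: tendsto_iff)
  moreover have "eventually (\<lambda>q. norm (F q) < 1) (at 0)"
    using bigo_id_tendsto_0[OF F] by (simp add: tendsto_iff)
  ultimately have "eventually (\<lambda>q. norm (F q * (B 1 q * (B 2 q * (B 3 q * (B 4 q * (B 5 q * B 6 q)))))) < \<epsilon> \<and> norm (F q) < 1) (at 0)"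
    by (rule eventually_conj)
  from eventually_nome[OF this] obtain Y where Y: "Y > 0"
    "\<And>\<tau>. Im \<tau> > Y \<Longrightarrow> norm (F (exp (2 * pi * \<i> * \<tau>)) * (B 1 (exp (2 * pi * \<i> * \<tau>)) * (B 2 (exp (2 * pi * \<i> * \<tau>)) *
      (B 3 (exp (2 * pi * \<i> * \<tau>)) * (B 4 (exp (2 * pi * \<i> * \<tau>)) * (B 5 (exp (2 * pi * \<i> * \<tau>)) * B 6 (exp (2 * pi * \<i> * \<tau>)))))))) < \<epsilon>"
    "\<And>\<tau>. Im \<tau> > Y \<Longrightarrow> norm (F (exp (2 * pi * \<i> * \<tau>))) < 1"
    by blast
  have FF: "F (exp (2 * pi * \<i> * \<tau>)) = modeq (hm \<tau>) (hm (7 * \<tau>))" if "Im \<tau> > 0" for \<tau>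
  proof -
    have "exp (2 * pi * \<i> * (7 * \<tau>)) = exp (2 * pi * \<i> * \<tau>) ^ 7"
      using exp_of_nat_mult[of 7 "2 * pi * \<i> * \<tau>"] by (simp add: mult_ac)
    thus ?thesis using hm_eq_ueta[of \<tau>] hm_eq_ueta[of "7 * \<tau>"] that by (simp add: F_def)
  qed
  have BB: "B k (exp (2 * pi * \<i> * \<tau>)) = modeq (hm \<tau>) (7 / hm (mob (7, k, 0, 7) \<tau>))" if "Im \<tau> > 0" for k \<tau>
  proof -
    have "mob (7, k, 0, 7) \<tau> = \<tau> + of_int k / 7" by (simp add: moeb_def field_simps)
    thus ?thesis using hm_eq_ueta[of \<tau>] hm_eq_ueta[of "\<tau> + of_int k / 7"] that
      unfolding exp_translate by (simp add: B_def \<zeta>_def)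
  qed
  have "norm (modeq_orbit \<tau>) < \<epsilon>" if t: "Im \<tau> > 7 * Y" for \<tau>
  proof -
    have t0: "Im \<tau> > 0" "Im \<tau> > Y" using t Y(1) by auto
    have A: "norm (modeq (hm (mob (1, j, 0, 7) \<tau>)) (hm \<tau>)) \<le> 1" for j
    proof -
      define \<sigma> where "\<sigma> = mob (1, j, 0, 7) \<tau>"
      have s: "Im \<sigma> > Y" using t by (simp add: \<sigma>_def moeb_def)
      have "7 * \<sigma> = \<tau> + of_int j" by (simp add: \<sigma>_def moeb_def)
      hence "hm \<tau> = hm (7 * \<sigma>)" by (simp add: hm_translate_int)
      thus ?thesis using Y(3)[OF s] FF[of \<sigma>] s Y(1) unfolding \<sigma>_def[symmetric] by simp
    qed
    have "norm (modeq_orbit \<tau>) = norm (modeq (hm (mob (1, 0, 0, 7) \<tau>)) (hm \<tau>)) * norm (modeq (hm (mob (1, 1, 0, 7) \<tau>)) (hm \<tau>)) *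
      norm (modeq (hm (mob (1, 2, 0, 7) \<tau>)) (hm \<tau>)) * norm (modeq (hm (mob (1, 3, 0, 7) \<tau>)) (hm \<tau>)) *
      norm (modeq (hm (mob (1, 4, 0, 7) \<tau>)) (hm \<tau>)) * norm (modeq (hm (mob (1, 5, 0, 7) \<tau>)) (hm \<tau>)) *
      norm (modeq (hm (mob (1, 6, 0, 7) \<tau>)) (hm \<tau>)) *
      norm (F (exp (2 * pi * \<i> * \<tau>)) * (B 1 (exp (2 * pi * \<i> * \<tau>)) * (B 2 (exp (2 * pi * \<i> * \<tau>)) *
      (B 3 (exp (2 * pi * \<i> * \<tau>)) * (B 4 (exp (2 * pi * \<i> * \<tau>)) * (B 5 (exp (2 * pi * \<i> * \<tau>)) * B 6 (exp (2 * pi * \<i> * \<tau>))))))))"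
      unfolding modeq_orbit_def BB[OF t0(1)] FF[OF t0(1)] norm_mult by (simp add: moeb_def mult_ac)
    also have "\<dots> \<le> 1 * 1 * 1 * 1 * 1 * 1 * 1 * norm (F (exp (2 * pi * \<i> * \<tau>)) * (B 1 (exp (2 * pi * \<i> * \<tau>)) * (B 2 (exp (2 * pi * \<i> * \<tau>)) *
      (B 3 (exp (2 * pi * \<i> * \<tau>)) * (B 4 (exp (2 * pi * \<i> * \<tau>)) * (B 5 (exp (2 * pi * \<i> * \<tau>)) * B 6 (exp (2 * pi * \<i> * \<tau>))))))))"
      by (intro mult_mono A mult_nonneg_nonneg norm_ge_zero zero_le_one order_refl)
    also have "\<dots> < \<epsilon>" using Y(2)[OF t0(2)] by simp
    finally show ?thesis .
  qed
  moreover have "7 * Y > 0" using Y(1) by simp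
  ultimately show ?thesis by blast
qed

text \<open>By \<open>reduction\<close> the maximum over the upper half-plane is attained on a compact set.\<close>

theorem modeq_orbit_zero:
  assumes "Im \<tau> > 0"
  shows "modeq_orbit \<tau> = 0"
proof (rule ccontr)
  assume "modeq_orbit \<tau> \<noteq> 0"
  define m where "m = norm (modeq_orbit \<tau>)"
  have "m > 0" using \<open>modeq_orbit \<tau> \<noteq> 0\<close> by (simp add: m_def)
  then obtain Y where Y: "Y > 0" "\<And>\<tau>. Im \<tau> > Y \<Longrightarrow> norm (modeq_orbit \<tau>) < m"
    using modeq_orbit_small by blast
  define K where "K = cbox (Complex 0 (1/50)) (Complex 1 Y)"
  have K_iff: "z \<in> K \<longleftrightarrow> 0 \<le> Re z \<and> Re z \<le> 1 \<and> 1/50 \<le> Im z \<and> Im z \<le> Y" for z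
    by (auto simp: K_def in_cbox_complex_iff)
  \<comment> \<open>Values of norm at least m do not occur above height Y, so the reduced point lies
    in the compact rectangle K.\<close>
  have red: "\<exists>z'\<in>K. modeq_orbit z' = modeq_orbit z" if z: "Im z > 0" "norm (modeq_orbit z) \<ge> m" for z
  proof -
    obtain z' where z': "Im z' \<ge> 1/50" "0 \<le> Re z'" "Re z' \<le> 1" "modeq_orbit z' = modeq_orbit z"
      using reduction[OF z(1)] by blast
    have "\<not> Im z' > Y" using Y(2)[of z'] z(2) z'(4) by auto
    thus ?thesis using z' by (intro bexI[of _ z']) (auto simp: K_iff)
  qed
  have "K \<subseteq> upper_half" by (auto simp: K_iff)
  hence "continuous_on K (\<lambda>z. norm (modeq_orbit z))"
    using holomorphic_on_imp_continuous_on[OF modeq_orbit_holomorphic]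
    by (intro continuous_on_norm) (rule continuous_on_subset)
  moreover have "compact K" by (simp add: K_def)
  moreover obtain z0 where z0: "z0 \<in> K" "modeq_orbit z0 = modeq_orbit \<tau>"
    using red[OF assms] by (auto simp: m_def)
  ultimately obtain \<xi> where \<xi>: "\<xi> \<in> K" "\<And>z. z \<in> K \<Longrightarrow> norm (modeq_orbit z) \<le> norm (modeq_orbit \<xi>)"
    using continuous_attains_sup[of K "\<lambda>z. norm (modeq_orbit z)"] by blast
  have m_le: "m \<le> norm (modeq_orbit \<xi>)" using \<xi>(2)[OF z0(1)] z0(2) by (simp add: m_def)
  have max: "norm (modeq_orbit z) \<le> norm (modeq_orbit \<xi>)" if zH: "z \<in> upper_half" for z
  proof (cases "norm (modeq_orbit z) \<ge> m")
    case True
    then obtain z' where "z' \<in> K" "modeq_orbit z' = modeq_orbit z" using red[of z] zH by blast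
    thus ?thesis using \<xi>(2)[of z'] by simp
  qed (use m_le in auto)
  have "modeq_orbit constant_on upper_half"
    by (rule maximum_modulus_principle[OF modeq_orbit_holomorphic upper_half_simps upper_half_simps(1) order_refl _ max])
       (use \<xi>(1) \<open>K \<subseteq> upper_half\<close> in auto)
  then obtain c where c: "\<And>z. Im z > 0 \<Longrightarrow> modeq_orbit z = c"
    unfolding constant_on_def by auto
  \<comment> \<open>The constant would have norm m at \<tau> but norm below m above height
    Y.\<close>
  have "modeq_orbit (Complex 0 (Y + 1)) = c" "modeq_orbit \<tau> = c"
    using c Y(1) assms by auto
  thus False using Y(2)[of "Complex 0 (Y + 1)"] by (simp add: m_def)
qed

text \<open>A nonzero holomorphic function on a connected open set has countably many zeros. In this
  form the fact singles out one identically vanishing factor of a vanishing product by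
  counting.\<close>

lemma uncountable_zeros_imp_zero:
  assumes "f holomorphic_on upper_half" "uncountable {z \<in> upper_half. f z = 0}" "Im z > 0"
  shows "f z = 0"
proof -
  have "(\<Union>n. {z. 1 / real (Suc n) \<le> Im z}) = upper_half"
  proof (intro equalityI subsetI)
    fix z assume "z \<in> upper_half"
    then obtain n where "1 / real (Suc n) < Im z" using nat_approx_posE by auto
    thus "z \<in> (\<Union>n. {z. 1 / real (Suc n) \<le> Im z})" by (auto intro: less_imp_le)
  qed (auto intro: less_le_trans[rotated])
  moreover have "fsigma (\<Union>n. {z. 1 / real (Suc n) \<le> Im z})"
    by (intro fsigma.intros closed_halfspace_Im_ge)
  ultimately have "fsigma upper_half" by simp
  from holomorphic_countable_equal[OF assms(1) holomorphic_on_const[of 0] upper_half_simps this] assms(2,3)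
  show ?thesis by auto
qed

text \<open>The fourteen zero sets cover an uncountable set, so one factor vanishes identically.
  Whichever it is, a substitution in \<tau> carries it to the factor in question.\<close>

theorem modeq_hm:
  assumes "Im \<tau> > 0"
  shows "modeq (hm \<tau>) (hm (7 * \<tau>)) = 0"
proof -
  define a where "a j \<tau> = modeq (hm (mob (1, j, 0, 7) \<tau>)) (hm \<tau>)" for j \<tau>
  define b where "b \<tau> = modeq (hm \<tau>) (hm (mob (7, 0, 0, 1) \<tau>))" for \<tau>
  define c where "c k \<tau> = modeq (hm \<tau>) (7 / hm (mob (7, k, 0, 7) \<tau>))" for k \<tau>
  define Z where "Z f = {z \<in> upper_half. f z = 0}" for f :: "complex \<Rightarrow> complex"
  have sub: "upper_half \<subseteq> (\<Union>j\<in>{0..6}. Z (a j)) \<union> Z b \<union> (\<Union>k\<in>{1..6}. Z (c k))"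
  proof
    fix z assume z: "z \<in> upper_half"
    have "(a 0 z * a 1 z * a 2 z * a 3 z * a 4 z * a 5 z * a 6 z) * (b z * c 1 z * c 2 z * c 3 z * c 4 z * c 5 z * c 6 z) = 0"
      using modeq_orbit_zero[of z] z unfolding modeq_orbit_def a_def b_def c_def by simp
    hence "(\<exists>j\<in>{0..6}. a j z = 0) \<or> b z = 0 \<or> (\<exists>k\<in>{1..6}. c k z = 0)"
      by auto
    thus "z \<in> (\<Union>j\<in>{0..6}. Z (a j)) \<union> Z b \<union> (\<Union>k\<in>{1..6}. Z (c k))"
      using z by (auto simp: Z_def)
  qed
  have unc: "uncountable ((\<Union>j\<in>{0..6}. Z (a j)) \<union> Z b \<union> (\<Union>k\<in>{1..6}. Z (c k)))"
    by (rule contrapos_nn[OF uncountable_halfspace_Im_gt[of 0] countable_subset[OF sub]])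
  have U: "(\<exists>j. uncountable (Z (a j))) \<or> uncountable (Z b) \<or> (\<exists>k\<in>{1..6}. uncountable (Z (c k)))"
  proof (rule ccontr)
    assume "\<not> ?thesis"
    hence "countable (Z (a j))" "countable (Z b)" "k \<in> {1..6} \<Longrightarrow> countable (Z (c k))" for j k
      by blast+
    hence "countable ((\<Union>j\<in>{0..6}. Z (a j)) \<union> Z b \<union> (\<Union>k\<in>{1..6}. Z (c k)))"
      by (intro countable_Un countable_UN countableI_type)
    with unc show False by contradiction
  qed
  have hol: "a j holomorphic_on upper_half" "b holomorphic_on upper_half" "c k holomorphic_on upper_half" for j k
    unfolding a_def b_def c_def by (rule modeq_u_holomorphic modeq_v_infinity_holomorphic modeq_v_holomorphic)+
  have za: "a j z = 0" if "uncountable (Z (a j))" "Im z > 0" for j z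
    using uncountable_zeros_imp_zero[OF hol(1)] that unfolding Z_def by blast
  have zb: "b z = 0" if "uncountable (Z b)" "Im z > 0" for z
    using uncountable_zeros_imp_zero[OF hol(2)] that unfolding Z_def by blast
  have zc: "c k z = 0" if "uncountable (Z (c k))" "Im z > 0" for k z
    using uncountable_zeros_imp_zero[OF hol(3)] that unfolding Z_def by blast
  from U consider (u) j where "uncountable (Z (a j))" | (v_inf) "uncountable (Z b)"
    | (v) k where "k \<in> {1..6}" "uncountable (Z (c k))"
    by (elim disjE exE bexE) (rule that; assumption)+
  hence "(\<exists>j. \<forall>z. Im z > 0 \<longrightarrow> a j z = 0) \<or> b \<tau> = 0"
  proof cases
    case (u j)
    thus ?thesis using za[OF u] by blast
  next
    case v_inf
    thus ?thesis using zb[OF v_inf assms] by blast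
  next
    case (v k)
    \<comment> \<open>\<open>W\<close> turns a factor of the second group into one of the first, by
      the pairing of \<open>hm_orbit_W\<close>; \<open>modeq_symmetry\<close> restores the order of
      the arguments.\<close>
    have W: "\<exists>j. \<forall>z. Im z > 0 \<longrightarrow> c k (mob (gen_mat W) z) = a j z"
    proof -
      have hmW: "hm (mob (gen_mat W) z) = 7 / hm z" if "Im z > 0" for z
        using hm_word(2)[OF that, of "[W]"] by simp
      have "k = 1 \<or> k = 2 \<or> k = 3 \<or> k = 4 \<or> k = 5 \<or> k = 6" using v(1) by auto
      thus ?thesis
        unfolding a_def c_def using hm_orbit_W(9-14) hmW
        by (elim disjE) (metis modeq_symmetry)+
    qed
    then obtain j where j: "\<And>z. Im z > 0 \<Longrightarrow> c k (mob (gen_mat W) z) = a j z" by blast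
    have "a j z = 0" if "Im z > 0" for z
      using j[OF that] zc[OF v(2) mob_gen_pos[OF that, of W]] by simp
    thus ?thesis by blast
  qed
  thus ?thesis
  proof
    assume "\<exists>j. \<forall>z. Im z > 0 \<longrightarrow> a j z = 0"
    then obtain j where j: "\<And>z. Im z > 0 \<Longrightarrow> a j z = 0" by blast
    \<comment> \<open>At 7 \<tau> - j the first argument becomes \<open>hm \<tau>\<close>, and the
      second is \<open>hm (7 * \<tau>)\<close> by periodicity.\<close>
    have "mob (1, j, 0, 7) (7 * \<tau> + of_int (- j)) = \<tau>" by (simp add: moeb_def)
    thus ?thesis
      using j[of "7 * \<tau> + of_int (- j)"] assms unfolding a_def hm_translate_int by simp
  next
    assume "b \<tau> = 0"
    thus ?thesis by (simp add: b_def moeb_def)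
  qed
qed

theorem theorem3p4:
  fixes q u1 u7 :: complex
  assumes "0 < norm q" and "norm q < 1"
    and "u1 = u_quot 1 q" and "u7 = u_quot 7 q"
  shows "u7 ^ 3 / u1 ^ 3 =
      161 * u7 ^ 2 / u1 + 112 * u7 ^ 2 / u1 ^ 2
    + 196 * (u1 * u7 + 49 / (u1 * u7))
    + 28 * (u1 ^ 2 * u7 ^ 2 + 7 ^ 4 / (u1 ^ 2 * u7 ^ 2))
    + 1372
    + 980 * u7 / u1 + 1127 * u7 / u1 ^ 2
    + (u1 ^ 4 * u7 ^ 2 + 7 ^ 6 / (u1 ^ 2 * u7 ^ 4))
    + 539 * (u7 + 7 / u1)
    + 343 * (u1 + 7 / u7)
    + 77 * (u7 ^ 2 * u1 + 7 ^ 3 / (u1 ^ 2 * u7))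
    + 49 * (u7 * u1 ^ 2 + 7 ^ 3 / (u1 * u7 ^ 2))
    + 7 * (u7 ^ 2 * u1 ^ 3 + 7 ^ 5 / (u1 ^ 2 * u7 ^ 3))
    + 49 * (u1 ^ 2 + 7 ^ 2 / u7 ^ 2)
    + 140 * (u7 ^ 2 + 7 ^ 2 / u1 ^ 2)
    + 7 * (u1 ^ 3 * u7 + 7 ^ 4 / (u1 * u7 ^ 3))
    + 343 * u1 / u7"
proof -
  \<comment> \<open>Any logarithm of q would serve; |q| < 1 places the point in the upper
    half-plane.\<close>
  define \<tau> where "\<tau> = Ln q / (2 * pi * \<i>)"
  have "q \<noteq> 0" using assms(1) by auto
  have q: "exp (2 * pi * \<i> * \<tau>) = q" using \<open>q \<noteq> 0\<close> by (simp add: \<tau>_def)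
  have "norm (exp (2 * pi * \<i> * \<tau>)) < 1" unfolding q by (rule assms(2))
  hence \<tau>: "Im \<tau> > 0" unfolding norm_nome by (simp add: zero_less_mult_iff)
  have "u1 = hm \<tau>" "u7 = hm (7 * \<tau>)"
    using u_quot_eq_hm[OF \<tau>, of 1] u_quot_eq_hm[OF \<tau>, of 7] assms(3,4) unfolding q by simp_all
  with modeq_hm[OF \<tau>] have "modeq u1 u7 = 0" by simp
  thus ?thesis
    unfolding modeq_def modeq_poly_def by (simp add: power_divide)
qed

end
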